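(* Let $f:S^1\to S^1$ be smooth and suppose $f$ has a finite number of stable periodic orbits $P_i$ of period $p_i$, $i=1,\dots,m_s$, and unstable periodic orbits $Q_i$ of period $q_i$, $i=1,\dots,m_u$. Let $c_{s,i}=(f^{p_i})'(x_i)$ for some $x_i\in P_i$ and $c_{u,i}=(f^{q_i})'(y_i)$ for some $y_i\in Q_i$. Assume in addition that for every $x\in S^1\setminus\bigcup_{i=1}^{m_u}Q_i$ the orbit $f^n(x)$ converges to $\bigcup_{i=1}^{m_s}P_i$ as $n\to\infty$ (i.e. its distance to this set tends to $0$). Then for every $r>0$ one can decompose $T^\varepsilon=T^\varepsilon_{up}+T^\varepsilon_{lp}$ into bounded linear operators on $B(S^1)$ so that, for all sufficiently small $\varepsilon>0$, $\|T^\varepsilon_{lp}\|_\infty<r$ and any eigenvalue of $T^\varepsilon_{up}$ with modulus greater than $r$ is of the form $\lambda+O(\varepsilon)$ (as $\varepsilon\to0$, with constant depending on $r$ but not on $\varepsilon$), where either (i) $\lambda=(c_{s,i}^{\,j})^{1/p_i}$ for some $i\in\{1,\dots,m_s\}$ and $j\ge0$, or (ii) $\lambda=(|c_{u,i}|^{-1}c_{u,i}^{-j})^{1/q_i}$ for some $i\in\{1,\dots,m_u\}$ and $j\ge0$, and all branches of the $p_i$-th and $q_i$-th roots are allowed.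
   Context: $S^1=\mathbb R/(2\pi\mathbb Z)$; $B(S^1)$ is the space of bounded Borel measurable functions on $S^1$ with sup-norm $\|\cdot\|_\infty$, and $\|\cdot\|_\infty$ also denotes the induced operator norm (eigenvalues are understood over $\mathbb C$, i.e. after complexification). $\sigma\in C^\infty(S^1)$ satisfies $0<\sigma_{lb}<\sigma(x)<\sigma_{ub}$ for all $x$, with constants $\sigma_{lb},\sigma_{ub}$. For $\varepsilon>0$, $T^\varepsilon$ is the transition operator of the Markov chain $X^\varepsilon_{n+1}=f(X^\varepsilon_n)+\varepsilon\sigma(X^\varepsilon_n)\chi_n \bmod 2\pi$, with $\chi_n$ i.i.d. standard normal; that is, $T^\varepsilon\phi(x)=\mathbb E[\phi(f(x)+\varepsilon\sigma(x)\chi)]=\int_{S^1}\phi(y)\tilde p^\varepsilon(x,y)\,dy$, where $\tilde p^\varepsilon(x,y)=\sum_{n\in\mathbb Z}\frac{1}{\sqrt{2\pi}\,\varepsilon\sigma(x)}e^{-(y+2\pi n-f(x))^2/(2\sigma^2(x)\varepsilon^2)}$ (real representatives of $y$ and $f(x)$; the sum does not depend on the choice). $f^p$ is the $p$-th iterate of $f$. A periodic orbit of period $p$ through $x_0$ is stable if $|(f^p)'(x_0)|<1$ and unstable if $|(f^p)'(x_0)|>1$. *)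

theory Defs
  imports "HOL-Probability.Probability"
begin

section \<open>The circle\<close>

definition same_angle :: "real \<Rightarrow> real \<Rightarrow> bool"
  where "same_angle s t \<longleftrightarrow> (\<exists>k::int. s = t + 2 * pi * of_int k)"

lemma equivp_same_angle: "equivp same_angle"
proof (rule equivpI)
  show "reflp same_angle"
    by (rule reflpI) (auto simp: same_angle_def intro!: exI[of _ 0])
  show "symp same_angle"
  proof (rule sympI)
    fix s t assume "same_angle s t"
    then obtain k :: int where "s = t + 2 * pi * of_int k" by (auto simp: same_angle_def)
    then have "t = s + 2 * pi * of_int (- k)" by simp
    then show "same_angle t s" unfolding same_angle_def by blast
  qed
  show "transp same_angle"
  proof (rule transpI)
    fix s t u assume "same_angle s t" "same_angle t u"
    then obtain k l :: int where "s = t + 2 * pi * of_int k" "t = u + 2 * pi * of_int l"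
      by (auto simp: same_angle_def)
    then have "s = u + 2 * pi * of_int (k + l)" by (simp add: algebra_simps)
    then show "same_angle s u" unfolding same_angle_def by blast
  qed
qed

quotient_type circle = real / same_angle
  morphisms rep_circle to_circle
  by (rule equivp_same_angle)

lemma to_circle_eq_iff: "to_circle s = to_circle t \<longleftrightarrow> (\<exists>k::int. s = t + 2 * pi * of_int k)"
  unfolding circle.abs_eq_iff same_angle_def ..

lemma circle_cases [cases type: circle]:
  obtains t where "x = to_circle t"
proof -
  have "\<exists>t. x = to_circle t" by (induct x rule: circle.abs_induct) blast
  then show ?thesis using that by blast
qed

instantiation circle :: ab_group_add
begin

lift_definition zero_circle :: circle is "0 :: real" .

lift_definition plus_circle :: "circle \<Rightarrow> circle \<Rightarrow> circle" is "(+)"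
proof -
  fix s s' t t' assume "same_angle s s'" "same_angle t t'"
  then obtain k l :: int where "s = s' + 2 * pi * of_int k" "t = t' + 2 * pi * of_int l"
    by (auto simp: same_angle_def)
  then have "s + t = s' + t' + 2 * pi * of_int (k + l)" by (simp add: algebra_simps)
  then show "same_angle (s + t) (s' + t')" unfolding same_angle_def by blast
qed

lift_definition uminus_circle :: "circle \<Rightarrow> circle" is uminus
proof -
  fix s s' assume "same_angle s s'"
  then obtain k :: int where "s = s' + 2 * pi * of_int k"
    by (auto simp: same_angle_def)
  then have "- s = - s' + 2 * pi * of_int (- k)" by simp
  then show "same_angle (- s) (- s')" unfolding same_angle_def by blast
qed

definition minus_circle :: "circle \<Rightarrow> circle \<Rightarrow> circle"
  where "x - y = x + - (y :: circle)"

instance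
proof
  fix x y z :: circle
  have r: "same_angle s s" for s using equivp_same_angle by (simp add: equivp_reflp)
  show "x + y + z = x + (y + z)" by transfer (simp add: r add.assoc)
  show "x + y = y + x" by transfer (simp add: r add.commute)
  show "0 + x = x" by transfer (simp add: r)
  show "- x + x = 0" by transfer (simp add: r)
  show "x - y = x + - y" by (rule minus_circle_def)
qed

end

lemma to_circle_add: "to_circle (s + t) = to_circle s + to_circle t"
  by (simp add: plus_circle.abs_eq)

lemma to_circle_minus: "to_circle (- t) = - to_circle t"
  by (simp add: uminus_circle.abs_eq)

lemma to_circle_0 [simp]: "to_circle 0 = 0"
  by (simp add: zero_circle.abs_eq)

definition angle_norm :: "real \<Rightarrow> real"
  where "angle_norm t = (INF k::int. \<bar>t + 2 * pi * of_int k\<bar>)"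

lemma angle_norm_le: "angle_norm t \<le> \<bar>t + 2 * pi * of_int k\<bar>"
  unfolding angle_norm_def by (rule cINF_lower) (auto intro!: bdd_belowI[of _ 0])

lemma angle_norm_attained: "\<exists>k::int. angle_norm t = \<bar>t + 2 * pi * of_int k\<bar>"
proof -
  define k where "k = - round (t / (2 * pi))"
  have *: "\<bar>t + 2 * pi * of_int j\<bar> = 2 * pi * \<bar>t / (2 * pi) - of_int (- j)\<bar>" for j :: int
  proof -
    have "t + 2 * pi * of_int j = 2 * pi * (t / (2 * pi) - of_int (- j))"
      by (simp add: field_simps)
    then show ?thesis by (simp add: abs_mult)
  qed
  have "\<bar>t + 2 * pi * of_int k\<bar> \<le> \<bar>t + 2 * pi * of_int j\<bar>" for j :: int
    unfolding * k_def using round_diff_minimal[of "t / (2 * pi)" "- j"]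
    by (intro mult_left_mono) simp_all
  then have "\<bar>t + 2 * pi * of_int k\<bar> \<le> angle_norm t"
    unfolding angle_norm_def by (intro cINF_greatest) auto
  with angle_norm_le[of t k] show ?thesis by (intro exI[of _ k]) simp
qed

lemma angle_norm_cong: "same_angle s t \<Longrightarrow> angle_norm s = angle_norm t"
proof (rule antisym)
  have *: "angle_norm s \<le> angle_norm t" if st: "same_angle s t" for s t
  proof -
    obtain k :: int where k: "angle_norm t = \<bar>t + 2 * pi * of_int k\<bar>"
      using angle_norm_attained by blast
    obtain l :: int where l: "s = t + 2 * pi * of_int l"
      using st by (auto simp: same_angle_def)
    show ?thesis using angle_norm_le[of s "k - l"] by (simp add: k l algebra_simps)
  qed
  assume "same_angle s t"
  then show "angle_norm s \<le> angle_norm t" "angle_norm t \<le> angle_norm s"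
    using * equivp_same_angle by (blast dest: equivp_symp)+
qed

lemma angle_norm_eq_0_iff: "angle_norm t = 0 \<longleftrightarrow> same_angle t 0"
proof
  assume "angle_norm t = 0"
  then obtain k :: int where "t + 2 * pi * of_int k = 0"
    using angle_norm_attained[of t] by auto
  then have "t = 0 + 2 * pi * of_int (- k)" by simp
  then show "same_angle t 0" unfolding same_angle_def by blast
next
  assume "same_angle t 0"
  then have "angle_norm t = angle_norm 0" by (rule angle_norm_cong)
  also have "\<dots> = 0"
    using angle_norm_attained[of 0] angle_norm_le[of 0 0] by auto
  finally show "angle_norm t = 0" .
qed

lemma angle_norm_minus: "angle_norm (- t) = angle_norm t"
proof (rule antisym)
  have *: "angle_norm (- t) \<le> angle_norm t" for t
  proof -
    obtain k :: int where "angle_norm t = \<bar>t + 2 * pi * of_int k\<bar>"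
      using angle_norm_attained by blast
    then show ?thesis using angle_norm_le[of "- t" "- k"] by simp
  qed
  show "angle_norm (- t) \<le> angle_norm t" by (rule *)
  show "angle_norm t \<le> angle_norm (- t)" using *[of "- t"] by simp
qed

lemma angle_norm_triangle: "angle_norm (s + t) \<le> angle_norm s + angle_norm t"
proof -
  obtain k l :: int where k: "angle_norm s = \<bar>s + 2 * pi * of_int k\<bar>"
    and l: "angle_norm t = \<bar>t + 2 * pi * of_int l\<bar>"
    using angle_norm_attained by meson
  have "angle_norm (s + t) \<le> \<bar>(s + t) + 2 * pi * of_int (k + l)\<bar>" by (rule angle_norm_le)
  also have "(s + t) + 2 * pi * of_int (k + l) = (s + 2 * pi * of_int k) + (t + 2 * pi * of_int l)"
    by (simp add: algebra_simps)
  also have "\<bar>\<dots>\<bar> \<le> angle_norm s + angle_norm t" unfolding k l by (rule abs_triangle_ineq)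
  finally show ?thesis .
qed

instantiation circle :: metric_space
begin

lift_definition dist_circle :: "circle \<Rightarrow> circle \<Rightarrow> real" is "\<lambda>s t. angle_norm (s - t)"
proof -
  fix s s' t t' assume "same_angle s s'" "same_angle t t'"
  then obtain k l :: int where "s = s' + 2 * pi * of_int k" "t = t' + 2 * pi * of_int l"
    by (auto simp: same_angle_def)
  then have "s - t = s' - t' + 2 * pi * of_int (k - l)" by (simp add: algebra_simps)
  then show "angle_norm (s - t) = angle_norm (s' - t')"
    by (intro angle_norm_cong) (unfold same_angle_def, blast)
qed

definition uniformity_circle :: "(circle \<times> circle) filter"
  where "uniformity_circle = (INF e\<in>{0 <..}. principal {(x, y). dist x y < e})"

definition open_circle :: "circle set \<Rightarrow> bool"
  where "open_circle S \<longleftrightarrow> (\<forall>x\<in>S. \<forall>\<^sub>F (x', y) in uniformity. x' = x \<longrightarrow> y \<in> S)"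

instance
proof
  fix x y z :: circle
  show "dist x y = 0 \<longleftrightarrow> x = y"
    by transfer (simp add: angle_norm_eq_0_iff same_angle_def algebra_simps)
  show "dist x y \<le> dist x z + dist y z"
  proof transfer
    fix s t u :: real
    show "angle_norm (s - t) \<le> angle_norm (s - u) + angle_norm (t - u)"
      using angle_norm_triangle[of "s - u" "u - t"] angle_norm_minus[of "t - u"] by simp
  qed
qed (rule uniformity_circle_def open_circle_def)+

end

lemma dist_to_circle: "dist (to_circle s) (to_circle t) = (INF k::int. \<bar>s - t + 2 * pi * of_int k\<bar>)"
  by (simp add: dist_circle.abs_eq angle_norm_def)

lemma dist_to_circle_le: "dist (to_circle s) (to_circle t) \<le> \<bar>s - t\<bar>"
  using angle_norm_le[of "s - t" 0] by (simp add: dist_circle.abs_eq)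

lemma continuous_on_to_circle [continuous_intros]:
  "continuous_on A g \<Longrightarrow> continuous_on A (\<lambda>x. to_circle (g x))"
proof -
  have "continuous_on UNIV to_circle"
    unfolding continuous_on_iff
    by (metis dist_to_circle_le dist_real_def order_le_less_trans)
  then show "continuous_on A g \<Longrightarrow> continuous_on A (\<lambda>x. to_circle (g x))"
    by (rule continuous_on_compose2) auto
qed

lemma open_to_circle_image:
  assumes "open U" shows "open (to_circle ` U)"
  unfolding open_dist
proof
  fix x assume "x \<in> to_circle ` U"
  then obtain t where t: "t \<in> U" "x = to_circle t" by auto
  obtain e where e: "e > 0" "\<And>s. dist s t < e \<Longrightarrow> s \<in> U"
    using assms t(1) unfolding open_dist by blast
  have "y \<in> to_circle ` U" if y: "dist y x < e" for y
  proof (cases y)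
    fix s assume s: "y = to_circle s"
    obtain k :: int where k: "angle_norm (s - t) = \<bar>s - t + 2 * pi * of_int k\<bar>"
      using angle_norm_attained by blast
    have "dist (s + 2 * pi * of_int k) t < e"
      using y k unfolding s t(2) dist_circle.abs_eq dist_real_def by (simp add: algebra_simps)
    then have "s + 2 * pi * of_int k \<in> U" by (rule e(2))
    moreover have "y = to_circle (s + 2 * pi * of_int k)"
      unfolding s to_circle_eq_iff by (intro exI[of _ "- k"]) simp
    ultimately show ?thesis by blast
  qed
  with e(1) show "\<exists>e>0. \<forall>y. dist y x < e \<longrightarrow> y \<in> to_circle ` U" by blast
qed

lemma continuous_on_circleI:
  fixes g :: "circle \<Rightarrow> 'a::topological_space"
  assumes "continuous_on UNIV (\<lambda>t. g (to_circle t))"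
  shows "continuous_on UNIV g"
  unfolding continuous_on_open_vimage[OF open_UNIV]
proof (intro allI impI)
  fix B :: "'a set" assume "open B"
  then have "open ((\<lambda>t. g (to_circle t)) -` B)"
    using assms continuous_on_open_vimage[OF open_UNIV] by fastforce
  then have "open (to_circle ` ((\<lambda>t. g (to_circle t)) -` B))" by (rule open_to_circle_image)
  also have "to_circle ` ((\<lambda>t. g (to_circle t)) -` B) = g -` B \<inter> UNIV"
  proof safe
    fix x assume "g x \<in> B"
    then show "x \<in> to_circle ` ((\<lambda>t. g (to_circle t)) -` B)" by (cases x) auto
  qed auto
  finally show "open (g -` B \<inter> UNIV)" .
qed

instance circle :: second_countable_topology
proof
  obtain B :: "real set set" where B: "countable B" "topological_basis B"
    using ex_countable_basis by blast
  have "topological_basis ((`) to_circle ` B)"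
  proof (rule topological_basisI)
    fix V assume "V \<in> (`) to_circle ` B"
    then show "open V" using B(2) by (auto intro!: open_to_circle_image topological_basis_open)
  next
    fix O' :: "circle set" and x assume O': "open O'" "x \<in> O'"
    obtain t where t: "x = to_circle t" by (cases x)
    have "open (to_circle -` O')"
      using continuous_on_to_circle[OF continuous_on_id, of UNIV] O'(1)
      by (simp add: continuous_on_open_vimage)
    then obtain V where "V \<in> B" "t \<in> V" "V \<subseteq> to_circle -` O'"
      using topological_basisE[OF B(2), of "to_circle -` O'" t] O'(2) t by auto
    then show "\<exists>B'\<in>(`) to_circle ` B. x \<in> B' \<and> B' \<subseteq> O'"
      unfolding t by (intro bexI[of _ "to_circle ` V"]) auto
  qed
  then show "\<exists>B::circle set set. countable B \<and> open = generate_topology B"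
    using B(1) by (intro exI[of _ "(`) to_circle ` B"])
      (auto intro!: topological_basis_imp_subbasis)
qed

instance circle :: topological_monoid_add
proof
  fix a b :: circle
  have *: "dist (x + y) (a + b) \<le> dist x a + dist y b" for x y :: circle
  proof transfer
    fix x y a b :: real
    show "angle_norm (x + y - (a + b)) \<le> angle_norm (x - a) + angle_norm (y - b)"
      using angle_norm_triangle[of "x - a" "y - b"] by (simp add: algebra_simps)
  qed
  have "((\<lambda>p. dist (fst p) a + dist (snd p) b) \<longlongrightarrow> dist a a + dist b b) (nhds a \<times>\<^sub>F nhds b)"
    by (intro tendsto_intros filterlim_fst filterlim_snd)
  then have lim: "((\<lambda>p. dist (fst p) a + dist (snd p) b) \<longlongrightarrow> 0) (nhds a \<times>\<^sub>F nhds b)"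
    by simp
  have "((\<lambda>p. dist (fst p + snd p) (a + b)) \<longlongrightarrow> 0) (nhds a \<times>\<^sub>F nhds b)"
  proof (rule tendsto_sandwich[OF _ _ tendsto_const lim])
    show "\<forall>\<^sub>F p in nhds a \<times>\<^sub>F nhds b. 0 \<le> dist (fst p + snd p) (a + b)"
      by (intro always_eventually allI zero_le_dist)
    show "\<forall>\<^sub>F p in nhds a \<times>\<^sub>F nhds b. dist (fst p + snd p) (a + b) \<le> dist (fst p) a + dist (snd p) b"
      by (intro always_eventually allI *)
  qed
  then show "((\<lambda>p. fst p + snd p) \<longlongrightarrow> a + b) (nhds a \<times>\<^sub>F nhds b)"
    by (rule tendsto_dist_iff[THEN iffD2])
qed

lemma borel_measurable_to_circle [measurable]: "to_circle \<in> borel_measurable borel"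
proof (rule borel_measurable_continuous_onI)
  show "continuous_on UNIV to_circle"
    using continuous_on_to_circle[of UNIV "\<lambda>t. t"] by (simp add: continuous_on_id)
qed


section \<open>Smooth maps and derivatives on the circle\<close>

definition smooth_real :: "(real \<Rightarrow> real) \<Rightarrow> bool"
  where "smooth_real F \<longleftrightarrow> (\<forall>n t. (deriv ^^ n) F differentiable (at t))"

definition smooth_circle_fun :: "(circle \<Rightarrow> real) \<Rightarrow> bool"
  where "smooth_circle_fun g \<longleftrightarrow> smooth_real (\<lambda>t. g (to_circle t))"

text \<open>A map of the circle is smooth iff it has a smooth lift to the universal cover.\<close>

definition smooth_circle_map :: "(circle \<Rightarrow> circle) \<Rightarrow> bool"
  where "smooth_circle_map f \<longleftrightarrow>
    (\<exists>F. smooth_real F \<and> (\<forall>t. f (to_circle t) = to_circle (F t)))"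

text \<open>The derivative is that of a local representative of \<open>g\<close> in angular coordinates.\<close>

definition has_circle_deriv :: "(circle \<Rightarrow> circle) \<Rightarrow> real \<Rightarrow> circle \<Rightarrow> bool"
  where "has_circle_deriv g D x \<longleftrightarrow>
    (\<exists>t G. x = to_circle t \<and> (\<forall>\<^sub>F s in nhds t. g (to_circle s) = to_circle (G s)) \<and>
      (G has_real_derivative D) (at t))"

definition circle_deriv :: "(circle \<Rightarrow> circle) \<Rightarrow> circle \<Rightarrow> real"
  where "circle_deriv g x = (THE D. has_circle_deriv g D x)"

lemma has_circle_deriv_unique:
  assumes "has_circle_deriv g D x" "has_circle_deriv g E x"
  shows "D = E"
proof -
  obtain t G where t: "x = to_circle t" "\<forall>\<^sub>F s in nhds t. g (to_circle s) = to_circle (G s)"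
    "(G has_real_derivative D) (at t)"
    using assms(1) unfolding has_circle_deriv_def by blast
  obtain u H where u: "x = to_circle u" "\<forall>\<^sub>F s in nhds u. g (to_circle s) = to_circle (H s)"
    "(H has_real_derivative E) (at u)"
    using assms(2) unfolding has_circle_deriv_def by blast
  obtain k :: int where k: "u = t + 2 * pi * of_int k"
    using t(1) u(1) to_circle_eq_iff by metis
  define c where "c = 2 * pi * of_int k"
  have per: "to_circle (s + c) = to_circle s" for s
    unfolding c_def to_circle_eq_iff by blast
  define H' where "H' s = H (s + c)" for s
  have H': "(H' has_real_derivative E) (at t)"
    using u(3) unfolding k H'_def c_def[symmetric] by (simp add: DERIV_shift)
  have "((\<lambda>s. s + c) \<longlongrightarrow> u) (nhds t)"
    unfolding k c_def[symmetric] by (intro tendsto_intros filterlim_ident)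
  then have "\<forall>\<^sub>F s in nhds t. g (to_circle (s + c)) = to_circle (H (s + c))"
    using u(2) unfolding filterlim_iff by blast
  then have ev: "\<forall>\<^sub>F s in nhds t. to_circle (G s) = to_circle (H' s)"
    using t(2) by eventually_elim (simp add: per H'_def)
  define d where "d s = G s - H' s" for s
  have d: "(d has_real_derivative D - E) (at t)"
    unfolding d_def by (intro DERIV_diff t(3) H')
  then have "isCont d t" by (rule DERIV_isCont)
  then have "(d \<longlongrightarrow> d t) (nhds t)" by (simp add: tendsto_nhds_iff isCont_def)
  then have close: "\<forall>\<^sub>F s in nhds t. dist (d s) (d t) < 2 * pi"
    by (rule tendstoD) simp
  obtain l :: int where l: "d t = 2 * pi * of_int l"
    using eventually_nhds_x_imp_x[OF ev] unfolding to_circle_eq_iff d_def by (auto simp: algebra_simps)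
  have "\<forall>\<^sub>F s in nhds t. d s = d t"
    using ev close
  proof eventually_elim
    case (elim s)
    obtain j :: int where j: "d s = 2 * pi * of_int j"
      using elim(1) unfolding to_circle_eq_iff d_def by (auto simp: algebra_simps)
    have "dist (d s) (d t) = 2 * pi * \<bar>of_int (j - l)\<bar>"
      unfolding j l dist_real_def by (simp add: abs_mult flip: right_diff_distrib)
    with elim(2) have "\<bar>of_int (j - l) :: real\<bar> < 1" by simp
    then have "j = l" by linarith
    then show ?case by (simp add: j l)
  qed
  then have "((\<lambda>_. d t) has_real_derivative D - E) (at t)"
    using d DERIV_cong_ev[OF refl _ refl, of d "\<lambda>_. d t" t "D - E"] by simp
  then have "D - E = 0" by (rule DERIV_unique) simp
  then show ?thesis by simp
qed

lemma circle_deriv_eq: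
  assumes "\<And>s. g (to_circle s) = to_circle (G s)" "(G has_real_derivative D) (at t)"
  shows "circle_deriv g (to_circle t) = D"
  unfolding circle_deriv_def
proof (rule the_equality)
  show "has_circle_deriv g D (to_circle t)"
    unfolding has_circle_deriv_def using assms by (auto intro!: exI[of _ t] exI[of _ G])
  then show "E = D" if "has_circle_deriv g E (to_circle t)" for E
    using that has_circle_deriv_unique by blast
qed

lemma smooth_real_continuous:
  assumes "smooth_real F" shows "continuous_on UNIV F"
proof -
  have "(deriv ^^ 0) F differentiable (at t)" for t
    using assms unfolding smooth_real_def by blast
  then show ?thesis
    by (intro continuous_at_imp_continuous_on ballI differentiable_imp_continuous_within) simp
qed

lemma smooth_circle_fun_measurable:
  assumes "smooth_circle_fun g" shows "g \<in> borel_measurable borel"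
proof (rule borel_measurable_continuous_onI)
  show "continuous_on UNIV g"
    using assms unfolding smooth_circle_fun_def
    by (intro continuous_on_circleI[of g] smooth_real_continuous)
qed

lemma smooth_circle_map_measurable:
  assumes "smooth_circle_map f" shows "f \<in> borel_measurable borel"
proof -
  obtain F where F: "smooth_real F" "\<And>t. f (to_circle t) = to_circle (F t)"
    using assms unfolding smooth_circle_map_def by blast
  have "continuous_on UNIV (\<lambda>t. f (to_circle t))"
    unfolding F(2) by (rule continuous_on_to_circle[OF smooth_real_continuous[OF F(1)]])
  then show ?thesis
    by (intro borel_measurable_continuous_onI continuous_on_circleI[of f])
qed


section \<open>Periodic orbits\<close>

definition least_period :: "('a \<Rightarrow> 'a) \<Rightarrow> nat \<Rightarrow> 'a \<Rightarrow> bool"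
  where "least_period f p x \<longleftrightarrow>
    0 < p \<and> (f ^^ p) x = x \<and> (\<forall>k. 0 < k \<and> k < p \<longrightarrow> (f ^^ k) x \<noteq> x)"

definition stable_orbit :: "(circle \<Rightarrow> circle) \<Rightarrow> nat \<Rightarrow> circle set \<Rightarrow> bool"
  where "stable_orbit f p A \<longleftrightarrow>
    (\<exists>x. least_period f p x \<and> A = (\<lambda>k. (f ^^ k) x) ` {..<p} \<and> \<bar>circle_deriv (f ^^ p) x\<bar> < 1)"

definition unstable_orbit :: "(circle \<Rightarrow> circle) \<Rightarrow> nat \<Rightarrow> circle set \<Rightarrow> bool"
  where "unstable_orbit f p A \<longleftrightarrow>
    (\<exists>x. least_period f p x \<and> A = (\<lambda>k. (f ^^ k) x) ` {..<p} \<and> \<bar>circle_deriv (f ^^ p) x\<bar> > 1)"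

text \<open>The nonemptiness condition is needed because \<open>infdist x {} = 0\<close>.\<close>

definition orbit_converges_to :: "('a::metric_space \<Rightarrow> 'a) \<Rightarrow> 'a \<Rightarrow> 'a set \<Rightarrow> bool"
  where "orbit_converges_to f x A \<longleftrightarrow> A \<noteq> {} \<and> (\<lambda>n. infdist ((f ^^ n) x) A) \<longlonglongrightarrow> 0"


section \<open>Bounded Borel functions on the circle\<close>

typedef bborel = "{\<phi> :: circle \<Rightarrow> real. \<phi> \<in> borel_measurable borel \<and> bounded (range \<phi>)}"
  morphisms apply_bborel Bborel
  by (rule exI[of _ "\<lambda>_. 0"]) simp

setup_lifting type_definition_bborel

lemma bborel_eqI: "(\<And>x. apply_bborel \<phi> x = apply_bborel \<psi> x) \<Longrightarrow> \<phi> = \<psi>"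
  by (simp add: apply_bborel_inject[symmetric] fun_eq_iff)

lemma apply_bborel_measurable [measurable]: "apply_bborel \<phi> \<in> borel_measurable borel"
  using apply_bborel[of \<phi>] by simp

lemma bounded_apply_bborel: "bounded (range (apply_bborel \<phi>))"
  using apply_bborel[of \<phi>] by simp

instantiation bborel :: real_vector
begin

lift_definition zero_bborel :: bborel is "\<lambda>_. 0" by simp

lift_definition plus_bborel :: "bborel \<Rightarrow> bborel \<Rightarrow> bborel" is "\<lambda>\<phi> \<psi> x. \<phi> x + \<psi> x"
  by (auto intro: bounded_plus_comp)

lift_definition uminus_bborel :: "bborel \<Rightarrow> bborel" is "\<lambda>\<phi> x. - \<phi> x"
  by (auto simp: bounded_iff)

lift_definition minus_bborel :: "bborel \<Rightarrow> bborel \<Rightarrow> bborel" is "\<lambda>\<phi> \<psi> x. \<phi> x - \<psi> x"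
  by (auto intro: bounded_minus_comp)

lift_definition scaleR_bborel :: "real \<Rightarrow> bborel \<Rightarrow> bborel" is "\<lambda>c \<phi> x. c * \<phi> x"
  using bounded_scaleR_comp[where 'b = real] by auto

instance
proof
  fix a b :: real and \<phi> \<psi> \<rho> :: bborel
  note rep = plus_bborel.rep_eq uminus_bborel.rep_eq minus_bborel.rep_eq zero_bborel.rep_eq
    scaleR_bborel.rep_eq
  show "\<phi> + \<psi> + \<rho> = \<phi> + (\<psi> + \<rho>)" by (rule bborel_eqI) (simp add: rep)
  show "\<phi> + \<psi> = \<psi> + \<phi>" by (rule bborel_eqI) (simp add: rep)
  show "0 + \<phi> = \<phi>" by (rule bborel_eqI) (simp add: rep)
  show "- \<phi> + \<phi> = 0" by (rule bborel_eqI) (simp add: rep)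
  show "\<phi> - \<psi> = \<phi> + - \<psi>" by (rule bborel_eqI) (simp add: rep)
  show "a *\<^sub>R (\<phi> + \<psi>) = a *\<^sub>R \<phi> + a *\<^sub>R \<psi>"
    by (rule bborel_eqI) (simp add: rep distrib_left)
  show "(a + b) *\<^sub>R \<phi> = a *\<^sub>R \<phi> + b *\<^sub>R \<phi>"
    by (rule bborel_eqI) (simp add: rep distrib_right)
  show "a *\<^sub>R b *\<^sub>R \<phi> = (a * b) *\<^sub>R \<phi>" by (rule bborel_eqI) (simp add: rep)
  show "1 *\<^sub>R \<phi> = \<phi>" by (rule bborel_eqI) (simp add: rep)
qed

end

instantiation bborel :: real_normed_vector
begin

lift_definition norm_bborel :: "bborel \<Rightarrow> real" is "\<lambda>\<phi>. SUP x. \<bar>\<phi> x\<bar>" .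

definition dist_bborel :: "bborel \<Rightarrow> bborel \<Rightarrow> real"
  where "dist_bborel \<phi> \<psi> = norm (\<phi> - \<psi>)"

definition sgn_bborel :: "bborel \<Rightarrow> bborel"
  where "sgn_bborel \<phi> = \<phi> /\<^sub>R norm \<phi>"

definition uniformity_bborel :: "(bborel \<times> bborel) filter"
  where "uniformity_bborel = (INF e\<in>{0 <..}. principal {(x, y). dist x y < e})"

definition open_bborel :: "bborel set \<Rightarrow> bool"
  where "open_bborel S \<longleftrightarrow> (\<forall>x\<in>S. \<forall>\<^sub>F (x', y) in uniformity. x' = x \<longrightarrow> y \<in> S)"

lemma abs_apply_bborel_le: "\<bar>apply_bborel \<phi> x\<bar> \<le> norm \<phi>"
proof -
  have "bounded (range (\<lambda>x. \<bar>apply_bborel \<phi> x\<bar>))"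
    using bounded_apply_bborel[of \<phi>] by (auto simp: bounded_iff)
  then show ?thesis
    unfolding norm_bborel.rep_eq by (intro cSUP_upper bounded_imp_bdd_above) auto
qed

lemma norm_bborel_le: "(\<And>x. \<bar>apply_bborel \<phi> x\<bar> \<le> b) \<Longrightarrow> norm \<phi> \<le> b"
  unfolding norm_bborel.rep_eq by (rule cSUP_least) auto

instance
proof
  fix \<phi> \<psi> :: bborel and c :: real
  show "norm \<phi> = 0 \<longleftrightarrow> \<phi> = 0"
  proof
    assume "norm \<phi> = 0"
    then have "apply_bborel \<phi> x = 0" for x using abs_apply_bborel_le[of \<phi> x] by simp
    then show "\<phi> = 0" by (intro bborel_eqI) (simp add: zero_bborel.rep_eq)
  qed (simp add: norm_bborel.rep_eq zero_bborel.rep_eq)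
  show "norm (\<phi> + \<psi>) \<le> norm \<phi> + norm \<psi>"
  proof (rule norm_bborel_le)
    fix x
    show "\<bar>apply_bborel (\<phi> + \<psi>) x\<bar> \<le> norm \<phi> + norm \<psi>"
      using abs_apply_bborel_le[of \<phi> x] abs_apply_bborel_le[of \<psi> x]
      by (simp add: plus_bborel.rep_eq)
  qed
  have le: "norm (c *\<^sub>R \<phi>) \<le> \<bar>c\<bar> * norm \<phi>" for c :: real and \<phi> :: bborel
    by (rule norm_bborel_le)
      (simp add: scaleR_bborel.rep_eq abs_mult mult_left_mono abs_apply_bborel_le)
  show "norm (c *\<^sub>R \<phi>) = \<bar>c\<bar> * norm \<phi>"
  proof (cases "c = 0")
    case True
    then show ?thesis by (simp add: norm_bborel.rep_eq zero_bborel.rep_eq)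
  next
    case False
    have "norm \<phi> = norm (inverse c *\<^sub>R (c *\<^sub>R \<phi>))" using False by simp
    also have "\<dots> \<le> \<bar>inverse c\<bar> * norm (c *\<^sub>R \<phi>)" by (rule le)
    finally have "\<bar>c\<bar> * norm \<phi> \<le> norm (c *\<^sub>R \<phi>)"
      using False by (simp add: field_simps)
    with le[of c \<phi>] show ?thesis by simp
  qed
qed (rule dist_bborel_def sgn_bborel_def uniformity_bborel_def open_bborel_def)+

end

text \<open>
  \<open>\<mu>\<close> is an eigenvalue of the complexification of \<open>A\<close>: the two equations are the real and
  imaginary parts of \<open>A (u + \<i> v) = \<mu> (u + \<i> v)\<close>.
\<close>

definition complex_eigenvalue :: "('a::real_normed_vector \<Rightarrow>\<^sub>L 'a) \<Rightarrow> complex \<Rightarrow> bool"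
  where "complex_eigenvalue A \<mu> \<longleftrightarrow>
    (\<exists>u v. (u \<noteq> 0 \<or> v \<noteq> 0) \<and>
      blinfun_apply A u = Re \<mu> *\<^sub>R u - Im \<mu> *\<^sub>R v \<and>
      blinfun_apply A v = Im \<mu> *\<^sub>R u + Re \<mu> *\<^sub>R v)"


section \<open>The transition operator\<close>

definition transition_fun ::
  "(circle \<Rightarrow> circle) \<Rightarrow> (circle \<Rightarrow> real) \<Rightarrow> real \<Rightarrow> (circle \<Rightarrow> real) \<Rightarrow> circle \<Rightarrow> real"
  where "transition_fun f \<sigma> \<epsilon> \<phi> x =
    (\<integral>z. \<phi> (f x + to_circle (\<epsilon> * \<sigma> x * z)) \<partial>std_normal_distribution)"

definition transition_op ::
  "(circle \<Rightarrow> circle) \<Rightarrow> (circle \<Rightarrow> real) \<Rightarrow> real \<Rightarrow> bborel \<Rightarrow>\<^sub>L bborel"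
  where "transition_op f \<sigma> \<epsilon> = Blinfun (\<lambda>\<phi>. Bborel (transition_fun f \<sigma> \<epsilon> (apply_bborel \<phi>)))"

text \<open>
  \<open>Blinfun\<close> and \<open>Bborel\<close> are only meaningful on bounded linear maps and on bounded Borel
  functions; the following shows that this is the case here.
\<close>

lemma transition_op_apply:
  assumes [measurable]: "f \<in> borel_measurable borel" "\<sigma> \<in> borel_measurable borel"
  shows "apply_bborel (blinfun_apply (transition_op f \<sigma> \<epsilon>) \<phi>) =
    transition_fun f \<sigma> \<epsilon> (apply_bborel \<phi>)"
proof -
  interpret N: prob_space std_normal_distribution
    by (rule prob_space_normal_density) simp
  have int: "integrable std_normal_distribution
      (\<lambda>z. apply_bborel \<phi> (f x + to_circle (\<epsilon> * \<sigma> x * z)))" for \<phi> x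
    by (rule N.integrable_const_bound[where B = "norm \<phi>"])
      (auto simp: abs_apply_bborel_le)
  have le: "\<bar>transition_fun f \<sigma> \<epsilon> (apply_bborel \<phi>) x\<bar> \<le> norm \<phi>" for \<phi> x
  proof -
    have "\<bar>transition_fun f \<sigma> \<epsilon> (apply_bborel \<phi>) x\<bar> \<le>
        (\<integral>z. \<bar>apply_bborel \<phi> (f x + to_circle (\<epsilon> * \<sigma> x * z))\<bar> \<partial>std_normal_distribution)"
      unfolding transition_fun_def by (rule integral_abs_bound)
    also have "\<dots> \<le> (\<integral>z. norm \<phi> \<partial>std_normal_distribution)"
      by (intro integral_mono integrable_abs int) (auto simp: abs_apply_bborel_le)
    also have "\<dots> = norm \<phi>" using N.prob_space by simp
    finally show ?thesis .
  qed
  have meas: "transition_fun f \<sigma> \<epsilon> (apply_bborel \<phi>) \<in> borel_measurable borel" for \<phi>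
    unfolding transition_fun_def by (intro N.borel_measurable_lebesgue_integral) measurable
  have B: "apply_bborel (Bborel (transition_fun f \<sigma> \<epsilon> (apply_bborel \<phi>))) =
      transition_fun f \<sigma> \<epsilon> (apply_bborel \<phi>)" for \<phi>
    using le[of \<phi>] meas[of \<phi>] by (intro Bborel_inverse) (auto simp: bounded_iff)
  have "bounded_linear (\<lambda>\<phi>. Bborel (transition_fun f \<sigma> \<epsilon> (apply_bborel \<phi>)))"
  proof (rule bounded_linear_intro[where K = 1])
    fix \<phi> \<psi> :: bborel and c :: real
    show "Bborel (transition_fun f \<sigma> \<epsilon> (apply_bborel (\<phi> + \<psi>))) =
        Bborel (transition_fun f \<sigma> \<epsilon> (apply_bborel \<phi>)) +
        Bborel (transition_fun f \<sigma> \<epsilon> (apply_bborel \<psi>))"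
      by (rule bborel_eqI, unfold B)
        (simp add: B plus_bborel.rep_eq, simp add: transition_fun_def int)
    show "Bborel (transition_fun f \<sigma> \<epsilon> (apply_bborel (c *\<^sub>R \<phi>))) =
        c *\<^sub>R Bborel (transition_fun f \<sigma> \<epsilon> (apply_bborel \<phi>))"
      by (rule bborel_eqI, unfold B)
        (simp add: B scaleR_bborel.rep_eq, simp add: transition_fun_def)
    show "norm (Bborel (transition_fun f \<sigma> \<epsilon> (apply_bborel \<phi>))) \<le> norm \<phi> * 1"
      by (rule norm_bborel_le) (simp add: B le)
  qed
  then show ?thesis
    unfolding transition_op_def by (simp add: bounded_linear_Blinfun_apply B)
qed

end

theory Submission
  imports Defs
begin

text \<open>
  The upper part can be chosen so that its nonzero eigenvalues are exactly the numbers in the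
  theorem, so the \<open>O(\<epsilon>)\<close> error is 0.  Replace the Gaussian noise by a compactly supported
  \<open>C\<^sup>1\<close> noise \<open>\<rho>\<close> that is close to it in \<open>L\<^sup>1\<close> and, within distance of order \<open>\<epsilon>\<close> of the
  periodic points, replace \<open>f\<close> by its linearization and \<open>\<sigma>\<close> by a constant.  For small \<open>\<epsilon>\<close> this
  changes the transition operator by less than \<open>r\<close>.

  Let \<open>\<phi>\<close> be an eigenfunction for \<open>\<mu> \<noteq> 0\<close>.  The windows around a stable orbit are mapped into each
  other.  There the \<open>j\<close>-th derivatives of \<open>\<phi>\<close> satisfy the same equation with an extra factor
  \<open>c\<^sup>j\<close> per period, so they vanish for large \<open>j\<close>; if \<open>j\<close> is the first order at which they
  vanish, the derivatives of order \<open>j - 1\<close> are constants, and \<open>\<mu>\<^sup>p\<close> is the corresponding power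
  of \<open>c\<close>.  If \<open>\<mu>\<close> is not of this form, \<open>\<phi>\<close> vanishes on the stable windows, hence at every point
  all of whose noisy orbits reach these windows, that is, outside the windows of the unstable
  orbits.  On an unstable window the adjoint of the operator acts triangularly on polynomials:
  the first nonvanishing moment of \<open>\<phi>\<close>, of order \<open>j\<close>, is multiplied by
  \<open>\<bar>c\<bar>\<^sup>-\<^sup>1 c\<^sup>-\<^sup>j\<close> per period.  If all moments vanish, \<open>\<phi> = 0\<close> by Weierstrass approximation.
\<close>

section \<open>Affine cycles with compactly supported noise\<close>

text \<open>The operator norm is controlled by the L1 distance of the noise laws at each starting
  point, so the noise may be recentred and rescaled as long as the changes are small compared with
  its amplitude, which is of order \<epsilon>. This dictates windows of radius proportional to
  \<epsilon>: there the linearization error of f and the variation of \<sigma> cost only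
  o(\<epsilon>), whereas on windows of fixed size the linearization error would in general dwarf the
  noise. Gaussian noise leaves every small window with positive probability; bounded noise makes
  stable windows exactly invariant and lets unstable windows be stretched exactly over their
  successors. A multiplier controls f only over a whole period, so window radii carry weights
  \<kappa> that give contraction or expansion at every single step. Constants are fixed in the order
  r, then \<rho> with its support radius R, the tolerance \<nu>, the weights \<kappa> with rate
  \<theta>, the window size K, and \<epsilon> last. The number r enters only through the size of the
  lower part; the eigenvalue argument needs nothing but \<open>\<mu> \<noteq> 0\<close>.\<close>

lemma cycle_le:
  fixes X g :: "'a \<Rightarrow> real"
  assumes "\<And>a. a \<in> A \<Longrightarrow> f a \<in> A" "\<And>a. a \<in> A \<Longrightarrow> 0 \<le> g a" "0 \<le> m"
    and "\<And>a. a \<in> A \<Longrightarrow> m * X a \<le> g a * X (f a)" "a \<in> A"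
  shows "(f ^^ n) a \<in> A \<and> m ^ n * X a \<le> (\<Prod>k<n. g ((f ^^ k) a)) * X ((f ^^ n) a)"
proof (induction n)
  case (Suc n)
  have "m ^ Suc n * X a = m * (m ^ n * X a)" by simp
  also have "\<dots> \<le> m * ((\<Prod>k<n. g ((f ^^ k) a)) * X ((f ^^ n) a))"
    using Suc assms(3) by (intro mult_left_mono) auto
  also have "\<dots> = (\<Prod>k<n. g ((f ^^ k) a)) * (m * X ((f ^^ n) a))" by simp
  also have "\<dots> \<le> (\<Prod>k<n. g ((f ^^ k) a)) * (g ((f ^^ n) a) * X (f ((f ^^ n) a)))"
  proof (intro mult_left_mono prod_nonneg)
    show "0 \<le> g ((f ^^ k) a)" for k
      using assms(1,5) by (intro assms(2), induction k) auto
  qed (use assms(4) Suc in blast)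
  finally show ?case using Suc assms(1) by (simp add: mult.assoc)
qed (use assms in auto)

text \<open>Taken over a period, both cycle lemmas return to the starting point, so a one-step
  relation becomes one whose factor is a product along the orbit. This is how multipliers, rather
  than single derivatives, enter the condition on \<mu>.\<close>

lemma cycle_eq:
  fixes X g :: "'a \<Rightarrow> 'b::comm_monoid_mult"
  assumes "\<And>a. a \<in> A \<Longrightarrow> f a \<in> A"
    and "\<And>a. a \<in> A \<Longrightarrow> m * X a = g a * X (f a)" "a \<in> A"
  shows "(f ^^ n) a \<in> A \<and> m ^ n * X a = (\<Prod>k<n. g ((f ^^ k) a)) * X ((f ^^ n) a)"
proof (induction n)
  case (Suc n)
  have "m ^ Suc n * X a = m * (m ^ n * X a)" by (simp add: mult.assoc)
  also have "\<dots> = (\<Prod>k<n. g ((f ^^ k) a)) * (m * X ((f ^^ n) a))"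
    using Suc by (simp add: mult.left_commute)
  also have "\<dots> = (\<Prod>k<n. g ((f ^^ k) a)) * (g ((f ^^ n) a) * X (f ((f ^^ n) a)))"
    using assms(2) Suc by simp
  finally show ?case using Suc assms(1) by (simp add: mult.assoc)
qed (use assms in auto)

text \<open>Eigenfunctions are at first merely measurable, so derivatives have to fall on the
  density; this is why it is C1. R measures how far one step can stray in units of the noise
  amplitude.\<close>

locale compact_noise =
  fixes \<rho> \<rho>' :: "real \<Rightarrow> real" and R :: real
  assumes R_pos: "0 < R"
    and deriv: "\<And>w. (\<rho> has_real_derivative \<rho>' w) (at w)"
    and cont': "continuous_on UNIV \<rho>'"
    and nonneg: "\<And>w. 0 \<le> \<rho> w"
    and support: "\<And>w. R \<le> \<bar>w\<bar> \<Longrightarrow> \<rho> w = 0"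
    and mass: "integral\<^sup>L lborel \<rho> = 1"
begin

lemma cont: "continuous_on UNIV \<rho>"
  using deriv by (intro continuous_at_imp_continuous_on) (auto intro: DERIV_isCont)

lemma cont_comp [continuous_intros]:
  "continuous_on S g \<Longrightarrow> continuous_on S (\<lambda>x. \<rho> (g x))"
  using continuous_on_compose2[OF cont] by auto

lemma cont'_comp [continuous_intros]:
  "continuous_on S g \<Longrightarrow> continuous_on S (\<lambda>x. \<rho>' (g x))"
  using continuous_on_compose2[OF cont'] by auto

lemma measurable_noise [measurable]: "\<rho> \<in> borel_measurable borel"
  by (rule borel_measurable_continuous_onI[OF cont])

text \<open>The Bochner integral of a nonintegrable function is 0 by convention, so
  \<open>mass\<close> already forces integrability.\<close>

lemma integrable_noise: "integrable lborel \<rho>"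
  using mass not_integrable_integral_eq by force

lemma noise_outside: "w \<notin> {-R..R} \<Longrightarrow> \<rho> w = 0"
  by (rule support) auto

text \<open>Leibniz' rule is applied to gauge integrals over intervals, while the eigenvalue
  equation is a Lebesgue integral over the line; compact support reconciles the two.\<close>

lemma integral_noise: "integral {-R..R} \<rho> = 1"
proof -
  have i: "indicator {-R..R} w *\<^sub>R \<rho> w = \<rho> w" for w
    using noise_outside[of w] by (auto simp: indicator_def)
  show ?thesis
    using set_borel_integral_eq_integral(2)[of "{-R..R}" \<rho>] integrable_noise mass
    unfolding set_integrable_def set_lebesgue_integral_def i by simp
qed

lemma noise_bound: obtains M where "0 \<le> M" "\<And>w. \<rho> w \<le> M"
proof -
  have "compact (\<rho> ` {-R..R})"
    by (intro compact_continuous_image continuous_intros) auto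
  then obtain M where M: "\<And>x. x \<in> {-R..R} \<Longrightarrow> \<bar>\<rho> x\<bar> \<le> M" "0 \<le> M"
    using compact_imp_bounded bounded_pos by (metis image_eqI real_norm_def less_imp_le)
  have "\<rho> w \<le> M" for w
    using M(1)[of w] M(2) support[of w] by (cases "R \<le> \<bar>w\<bar>") (simp, force)
  with M that show ?thesis by blast
qed

lemma integrable_noise_mult:
  fixes g :: "real \<Rightarrow> 'b::{banach, second_countable_topology}"
  assumes [measurable]: "g \<in> borel_measurable borel" and "\<And>w. norm (g w) \<le> B"
  shows "integrable lborel (\<lambda>w. \<rho> w *\<^sub>R g w)"
proof (rule Bochner_Integration.integrable_bound[where f = "\<lambda>w. B * \<rho> w"])
  show "AE w in lborel. norm (\<rho> w *\<^sub>R g w) \<le> norm (B * \<rho> w)"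
  proof (intro AE_I2)
    fix w
    have "0 \<le> B" using assms(2)[of w] norm_ge_zero order_trans by blast
    then show "norm (\<rho> w *\<^sub>R g w) \<le> norm (B * \<rho> w)"
      using assms(2)[of w] nonneg[of w] by (simp add: abs_mult mult_left_mono mult.commute[of B])
  qed
qed (use integrable_noise in auto)

lemma norm_noise_integral_le:
  fixes g :: "real \<Rightarrow> 'b::{banach, second_countable_topology}"
  assumes [measurable]: "g \<in> borel_measurable borel"
    and B: "\<And>w. \<bar>w\<bar> < R \<Longrightarrow> norm (g w) \<le> B"
  shows "norm (\<integral>w. \<rho> w *\<^sub>R g w \<partial>lborel) \<le> B"
proof -
  have "norm (\<integral>w. \<rho> w *\<^sub>R g w \<partial>lborel) \<le> (\<integral>w. B * \<rho> w \<partial>lborel)"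
  proof (rule Bochner_Integration.integral_norm_bound_integral)
    have 1: "norm (\<rho> w *\<^sub>R g w) \<le> B * \<rho> w" for w
      using B[of w] nonneg[of w] support[of w]
      by (cases "\<bar>w\<bar> < R") (auto simp: mult_left_mono mult.commute[of B])
    then show "norm (\<rho> w *\<^sub>R g w) \<le> B * \<rho> w" for w .
    show "integrable lborel (\<lambda>w. B * \<rho> w)" using integrable_noise by simp
    have "norm (\<rho> w *\<^sub>R g w) \<le> norm (B * \<rho> w)" for w
      using 1[of w] by simp
    then show "integrable lborel (\<lambda>w. \<rho> w *\<^sub>R g w)"
      by (intro Bochner_Integration.integrable_bound[OF \<open>integrable lborel (\<lambda>w. B * \<rho> w)\<close>]) auto
  qed
  then show ?thesis by (simp add: mass)
qed

text \<open>The substitution y = x + s w moves x from g, about whose regularity nothing is known,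
  into the density.\<close>

lemma noise_integral_affine:
  fixes g :: "real \<Rightarrow> 'b::{banach, second_countable_topology}"
  assumes "0 < s"
  shows "(\<integral>w. \<rho> w *\<^sub>R g (x + s * w) \<partial>lborel) = (\<integral>y. (\<rho> ((y - x) / s) / s) *\<^sub>R g y \<partial>lborel)"
proof -
  have "(\<integral>y. (\<rho> ((y - x) / s) / s) *\<^sub>R g y \<partial>lborel) =
      \<bar>s\<bar> *\<^sub>R (\<integral>w. (\<rho> ((x + s * w - x) / s) / s) *\<^sub>R g (x + s * w) \<partial>lborel)"
    using assms by (intro lborel_integral_real_affine) simp
  also have "\<dots> = \<bar>s\<bar> *\<^sub>R (\<integral>w. (1/s) *\<^sub>R (\<rho> w *\<^sub>R g (x + s * w)) \<partial>lborel)"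
    using assms by (intro arg_cong[where f="(*\<^sub>R) \<bar>s\<bar>"] Bochner_Integration.integral_cong) auto
  also have "\<dots> = (\<integral>w. \<rho> w *\<^sub>R g (x + s * w) \<partial>lborel)"
    using assms by (subst integral_scaleR_right) simp
  finally show ?thesis by simp
qed

end

text \<open>In the application A is a periodic orbit, c and s are the derivative of the map and the
  noise amplitude at its points, C is the multiplier, and \<open>\<Phi> a z\<close> is, up to
  truncation, the value of the eigenfunction at a + \<epsilon> z. The equation is demanded only for
  z in the window of a, although its right side may see \<open>\<Phi> (f a)\<close> beyond the
  window of \<open>f a\<close>.\<close>

locale noise_cycle = compact_noise +
  fixes A :: "'a set" and f :: "'a \<Rightarrow> 'a" and c s K :: "'a \<Rightarrow> real"
    and p :: nat and C :: real and \<mu> :: complex and \<Phi> :: "'a \<Rightarrow> real \<Rightarrow> complex" and B :: real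
  assumes inv: "\<And>a. a \<in> A \<Longrightarrow> f a \<in> A"
    and per: "\<And>a. a \<in> A \<Longrightarrow> (f ^^ p) a = a"
    and multiplier: "\<And>a. a \<in> A \<Longrightarrow> (\<Prod>k<p. c ((f ^^ k) a)) = C"
    and s_pos: "\<And>a. a \<in> A \<Longrightarrow> 0 < s a"
    and K_pos: "\<And>a. a \<in> A \<Longrightarrow> 0 < K a"
    and \<mu>_nz: "\<mu> \<noteq> 0"
    and meas: "\<And>a. a \<in> A \<Longrightarrow> \<Phi> a \<in> borel_measurable borel"
    and bdd: "\<And>a z. a \<in> A \<Longrightarrow> norm (\<Phi> a z) \<le> B"
    and eigen: "\<And>a z. a \<in> A \<Longrightarrow> \<bar>z\<bar> \<le> K a \<Longrightarrow>
      \<mu> * \<Phi> a z = (\<integral>w. \<rho> w *\<^sub>R \<Phi> (f a) (c a * z + s a * w) \<partial>lborel)"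

section \<open>Contracting cycles: derivatives of eigenfunctions\<close>

locale contracting_noise_cycle = noise_cycle +
  assumes contract: "\<And>a. a \<in> A \<Longrightarrow> \<bar>c a\<bar> * K a + s a * R \<le> K (f a)"
    and C_lt: "\<bar>C\<bar> < 1"
begin

lemma window_step:
  assumes "a \<in> A" "\<bar>z\<bar> \<le> K a" "\<bar>w\<bar> \<le> R"
  shows "\<bar>c a * z + s a * w\<bar> \<le> K (f a)"
proof -
  have "\<bar>c a * z + s a * w\<bar> \<le> \<bar>c a\<bar> * \<bar>z\<bar> + s a * \<bar>w\<bar>"
    using s_pos[OF assms(1)] by (metis abs_mult abs_of_pos abs_triangle_ineq)
  also have "\<dots> \<le> \<bar>c a\<bar> * K a + s a * R"
    using assms s_pos[OF assms(1)] by (intro add_mono mult_left_mono) auto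
  finally show ?thesis using contract[OF assms(1)] by simp
qed

text \<open>\<open>derivative_system j \<Psi>\<close> is the equation satisfied by the \<open>j\<close>-th derivatives of \<open>\<Phi>\<close>.\<close>

definition derivative_system :: "nat \<Rightarrow> ('a \<Rightarrow> real \<Rightarrow> complex) \<Rightarrow> bool" where
  "derivative_system j \<Psi> \<longleftrightarrow> (\<forall>a\<in>A. continuous_on {- K a..K a} (\<Psi> a) \<and>
    (\<forall>z. \<bar>z\<bar> \<le> K a \<longrightarrow> \<mu> * \<Psi> a z =
      of_real (c a ^ j) * integral {-R..R} (\<lambda>w. \<rho> w *\<^sub>R \<Psi> (f a) (c a * z + s a * w))))"

text \<open>Since \<open>\<mu> \<noteq> 0\<close>, \<Phi> is its own noise average divided by \<mu>,
  and the average depends continuously on z because the density is continuous. Window invariance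
  confines the integrand to the window of \<open>f a\<close>, which supplies the dominating
  function.\<close>

lemma continuous_eigenfunction:
  assumes a: "a \<in> A"
  shows "continuous_on {- K a..K a} (\<Phi> a)"
proof -
  let ?a = "f a"
  note [measurable] = meas[OF inv[OF a]]
  obtain M where M: "0 \<le> M" "\<And>w. \<rho> w \<le> M" using noise_bound by blast
  have s: "0 < s a" by (rule s_pos[OF a])
  have B: "0 \<le> B" using bdd[OF a, of 0] norm_ge_zero order_trans by blast
  define G where "G z = (\<integral>y. (\<rho> ((y - c a * z) / s a) / s a) *\<^sub>R \<Phi> ?a y \<partial>lborel)" for z
  have "continuous_on {- K a..K a} G"
    unfolding continuous_on_sequentially
  proof (intro allI ballI impI)
    fix u z assume z: "z \<in> {- K a..K a}" and u: "(\<forall>n. u n \<in> {- K a..K a}) \<and> u \<longlonglongrightarrow> z"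
    show "(G \<circ> u) \<longlonglongrightarrow> G z"
      unfolding G_def comp_def
    proof (rule integral_dominated_convergence[where
          w = "\<lambda>y. indicator {- K ?a..K ?a} y *\<^sub>R (M / s a * B)"])
      show "integrable lborel (\<lambda>y. indicator {- K ?a..K ?a} y *\<^sub>R (M / s a * B))"
        by (intro integrable_scaleR_left integrable_real_indicator) (auto simp: emeasure_lborel_Icc_eq)
      have "(\<lambda>n. \<rho> ((y - c a * u n) / s a)) \<longlonglongrightarrow> \<rho> ((y - c a * z) / s a)" for y
        using u s by (intro continuous_on_tendsto_compose[OF cont] tendsto_intros) auto
      then show "AE y in lborel. (\<lambda>n. (\<rho> ((y - c a * u n) / s a) / s a) *\<^sub>R \<Phi> ?a y)
          \<longlonglongrightarrow> (\<rho> ((y - c a * z) / s a) / s a) *\<^sub>R \<Phi> ?a y"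
        using s by (intro AE_I2 tendsto_intros) auto
      show "AE y in lborel. norm ((\<rho> ((y - c a * u n) / s a) / s a) *\<^sub>R \<Phi> ?a y)
          \<le> indicator {- K ?a..K ?a} y *\<^sub>R (M / s a * B)" for n
      proof (intro AE_I2)
        fix y
        define w where "w = (y - c a * u n) / s a"
        have y: "y = c a * u n + s a * w" using s by (simp add: w_def)
        show "norm ((\<rho> ((y - c a * u n) / s a) / s a) *\<^sub>R \<Phi> ?a y)
          \<le> indicator {- K ?a..K ?a} y *\<^sub>R (M / s a * B)"
        proof (cases "\<bar>w\<bar> \<le> R")
          case True
          have "\<bar>y\<bar> \<le> K ?a" unfolding y by (rule window_step[OF a _ True]) (use u in \<open>auto simp: abs_le_iff minus_le_iff\<close>)
          moreover have "\<rho> w / s a * norm (\<Phi> ?a y) \<le> M / s a * B"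
            using M s bdd[OF inv[OF a]] by (intro mult_mono divide_right_mono) auto
          ultimately show ?thesis
            using s nonneg[of w] unfolding w_def[symmetric] by (auto simp: indicator_def)
        next
          case False
          then have "\<rho> w = 0" by (intro support) simp
          then show ?thesis using M B s unfolding w_def[symmetric] by (auto simp: indicator_def)
        qed
      qed
    qed measurable
  qed
  then have "continuous_on {- K a..K a} (\<lambda>z. inverse \<mu> * G z)"
    by (intro continuous_intros)
  moreover have "\<Phi> a z = inverse \<mu> * G z" if "z \<in> {- K a..K a}" for z
  proof -
    have "\<mu> * \<Phi> a z = G z"
      using eigen[OF a, of z] noise_integral_affine[OF s, of "\<Phi> ?a" "c a * z"] that
      by (auto simp: G_def)
    then show ?thesis using \<mu>_nz by (metis mult.assoc left_inverse mult_1)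
  qed
  ultimately show ?thesis by (subst continuous_on_cong[OF refl]) auto
qed

lemma derivative_system_0: "derivative_system 0 \<Phi>"
  unfolding derivative_system_def
proof (intro ballI conjI allI impI)
  fix a z assume a: "a \<in> A" and z: "\<bar>z\<bar> \<le> K a"
  note [measurable] = meas[OF inv[OF a]]
  let ?h = "\<lambda>w. \<rho> w *\<^sub>R \<Phi> (f a) (c a * z + s a * w)"
  have int: "integrable lborel ?h"
    by (rule integrable_noise_mult) (auto intro: bdd inv a)
  have h: "indicator {-R..R} w *\<^sub>R ?h w = ?h w" for w
    using noise_outside[of w] by (auto simp: indicator_def)
  have "set_integrable lborel {-R..R} ?h"
    unfolding set_integrable_def h by (rule int)
  then have "integral {-R..R} ?h = (LINT w:{-R..R}|lborel. ?h w)"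
    by (rule set_borel_integral_eq_integral(2)[symmetric])
  also have "\<dots> = integral\<^sup>L lborel ?h"
    unfolding set_lebesgue_integral_def h ..
  finally have "integral {-R..R} ?h = integral\<^sup>L lborel ?h" .
  then show "\<mu> * \<Phi> a z = of_real (c a ^ 0) * integral {-R..R} ?h"
    using eigen[OF a z] by simp
qed (rule continuous_eigenfunction)

text \<open>Puts z into the density and makes the domain independent of z, the form to which
  Leibniz' rule applies. Enlarging the domain to the full window adds nothing because the density
  vanishes there.\<close>

lemma noise_integral_kernel:
  fixes g :: "real \<Rightarrow> complex"
  assumes a: "a \<in> A" and z: "\<bar>z\<bar> \<le> K a" and g: "continuous_on {- K (f a)..K (f a)} g"
  shows "integral {-R..R} (\<lambda>w. \<rho> w *\<^sub>R g (c a * z + s a * w)) =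
    integral {- K (f a)..K (f a)} (\<lambda>y. (\<rho> ((y - c a * z) / s a) / s a) *\<^sub>R g y)"
proof -
  let ?x = "c a * z" let ?s = "s a" let ?K = "K (f a)"
  let ?G = "\<lambda>y. (\<rho> ((y - ?x) / ?s) / ?s) *\<^sub>R g y"
  have s: "0 < ?s" by (rule s_pos[OF a])
  have sub: "{?x - ?s * R..?x + ?s * R} \<subseteq> {- ?K..?K}"
    using window_step[OF a z, of R] window_step[OF a z, of "- R"] R_pos by auto
  have "?G integrable_on {?x - ?s * R..?x + ?s * R}"
    using s by (intro integrable_continuous_interval continuous_intros continuous_on_subset[OF g sub]) auto
  then have I: "(?G has_integral integral {?x - ?s * R..?x + ?s * R} ?G) (cbox (?x - ?s * R) (?x + ?s * R))"
    by (simp add: integrable_integral)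
  have "(?G has_integral integral {?x - ?s * R..?x + ?s * R} ?G) {- ?K..?K}"
  proof (rule has_integral_on_superset[OF I])
    fix y assume y: "y \<notin> cbox (?x - ?s * R) (?x + ?s * R)"
    have "R \<le> \<bar>(y - ?x) / ?s\<bar>"
      using y s by (auto simp: field_simps abs_if)
    then have "\<rho> ((y - ?x) / ?s) = 0" by (rule support)
    then show "?G y = 0" by simp
  qed (use sub in auto)
  then have 1: "integral {- ?K..?K} ?G = integral {?x - ?s * R..?x + ?s * R} ?G"
    by (rule integral_unique)
  have "((\<lambda>w. ?G (?s *\<^sub>R w + ?x)) has_integral
      (integral {?x - ?s * R..?x + ?s * R} ?G /\<^sub>R ?s ^ DIM(real)))
      (cbox ((?x - ?s * R - ?x) /\<^sub>R ?s) ((?x + ?s * R - ?x) /\<^sub>R ?s))"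
    by (rule has_integral_affinity'[OF I s])
  then have "((\<lambda>w. (1 / ?s) *\<^sub>R (\<rho> w *\<^sub>R g (?x + ?s * w))) has_integral
      (integral {?x - ?s * R..?x + ?s * R} ?G /\<^sub>R ?s)) {-R..R}"
    using s by (simp add: algebra_simps)
  then have "((\<lambda>w. ?s *\<^sub>R (1 / ?s) *\<^sub>R (\<rho> w *\<^sub>R g (?x + ?s * w))) has_integral
      (?s *\<^sub>R (integral {?x - ?s * R..?x + ?s * R} ?G /\<^sub>R ?s))) {-R..R}"
    by (rule has_integral_cmul)
  then have "((\<lambda>w. \<rho> w *\<^sub>R g (?x + ?s * w)) has_integral
      integral {?x - ?s * R..?x + ?s * R} ?G) {-R..R}"
    using s by simp
  then show ?thesis unfolding 1 by (rule integral_unique)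
qed

text \<open>The equation is differentiated in two forms. In kernel form the derivative falls on
  \<rho>, which yields existence and continuity of \<open>\<Psi>'\<close> from continuity of \<Psi>
  alone. Once \<Psi> is known to be C1, the chain rule in the original form produces the extra
  factor \<open>c a\<close>.\<close>

lemma derivative_system_Suc:
  assumes \<Psi>: "derivative_system j \<Psi>"
  obtains \<Psi>' where "derivative_system (Suc j) \<Psi>'"
    and "\<And>a z. a \<in> A \<Longrightarrow> \<bar>z\<bar> \<le> K a \<Longrightarrow>
      (\<Psi> a has_vector_derivative \<Psi>' a z) (at z within {- K a..K a})"
proof -
  define H where "H a z y = (\<rho>' ((y - c a * z) / s a) * (- c a / s a) / s a) *\<^sub>R \<Psi> (f a) y" for a z y
  define \<Psi>' where "\<Psi>' a z = inverse \<mu> * of_real (c a ^ j) * integral {- K (f a)..K (f a)} (H a z)" for a z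
  have cont\<Psi>: "continuous_on {- K a..K a} (\<Psi> a)" if "a \<in> A" for a
    using \<Psi> that unfolding derivative_system_def by blast
  have eq: "\<mu> * \<Psi> a z = of_real (c a ^ j) * integral {-R..R} (\<lambda>w. \<rho> w *\<^sub>R \<Psi> (f a) (c a * z + s a * w))"
    if "a \<in> A" "\<bar>z\<bar> \<le> K a" for a z
    using \<Psi> that unfolding derivative_system_def by blast
  have contH: "continuous_on ({- K a..K a} \<times> cbox (- K (f a)) (K (f a))) (\<lambda>(z, y). H a z y)"
    if a: "a \<in> A" for a
    unfolding H_def case_prod_beta using s_pos[OF a]
    by (intro continuous_intros continuous_on_compose2[OF cont\<Psi>[OF inv[OF a]]]) auto
  have cont\<Psi>': "continuous_on {- K a..K a} (\<Psi>' a)" if a: "a \<in> A" for a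
    unfolding \<Psi>'_def using integral_continuous_on_param[OF contH[OF a]]
    by (intro continuous_intros) auto
  have der: "(\<Psi> a has_vector_derivative \<Psi>' a z) (at z within {- K a..K a})"
    if a: "a \<in> A" and z: "\<bar>z\<bar> \<le> K a" for a z
  proof -
    let ?G = "\<lambda>z y. (\<rho> ((y - c a * z) / s a) / s a) *\<^sub>R \<Psi> (f a) y"
    have s: "0 < s a" by (rule s_pos[OF a])
    have "((\<lambda>z. integral (cbox (- K (f a)) (K (f a))) (?G z)) has_vector_derivative
        integral (cbox (- K (f a)) (K (f a))) (H a z)) (at z within {- K a..K a})"
    proof (rule leibniz_rule_vector_derivative)
      fix x y
      have "((\<lambda>z. \<rho> ((y - c a * z) / s a) / s a) has_real_derivative
          \<rho>' ((y - c a * x) / s a) * (- c a / s a) / s a) (at x within {- K a..K a})"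
        using s by (auto intro!: derivative_eq_intros DERIV_chain2[OF deriv])
      then have "((\<lambda>z. \<rho> ((y - c a * z) / s a) / s a) has_vector_derivative
          \<rho>' ((y - c a * x) / s a) * (- c a / s a) / s a) (at x within {- K a..K a})"
        by (simp add: has_real_derivative_iff_has_vector_derivative)
      then show "((\<lambda>z. ?G z y) has_vector_derivative H a x y) (at x within {- K a..K a})"
        unfolding H_def by (rule bounded_linear.has_vector_derivative[OF bounded_linear_scaleR_left])
    next
      show "?G x integrable_on cbox (- K (f a)) (K (f a))" for x
        using s by (intro integrable_continuous continuous_intros) (auto intro: cont\<Psi> inv a)
    qed (use contH[OF a] z in auto)
    then have "((\<lambda>z. inverse \<mu> * of_real (c a ^ j) * integral (cbox (- K (f a)) (K (f a))) (?G z))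
        has_vector_derivative \<Psi>' a z) (at z within {- K a..K a})"
      unfolding \<Psi>'_def box_real by (rule has_vector_derivative_mult_right)
    moreover have "\<Psi> a x = inverse \<mu> * of_real (c a ^ j) * integral (cbox (- K (f a)) (K (f a))) (?G x)"
      if x: "x \<in> {- K a..K a}" for x
    proof -
      have x: "\<bar>x\<bar> \<le> K a" using x by auto
      have "\<mu> * \<Psi> a x = of_real (c a ^ j) * integral {- K (f a)..K (f a)} (?G x)"
        unfolding eq[OF a x] noise_integral_kernel[OF a x cont\<Psi>[OF inv[OF a]]] ..
      then show ?thesis using \<mu>_nz by (simp add: field_simps)
    qed
    ultimately show ?thesis
      using z by (intro has_vector_derivative_transform[where g = "\<Psi> a"]) auto
  qed
  show ?thesis
  proof (rule that[OF _ der])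
    show "derivative_system (Suc j) \<Psi>'"
      unfolding derivative_system_def
    proof (intro ballI conjI allI impI cont\<Psi>')
      fix a z assume a: "a \<in> A" and z: "\<bar>z\<bar> \<le> K a"
      let ?L = "\<lambda>z w. \<rho> w *\<^sub>R \<Psi> (f a) (c a * z + s a * w)"
      let ?L' = "\<lambda>z w. \<rho> w *\<^sub>R (c a *\<^sub>R \<Psi>' (f a) (c a * z + s a * w))"
      have step: "c a * x + s a * w \<in> {- K (f a)..K (f a)}" if "x \<in> {- K a..K a}" "w \<in> cbox (-R) R" for x w
        using window_step[OF a, of x w] that by (auto simp: abs_le_iff)
      \<comment> \<open>Second differentiation, through the argument of \<Psi>; it is legitimate
        because \<open>der\<close> also holds at \<open>f a\<close>.\<close>
      have "((\<lambda>z. integral (cbox (-R) R) (?L z)) has_vector_derivative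
          integral (cbox (-R) R) (?L' z)) (at z within {- K a..K a})"
      proof (rule leibniz_rule_vector_derivative)
        fix x w assume x: "x \<in> {- K a..K a}" and w: "w \<in> cbox (-R) R"
        have g: "((\<lambda>x. c a * x + s a * w) has_vector_derivative c a) (at x within {- K a..K a})"
          by (auto intro!: derivative_eq_intros)
        have "(\<Psi> (f a) has_vector_derivative \<Psi>' (f a) (c a * x + s a * w))
            (at (c a * x + s a * w) within (\<lambda>x. c a * x + s a * w) ` {- K a..K a})"
          using step[OF x w] step[OF _ w]
          by (intro has_vector_derivative_within_subset[OF der[OF inv[OF a]]]) auto
        from vector_diff_chain_within[OF g this]
        show "((\<lambda>z. ?L z w) has_vector_derivative ?L' x w) (at x within {- K a..K a})"
          unfolding comp_def by (rule bounded_linear.has_vector_derivative[OF bounded_linear_scaleR_right])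
      next
        show "?L x integrable_on cbox (-R) R" if "x \<in> {- K a..K a}" for x
          by (intro integrable_continuous continuous_intros continuous_on_compose2[OF cont\<Psi>[OF inv[OF a]]])
            (use step[OF that] in auto)
        show "continuous_on ({- K a..K a} \<times> cbox (-R) R) (\<lambda>(x, w). ?L' x w)"
          unfolding case_prod_beta
          by (intro continuous_intros continuous_on_compose2[OF cont\<Psi>'[OF inv[OF a]]])
            (use step in auto)
      qed (use z in auto)
      then have "((\<lambda>z. inverse \<mu> * of_real (c a ^ j) * integral (cbox (-R) R) (?L z)) has_vector_derivative
          inverse \<mu> * of_real (c a ^ j) * integral (cbox (-R) R) (?L' z)) (at z within {- K a..K a})"
        by (rule has_vector_derivative_mult_right)
      moreover have "\<Psi> a x = inverse \<mu> * of_real (c a ^ j) * integral (cbox (-R) R) (?L x)"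
        if "x \<in> {- K a..K a}" for x
        using eq[OF a, of x] that \<mu>_nz by (auto simp: field_simps)
      ultimately have "(\<Psi> a has_vector_derivative
          inverse \<mu> * of_real (c a ^ j) * integral (cbox (-R) R) (?L' z)) (at z within {- K a..K a})"
        using z by (intro has_vector_derivative_transform[where g = "\<Psi> a"]) auto
      moreover have "z \<in> {- K a..K a}" using z by auto
      ultimately have "\<Psi>' a z = inverse \<mu> * of_real (c a ^ j) * integral (cbox (-R) R) (?L' z)"
        using vector_derivative_unique_within_closed_interval[unfolded box_real, OF _ _ der[OF a z]] K_pos[OF a]
        by auto
      also have "?L' z = (\<lambda>w. of_real (c a) * (\<rho> w *\<^sub>R \<Psi>' (f a) (c a * z + s a * w)))"
        by (simp add: fun_eq_iff scaleR_conv_of_real mult_ac)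
      also have "integral (cbox (-R) R) \<dots> =
          of_real (c a) * integral (cbox (-R) R) (\<lambda>w. \<rho> w *\<^sub>R \<Psi>' (f a) (c a * z + s a * w))"
        by (rule Henstock_Kurzweil_Integration.integral_mult_right)
      finally show "\<mu> * \<Psi>' a z = of_real (c a ^ Suc j) *
          integral {-R..R} (\<lambda>w. \<rho> w *\<^sub>R \<Psi>' (f a) (c a * z + s a * w))"
        using \<mu>_nz by (simp add: field_simps)
    qed
  qed
qed

text \<open>Averaging against the noise cannot raise a supremum, so the suprema over the windows
  satisfy the one-step inequality with factor \<open>\<bar>c a\<bar> ^ j\<close>. Around the cycle,
  the hypothesis on j rules out a positive supremum.\<close>

lemma derivative_system_large:
  assumes \<Psi>: "derivative_system j \<Psi>" and j: "\<bar>C\<bar> ^ j < cmod \<mu> ^ p"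
    and a: "a \<in> A" and z: "\<bar>z\<bar> \<le> K a"
  shows "\<Psi> a z = 0"
proof -
  define X where "X a = (SUP z\<in>{- K a..K a}. norm (\<Psi> a z))" for a
  have cont\<Psi>: "continuous_on {- K a..K a} (\<Psi> a)" if "a \<in> A" for a
    using \<Psi> that unfolding derivative_system_def by blast
  have le: "norm (\<Psi> a z) \<le> X a" if "a \<in> A" "\<bar>z\<bar> \<le> K a" for a z
    unfolding X_def
  proof (rule cSUP_upper)
    show "bdd_above ((\<lambda>z. norm (\<Psi> a z)) ` {- K a..K a})"
      by (intro bounded_imp_bdd_above compact_imp_bounded compact_continuous_image
          continuous_intros cont\<Psi> that compact_Icc)
  qed (use that in auto)
  have step: "cmod \<mu> * X a \<le> \<bar>c a\<bar> ^ j * X (f a)" if a: "a \<in> A" for a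
  proof -
    have "X a \<le> \<bar>c a\<bar> ^ j * X (f a) / cmod \<mu>"
      unfolding X_def[of a]
    proof (rule cSUP_least)
      fix z assume "z \<in> {- K a..K a}"
      then have z: "\<bar>z\<bar> \<le> K a" by auto
      let ?h = "\<lambda>w. \<rho> w *\<^sub>R \<Psi> (f a) (c a * z + s a * w)"
      have c1: "continuous_on {-R..R} ?h"
        by (intro continuous_intros continuous_on_compose2[OF cont\<Psi>[OF inv[OF a]]])
          (use window_step[OF a z] in \<open>force simp: abs_le_iff\<close>)
      have n: "norm (integral {-R..R} ?h) \<le> integral {-R..R} (\<lambda>w. \<rho> w * X (f a))"
      proof (rule integral_norm_bound_integral)
        show "norm (?h w) \<le> \<rho> w * X (f a)" if "w \<in> {-R..R}" for w
          using le[OF inv[OF a] window_step[OF a z, of w]] that nonneg[of w]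
          by (auto simp: mult_left_mono abs_le_iff)
      qed (auto intro!: integrable_continuous_interval c1 continuous_intros)
      have n: "norm (integral {-R..R} ?h) \<le> X (f a)" using n by (simp add: integral_noise)
      have "cmod \<mu> * cmod (\<Psi> a z) = cmod (\<mu> * \<Psi> a z)" by (simp add: norm_mult)
      also have "\<mu> * \<Psi> a z = of_real (c a ^ j) * integral {-R..R} ?h"
        using \<Psi> a z unfolding derivative_system_def by blast
      also have "cmod \<dots> \<le> \<bar>c a\<bar> ^ j * X (f a)"
        using n by (simp add: norm_mult norm_power mult_left_mono)
      finally show "cmod (\<Psi> a z) \<le> \<bar>c a\<bar> ^ j * X (f a) / cmod \<mu>"
        using \<mu>_nz by (simp add: field_simps)
    qed (use K_pos[OF a] in auto)
    then show ?thesis using \<mu>_nz by (simp add: field_simps)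
  qed
  have "cmod \<mu> ^ p * X a \<le> (\<Prod>k<p. \<bar>c ((f ^^ k) a)\<bar> ^ j) * X ((f ^^ p) a)"
    using cycle_le[of A f "\<lambda>a. \<bar>c a\<bar> ^ j" "cmod \<mu>" X a p] inv step a by auto
  also have "\<dots> = \<bar>C\<bar> ^ j * X a"
    using multiplier[OF a, symmetric] per[OF a] by (simp add: prod_power_distrib[symmetric] abs_prod)
  finally have "(cmod \<mu> ^ p - \<bar>C\<bar> ^ j) * X a \<le> 0" by (simp add: algebra_simps)
  then have "X a \<le> 0" using j by (simp add: mult_le_0_iff)
  then have "norm (\<Psi> a z) \<le> 0" using le[OF a z] by linarith
  then show ?thesis by simp
qed

theorem contracting_eigenvalue:
  assumes "\<And>j. \<mu> ^ p \<noteq> of_real (C ^ j)" and "a \<in> A" "\<bar>z\<bar> \<le> K a"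
  shows "\<Phi> a z = 0"
proof -
  have "0 < cmod \<mu> ^ p" using \<mu>_nz by simp
  \<comment> \<open>From order N on every solution of the derivative system vanishes.\<close>
  then obtain N where N: "\<bar>C\<bar> ^ N < cmod \<mu> ^ p"
    using real_arch_pow_inv C_lt by blast
  have "\<forall>a\<in>A. \<forall>z. \<bar>z\<bar> \<le> K a \<longrightarrow> \<Psi> a z = 0" if "derivative_system j \<Psi>" for j \<Psi>
    using that
  \<comment> \<open>Downward induction on j: by truncated subtraction the base case covers all j
    \<ge> N, and the step passes to the derivative of \<Psi>, which solves the system of order j +
    1.\<close>
  proof (induction "N - j" arbitrary: j \<Psi>)
    case 0
    have "\<bar>C\<bar> ^ j \<le> \<bar>C\<bar> ^ N" using 0 C_lt by (intro power_decreasing) auto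
    then show ?case using derivative_system_large[OF 0(2)] N by auto
  next
    case (Suc n)
    obtain \<Psi>' where \<Psi>': "derivative_system (Suc j) \<Psi>'"
      and der: "\<And>a z. a \<in> A \<Longrightarrow> \<bar>z\<bar> \<le> K a \<Longrightarrow>
        (\<Psi> a has_vector_derivative \<Psi>' a z) (at z within {- K a..K a})"
      using derivative_system_Suc[OF Suc.prems] by blast
    have 0: "\<Psi>' a z = 0" if "a \<in> A" "\<bar>z\<bar> \<le> K a" for a z
      using Suc.hyps(1)[OF _ \<Psi>'] Suc.hyps(2) that by auto
    have const: "\<Psi> a z = \<Psi> a 0" if a: "a \<in> A" and z: "\<bar>z\<bar> \<le> K a" for a z
    proof -
      have *: "(\<Psi> a has_derivative (\<lambda>h. 0)) (at x within {- K a..K a})" if "x \<in> {- K a..K a}" for x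
      proof -
        have "\<bar>x\<bar> \<le> K a" using that by auto
        from der[OF a this] 0[OF a this] show ?thesis
          by (simp add: has_vector_derivative_def)
      qed
      have "\<exists>c. \<forall>x\<in>{- K a..K a}. \<Psi> a x = c"
        by (rule has_derivative_zero_constant[OF _ *]) auto
      then show ?thesis using z K_pos[OF a] by (auto simp: abs_le_iff)
    qed
    \<comment> \<open>The noise has mass 1, so averaging a constant leaves it unchanged and only the
      factor \<open>c a ^ j\<close> remains.\<close>
    have rel: "\<mu> * \<Psi> a 0 = of_real (c a ^ j) * \<Psi> (f a) 0" if a: "a \<in> A" for a
    proof -
      have "\<mu> * \<Psi> a 0 = of_real (c a ^ j) * integral {-R..R} (\<lambda>w. \<rho> w *\<^sub>R \<Psi> (f a) (c a * 0 + s a * w))"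
        using Suc.prems a K_pos[OF a] unfolding derivative_system_def by auto
      also have "integral {-R..R} (\<lambda>w. \<rho> w *\<^sub>R \<Psi> (f a) (c a * 0 + s a * w)) =
          integral {-R..R} (\<lambda>w. \<rho> w *\<^sub>R \<Psi> (f a) 0)"
      proof (rule Henstock_Kurzweil_Integration.integral_cong)
        fix w assume "w \<in> {-R..R}"
        then have "\<bar>c a * 0 + s a * w\<bar> \<le> K (f a)"
          using K_pos[OF a] by (intro window_step a) auto
        then have "\<Psi> (f a) (c a * 0 + s a * w) = \<Psi> (f a) 0"
          by (rule const[OF inv[OF a]])
        then show "\<rho> w *\<^sub>R \<Psi> (f a) (c a * 0 + s a * w) = \<rho> w *\<^sub>R \<Psi> (f a) 0"
          by (rule arg_cong)
      qed
      also have "\<dots> = integral {-R..R} \<rho> *\<^sub>R \<Psi> (f a) 0"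
        by (intro integral_unique has_integral_scaleR_left integrable_integral
            integrable_continuous_interval continuous_intros)
      finally show ?thesis by (simp add: integral_noise)
    qed
    show ?case
    proof (intro ballI allI impI)
      fix a z assume a: "a \<in> A" and z: "\<bar>z\<bar> \<le> K a"
      have "\<mu> ^ p * \<Psi> a 0 = (\<Prod>k<p. of_real (c ((f ^^ k) a) ^ j)) * \<Psi> ((f ^^ p) a) 0"
        using cycle_eq[of A f \<mu> "\<lambda>a. \<Psi> a 0" "\<lambda>a. of_real (c a ^ j)" a p] inv rel a by auto
      also have "\<dots> = of_real (C ^ j) * \<Psi> a 0"
        using multiplier[OF a, symmetric] per[OF a] by (simp add: prod_power_distrib)
      finally have "\<Psi> a 0 = 0" using assms(1)[of j] by simp
      then show "\<Psi> a z = 0" using const[OF a z] by simp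
    qed
  qed
  from this[OF derivative_system_0] show ?thesis using assms by blast
qed

end

section \<open>Expanding cycles: moments of eigenfunctions\<close>

locale expanding_noise_cycle = noise_cycle +
  assumes expand: "\<And>a. a \<in> A \<Longrightarrow> K (f a) + s a * R \<le> \<bar>c a\<bar> * K a"
    and outside: "\<And>a z. a \<in> A \<Longrightarrow> K a < \<bar>z\<bar> \<Longrightarrow> \<Phi> a z = 0"
begin

lemma c_nz: assumes a: "a \<in> A" shows "c a \<noteq> 0"
proof
  assume "c a = 0"
  moreover have "0 < K (f a)" "0 < s a * R"
    using K_pos inv s_pos a R_pos by auto
  ultimately show False using expand[OF a] by simp
qed

definition moment :: "nat \<Rightarrow> 'a \<Rightarrow> complex" where
  "moment j a = (\<integral>y. y ^ j *\<^sub>R \<Phi> a y \<partial>lborel)"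

lemma integrable_window:
  fixes g :: "real \<Rightarrow> real"
  assumes a: "a \<in> A" and [measurable]: "g \<in> borel_measurable borel"
    and M: "\<And>y. \<bar>y\<bar> \<le> K a \<Longrightarrow> \<bar>g y\<bar> \<le> M"
  shows "integrable lborel (\<lambda>y. g y *\<^sub>R \<Phi> a y)"
    and "norm (\<integral>y. g y *\<^sub>R \<Phi> a y \<partial>lborel) \<le> 2 * K a * M * B"
proof -
  note [measurable] = meas[OF a]
  have M0: "0 \<le> M" using M[of 0] K_pos[OF a] by force
  let ?h = "\<lambda>y. (M * B) * indicator {- K a..K a} y :: real"
  have h: "integrable lborel ?h"
    by (intro integrable_mult_right integrable_real_indicator) (auto simp: emeasure_lborel_Icc_eq)
  have le: "norm (g y *\<^sub>R \<Phi> a y) \<le> ?h y" for y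
  proof (cases "\<bar>y\<bar> \<le> K a")
    case True
    then show ?thesis
      using M[OF True] bdd[OF a, of y] M0 by (auto simp: indicator_def abs_le_iff intro!: mult_mono)
  next
    case False
    then have "\<Phi> a y = 0" using outside[OF a] by simp
    then show ?thesis using False by (auto simp: indicator_def)
  qed
  have "norm (g y *\<^sub>R \<Phi> a y) \<le> norm (?h y)" for y
    using le[of y] by simp
  then show i: "integrable lborel (\<lambda>y. g y *\<^sub>R \<Phi> a y)"
    by (intro Bochner_Integration.integrable_bound[OF h]) auto
  have "norm (\<integral>y. g y *\<^sub>R \<Phi> a y \<partial>lborel) \<le> (\<integral>y. ?h y \<partial>lborel)"
    by (intro Bochner_Integration.integral_norm_bound_integral i h le)
  also have "\<dots> = 2 * K a * M * B"
    using K_pos[OF a] by simp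
  finally show "norm (\<integral>y. g y *\<^sub>R \<Phi> a y \<partial>lborel) \<le> 2 * K a * M * B" .
qed

lemma integrable_moment: "a \<in> A \<Longrightarrow> integrable lborel (\<lambda>y. y ^ j *\<^sub>R \<Phi> a y)"
  by (rule integrable_window(1)[where M = "K a ^ j"]) (auto simp: power_abs intro: power_mono)

text \<open>Only the top-degree term of the binomial expansion survives. The first nonvanishing
  moment is thus insensitive to translation, and in particular to the noise.\<close>

lemma shifted_moment:
  assumes a: "a \<in> A" and 0: "\<And>i. i < j \<Longrightarrow> moment i a = 0"
  shows "(\<integral>y. (y + h) ^ j *\<^sub>R \<Phi> a y \<partial>lborel) = moment j a"
proof -
  have "(\<integral>y. (y + h) ^ j *\<^sub>R \<Phi> a y \<partial>lborel) =
      (\<integral>y. (\<Sum>i\<le>j. (of_nat (j choose i) * h ^ (j - i)) *\<^sub>R (y ^ i *\<^sub>R \<Phi> a y)) \<partial>lborel)"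
    unfolding binomial_ring scaleR_sum_left
    by (intro Bochner_Integration.integral_cong sum.cong refl) (simp add: mult_ac)
  also have "\<dots> = (\<Sum>i\<le>j. (of_nat (j choose i) * h ^ (j - i)) *\<^sub>R moment i a)"
    unfolding moment_def
    by (simp only: Bochner_Integration.integral_sum integrable_scaleR_right
        integrable_moment[OF a] integral_scaleR_right)
  also have "\<dots> = (\<Sum>i\<le>j. if i = j then moment j a else 0)"
    by (intro sum.cong refl) (auto simp: 0)
  finally show ?thesis by simp
qed

text \<open>Exchange the integrals and substitute y = c z + s w: the change of variables gives 1 /
  |c|, and z = (y - s w) / c gives the inverse power of c. The shift by s w is harmless by
  \<open>shifted_moment\<close>, so the noise drops out.\<close>

lemma moment_step:
  assumes a: "a \<in> A" and 0: "\<And>i. i < j \<Longrightarrow> moment i (f a) = 0"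
  shows "\<mu> * moment j a = of_real (1 / (\<bar>c a\<bar> * c a ^ j)) * moment j (f a)"
proof -
  note [measurable] = meas[OF inv[OF a]]
  have c: "c a \<noteq> 0" by (rule c_nz[OF a])
  define I where "I = {- K a..K a}"
  \<comment> \<open>The indicator restricts z to the window, where the eigenvalue equation holds,
    and makes the double integral absolutely convergent.\<close>
  define h where "h z w = (z ^ j * indicator I z * \<rho> w) *\<^sub>R \<Phi> (f a) (c a * z + s a * w)" for z w
  have B: "0 \<le> B" using bdd[OF a, of 0] norm_ge_zero order_trans by blast
  have [measurable]: "I \<in> sets borel" by (simp add: I_def)
  have hm [measurable]: "case_prod h \<in> borel_measurable (lborel \<Otimes>\<^sub>M lborel)"
    unfolding h_def case_prod_beta by measurable
  let ?g = "\<lambda>z. (K a ^ j * B) * indicator I z :: real"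
  have norm_h: "norm (h z w) \<le> ?g z * \<rho> w" for z w
  proof (cases "z \<in> I")
    case True
    then have "\<bar>z\<bar> ^ j \<le> K a ^ j" by (intro power_mono) (auto simp: I_def)
    then have "(\<bar>z\<bar> ^ j * \<rho> w) * norm (\<Phi> (f a) (c a * z + s a * w)) \<le> (K a ^ j * \<rho> w) * B"
      using bdd[OF inv[OF a]] nonneg[of w] K_pos[OF a] by (intro mult_mono) auto
    then show ?thesis using True nonneg[of w] by (simp add: h_def abs_mult power_abs mult_ac)
  qed (simp add: h_def)
  have ih: "integrable lborel (h z)" for z
    by (rule Bochner_Integration.integrable_bound[where f = "\<lambda>w. ?g z * \<rho> w"])
      (use norm_h[of z] integrable_noise in \<open>auto simp: h_def intro: order_trans[OF _ abs_ge_self]\<close>)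
  have "integrable (lborel \<Otimes>\<^sub>M lborel) (case_prod h)"
  proof (rule lborel_pair.Fubini_integrable[OF hm])
    show "AE z in lborel. integrable lborel (\<lambda>w. case_prod h (z, w))" using ih by simp
    show "integrable lborel (\<lambda>z. \<integral>w. norm (case_prod h (z, w)) \<partial>lborel)"
    proof (rule Bochner_Integration.integrable_bound[where f = ?g])
      show "integrable lborel ?g"
        unfolding I_def by (intro integrable_mult_right integrable_real_indicator) (auto simp: emeasure_lborel_Icc_eq)
      have "(\<integral>w. norm (h z w) \<partial>lborel) \<le> (\<integral>w. ?g z * \<rho> w \<partial>lborel)" for z
        by (intro integral_mono integrable_norm ih norm_h) (simp add: integrable_noise)
      then show "AE z in lborel. norm (\<integral>w. norm (case_prod h (z, w)) \<partial>lborel) \<le> norm (?g z)"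
        by (auto simp: mass intro: order_trans[OF _ abs_ge_self])
    qed measurable
  qed
  then have fub: "(\<integral>w. (\<integral>z. h z w \<partial>lborel) \<partial>lborel) = (\<integral>z. (\<integral>w. h z w \<partial>lborel) \<partial>lborel)"
    by (rule lborel_pair.Fubini_integral)
  have inner: "(\<integral>z. h z w \<partial>lborel) = \<rho> w *\<^sub>R (1 / (\<bar>c a\<bar> * c a ^ j)) *\<^sub>R moment j (f a)" for w
  proof (cases "R \<le> \<bar>w\<bar>")
    case True
    then show ?thesis by (simp add: h_def support)
  next
    case False
    have "h z w = \<rho> w *\<^sub>R z ^ j *\<^sub>R \<Phi> (f a) (c a * z + s a * w)" for z
    proof (cases "z \<in> I")
      case False
      then have z: "K a \<le> \<bar>z\<bar>" by (auto simp: I_def)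
      have "K (f a) + s a * R \<le> \<bar>c a\<bar> * K a" by (rule expand[OF a])
      also have "\<dots> \<le> \<bar>c a\<bar> * \<bar>z\<bar>" using z by (intro mult_left_mono) auto
      also have "\<dots> \<le> \<bar>c a * z + s a * w\<bar> + s a * \<bar>w\<bar>"
        using abs_triangle_ineq4[of "c a * z + s a * w" "s a * w"] s_pos[OF a] by (simp add: abs_mult)
      also have "\<dots> < \<bar>c a * z + s a * w\<bar> + s a * R"
        using \<open>\<not> R \<le> \<bar>w\<bar>\<close> s_pos[OF a] by simp
      finally have "\<Phi> (f a) (c a * z + s a * w) = 0" by (intro outside inv a) simp
      then show ?thesis by (simp add: h_def)
    qed (simp add: h_def mult_ac)
    then have "(\<integral>z. h z w \<partial>lborel) = \<rho> w *\<^sub>R (\<integral>z. z ^ j *\<^sub>R \<Phi> (f a) (c a * z + s a * w) \<partial>lborel)"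
      by (simp only: integral_scaleR_right)
    also have "(\<integral>z. z ^ j *\<^sub>R \<Phi> (f a) (c a * z + s a * w) \<partial>lborel) =
        \<bar>1 / c a\<bar> *\<^sub>R (\<integral>y. (- (s a * w) / c a + 1 / c a * y) ^ j *\<^sub>R
          \<Phi> (f a) (c a * (- (s a * w) / c a + 1 / c a * y) + s a * w) \<partial>lborel)"
      using c by (intro lborel_integral_real_affine) simp
    also have "\<dots> = \<bar>1 / c a\<bar> *\<^sub>R (\<integral>y. (1 / c a ^ j) *\<^sub>R ((y + - (s a * w)) ^ j *\<^sub>R \<Phi> (f a) y) \<partial>lborel)"
    proof -
      have "- (s a * w) / c a + 1 / c a * y = (y + - (s a * w)) / c a" for y
        using c by (simp add: field_simps)
      then show ?thesis using c by (simp add: power_divide)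
    qed
    also have "\<dots> = (1 / (\<bar>c a\<bar> * c a ^ j)) *\<^sub>R moment j (f a)"
      by (subst integral_scaleR_right, subst shifted_moment[OF inv[OF a] 0]) auto
    finally show ?thesis .
  qed
  have "\<mu> * moment j a = (\<integral>z. \<mu> * (z ^ j *\<^sub>R \<Phi> a z) \<partial>lborel)"
    unfolding moment_def by (rule integral_mult_right_zero[symmetric])
  also have "\<dots> = (\<integral>z. (\<integral>w. h z w \<partial>lborel) \<partial>lborel)"
  proof (intro Bochner_Integration.integral_cong refl)
    fix z
    show "\<mu> * (z ^ j *\<^sub>R \<Phi> a z) = (\<integral>w. h z w \<partial>lborel)"
    proof (cases "z \<in> I")
      case True
      then have z: "\<bar>z\<bar> \<le> K a" by (auto simp: I_def)
      have "\<mu> * (z ^ j *\<^sub>R \<Phi> a z) = z ^ j *\<^sub>R (\<mu> * \<Phi> a z)" by simp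
      also have "\<dots> = (\<integral>w. z ^ j *\<^sub>R (\<rho> w *\<^sub>R \<Phi> (f a) (c a * z + s a * w)) \<partial>lborel)"
        unfolding eigen[OF a z] by (rule integral_scaleR_right[symmetric])
      finally show ?thesis using True by (simp add: h_def)
    next
      case False
      then have "\<Phi> a z = 0" by (intro outside[OF a]) (auto simp: I_def)
      then show ?thesis using False by (simp add: h_def)
    qed
  qed
  also have "\<dots> = (\<integral>w. \<rho> w *\<^sub>R (1 / (\<bar>c a\<bar> * c a ^ j)) *\<^sub>R moment j (f a) \<partial>lborel)"
    unfolding fub[symmetric] inner ..
  also have "\<dots> = (1 / (\<bar>c a\<bar> * c a ^ j)) *\<^sub>R moment j (f a)"
    using integrable_noise mass by (subst integral_scaleR_left) auto
  finally show ?thesis by (simp add: scaleR_conv_of_real)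
qed

text \<open>Up to the factor \<mu>, the value \<open>\<Phi> a z\<close> is the pairing of
  \<open>\<Phi> (f a)\<close> with a continuous kernel. Polynomials approximate this kernel
  uniformly on the window and pair to zero. It is the kernel that gets approximated, so no
  regularity of \<Phi> is required and the conclusion holds at every point, not just almost
  everywhere.\<close>

lemma zero_if_moments_zero:
  assumes m: "\<And>j a. a \<in> A \<Longrightarrow> moment j a = 0" and a: "a \<in> A"
  shows "\<Phi> a z = 0"
proof (cases "\<bar>z\<bar> \<le> K a")
  case True
  let ?a = "f a"
  have fa: "?a \<in> A" by (rule inv[OF a])
  have s: "0 < s a" by (rule s_pos[OF a])
  define h where "h y = \<rho> ((y - c a * z) / s a) / s a" for y
  let ?I = "\<integral>y. h y *\<^sub>R \<Phi> ?a y \<partial>lborel"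
  have hc: "continuous_on S h" for S
    unfolding h_def using s by (intro continuous_intros) auto
  have hm [measurable]: "h \<in> borel_measurable borel"
    by (rule borel_measurable_continuous_onI[OF hc])
  have le: "norm ?I \<le> e * (2 * K ?a * B)" if e: "0 < e" for e
  proof -
    obtain g where g: "real_polynomial_function g" "\<And>y. y \<in> {- K ?a..K ?a} \<Longrightarrow> \<bar>h y - g y\<bar> < e"
      using Stone_Weierstrass_real_polynomial_function[OF compact_Icc hc e] by blast
    obtain b n where gb: "g = (\<lambda>y. \<Sum>i\<le>n. b i * y ^ i)"
      using g(1) unfolding real_polynomial_function_iff_sum by blast
    have gm [measurable]: "g \<in> borel_measurable borel" unfolding gb by measurable
    have gI: "(\<lambda>y. g y *\<^sub>R \<Phi> ?a y) = (\<lambda>y. \<Sum>i\<le>n. b i *\<^sub>R (y ^ i *\<^sub>R \<Phi> ?a y))"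
      unfolding gb by (simp add: scaleR_sum_left)
    have gi: "integrable lborel (\<lambda>y. g y *\<^sub>R \<Phi> ?a y)"
      unfolding gI by (intro Bochner_Integration.integrable_sum integrable_scaleR_right integrable_moment fa)
    have g0: "(\<integral>y. g y *\<^sub>R \<Phi> ?a y \<partial>lborel) = 0"
      unfolding gI using m[OF fa, unfolded moment_def]
      by (simp only: Bochner_Integration.integral_sum integrable_scaleR_right
          integrable_moment[OF fa] integral_scaleR_right scaleR_zero_right sum.neutral_const)
    have d: "integrable lborel (\<lambda>y. (h y - g y) *\<^sub>R \<Phi> ?a y)"
      "norm (\<integral>y. (h y - g y) *\<^sub>R \<Phi> ?a y \<partial>lborel) \<le> 2 * K ?a * e * B"
    proof -
      have e: "\<bar>h y - g y\<bar> \<le> e" if "\<bar>y\<bar> \<le> K ?a" for y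
        using g(2)[of y] that by (auto simp: abs_le_iff)
      show "integrable lborel (\<lambda>y. (h y - g y) *\<^sub>R \<Phi> ?a y)"
        by (rule integrable_window(1)[OF fa _ e]) auto
      show "norm (\<integral>y. (h y - g y) *\<^sub>R \<Phi> ?a y \<partial>lborel) \<le> 2 * K ?a * e * B"
        by (rule integrable_window(2)[OF fa _ e]) auto
    qed
    have "?I = (\<integral>y. (h y - g y) *\<^sub>R \<Phi> ?a y + g y *\<^sub>R \<Phi> ?a y \<partial>lborel)"
      by (simp add: algebra_simps)
    also have "\<dots> = (\<integral>y. (h y - g y) *\<^sub>R \<Phi> ?a y \<partial>lborel)"
      by (subst Bochner_Integration.integral_add[OF d(1) gi]) (simp add: g0)
    finally show ?thesis using d(2) by (simp add: mult_ac)
  qed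
  have "norm ?I = 0"
  proof (rule antisym[OF _ norm_ge_zero], rule tendsto_lowerbound)
    show "((\<lambda>e. e * (2 * K ?a * B)) \<longlongrightarrow> 0) (at_right 0)"
      by (auto intro!: tendsto_eq_intros)
    show "\<forall>\<^sub>F e in at_right 0. norm ?I \<le> e * (2 * K ?a * B)"
      using le by (auto simp: eventually_at_filter)
  qed simp
  moreover have "\<mu> * \<Phi> a z = ?I"
    unfolding h_def using eigen[OF a True] noise_integral_affine[OF s, of "\<Phi> ?a" "c a * z"] by simp
  ultimately show ?thesis using \<mu>_nz by simp
qed (simp add: outside a)

theorem expanding_eigenvalue:
  assumes "\<And>j. \<mu> ^ p \<noteq> of_real (1 / (\<bar>C\<bar> * C ^ j))" and "a \<in> A"
  shows "\<Phi> a z = 0"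
proof (rule zero_if_moments_zero[OF _ assms(2)])
  fix j a assume "a \<in> A"
  then show "moment j a = 0"
  \<comment> \<open>Lower moments vanish at all points of the cycle by induction, so
    \<open>moment_step\<close> applies at each of them and relates moments of order j only to each
    other.\<close>
  proof (induction j arbitrary: a rule: less_induct)
    case (less j)
    note a = less.prems
    have rel: "\<mu> * moment j b = of_real (1 / (\<bar>c b\<bar> * c b ^ j)) * moment j (f b)" if "b \<in> A" for b
      by (rule moment_step[OF that less.IH]) (auto intro: inv that)
    have "\<mu> ^ p * moment j a =
        (\<Prod>k<p. of_real (1 / (\<bar>c ((f ^^ k) a)\<bar> * c ((f ^^ k) a) ^ j))) * moment j ((f ^^ p) a)"
      using cycle_eq[of A f \<mu> "moment j" "\<lambda>a. of_real (1 / (\<bar>c a\<bar> * c a ^ j))" a p] inv rel a by blast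
    also have "\<dots> = of_real (1 / (\<bar>C\<bar> * C ^ j)) * moment j a"
      unfolding of_real_prod[symmetric] using multiplier[OF a, symmetric] per[OF a]
      by (simp only: prod_dividef prod.distrib prod_power_distrib[symmetric] abs_prod prod.neutral_const)
    finally have "(\<mu> ^ p - of_real (1 / (\<bar>C\<bar> * C ^ j))) * moment j a = 0"
      by (simp add: left_diff_distrib)
    then show ?case using assms(1)[of j] by (simp only: mult_eq_0_iff right_minus_eq) blast
  qed
qed

end

section \<open>Compactly supported noise close to the normal distribution\<close>

text \<open>In every sign case the first-order remainder is at most (y - u)^2, hence at most e |y -
  u| once |y - u| < e. This is what makes the cutoff of the normal density C1.\<close>

lemma has_real_derivative_pos_part_sq:
  "((\<lambda>u. (max 0 u)\<^sup>2) has_real_derivative 2 * max 0 u) (at u)"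
proof -
  have "norm ((max 0 y)\<^sup>2 - (max 0 u)\<^sup>2 - 2 * max 0 u * (y - u)) \<le> e * norm (y - u)"
    if "norm (y - u) < e" for y e :: real
  proof -
    have "\<bar>(max 0 y)\<^sup>2 - (max 0 u)\<^sup>2 - 2 * max 0 u * (y - u)\<bar> \<le> (y - u)\<^sup>2"
    proof (cases "0 \<le> u"; cases "0 \<le> y")
      assume "0 \<le> u" "\<not> 0 \<le> y"
      then have "0 \<le> - (u * y)" "0 \<le> y\<^sup>2" "0 \<le> u\<^sup>2" by (auto simp: mult_nonneg_nonpos)
      moreover have "(max 0 y)\<^sup>2 - (max 0 u)\<^sup>2 - 2 * max 0 u * (y - u) = u\<^sup>2 - 2 * (u * y)"
        using \<open>0 \<le> u\<close> \<open>\<not> 0 \<le> y\<close> by (simp add: power2_eq_square algebra_simps)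
      moreover have "(y - u)\<^sup>2 = y\<^sup>2 - 2 * (u * y) + u\<^sup>2"
        by (simp add: power2_eq_square algebra_simps)
      ultimately show ?thesis by linarith
    next
      assume "\<not> 0 \<le> u" "0 \<le> y"
      then have "0 \<le> - (u * y)" "0 \<le> y\<^sup>2" "0 \<le> u\<^sup>2" by (auto simp: mult_nonpos_nonneg)
      moreover have "(max 0 y)\<^sup>2 - (max 0 u)\<^sup>2 - 2 * max 0 u * (y - u) = y\<^sup>2"
        using \<open>\<not> 0 \<le> u\<close> \<open>0 \<le> y\<close> by simp
      moreover have "(y - u)\<^sup>2 = y\<^sup>2 - 2 * (u * y) + u\<^sup>2"
        by (simp add: power2_eq_square algebra_simps)
      ultimately show ?thesis by linarith
    next
      assume "0 \<le> u" "0 \<le> y"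
      then have "(max 0 y)\<^sup>2 - (max 0 u)\<^sup>2 - 2 * max 0 u * (y - u) = (y - u)\<^sup>2"
        by (simp add: power2_eq_square algebra_simps)
      then show ?thesis by simp
    qed simp
    also have "(y - u)\<^sup>2 = \<bar>y - u\<bar> * \<bar>y - u\<bar>" by (simp add: power2_eq_square)
    also have "\<dots> \<le> e * \<bar>y - u\<bar>" using that by (intro mult_right_mono) auto
    finally show ?thesis by simp
  qed
  then show ?thesis
    unfolding has_field_derivative_def has_derivative_at_alt
    by (auto simp: bounded_linear_mult_right)
qed

lemma compact_noise_near_normal:
  assumes "0 < r"
  obtains \<rho> \<rho>' R where "compact_noise \<rho> \<rho>' R"
    and "(\<integral>w. \<bar>std_normal_density w - \<rho> w\<bar> \<partial>lborel) < r"
proof -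
  let ?n = std_normal_density
  have n: "integrable lborel ?n" "integral\<^sup>L lborel ?n = 1"
    using integrable_normal_density[of 1 0] integral_normal_density[of 1 0] by auto
  \<comment> \<open>A C1 bump supported in [-(m + 1), m + 1] that tends to 1 pointwise;
    \<open>Suc m\<close> avoids dividing by 0.\<close>
  define cut where "cut m w = (max 0 (1 - (w / real (Suc m))\<^sup>2))\<^sup>2" for m w
  define h where "h m w = ?n w * cut m w" for m w
  have cut: "0 \<le> cut m w" "cut m w \<le> 1" for m w
    unfolding cut_def by (auto intro!: power_le_one)
  have [measurable]: "cut m \<in> borel_measurable borel" for m unfolding cut_def by measurable
  have h: "0 \<le> h m w" "h m w \<le> ?n w" for m w
    using cut[of m w] by (auto simp: h_def mult_left_le)
  have [measurable]: "h m \<in> borel_measurable borel" for m unfolding h_def by measurable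
  have hi: "integrable lborel (h m)" for m
    by (rule Bochner_Integration.integrable_bound[OF n(1)]) (use h in auto)
  have "(\<lambda>m. integral\<^sup>L lborel (h m)) \<longlonglongrightarrow> integral\<^sup>L lborel ?n"
  proof (rule integral_dominated_convergence[where w = ?n])
    have "(\<lambda>m. h m w) \<longlonglongrightarrow> ?n w" for w
    proof -
      have "(\<lambda>m. w / real (Suc m)) \<longlonglongrightarrow> 0" by (rule LIMSEQ_Suc) (rule lim_const_over_n)
      then have "(\<lambda>m. h m w) \<longlonglongrightarrow> ?n w * (max 0 (1 - 0\<^sup>2))\<^sup>2"
        unfolding h_def cut_def by (intro tendsto_intros)
      then show ?thesis by simp
    qed
    then show "AE w in lborel. (\<lambda>m. h m w) \<longlonglongrightarrow> ?n w" by simp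
    show "AE w in lborel. norm (h m w) \<le> ?n w" for m using h by simp
  qed (use n in auto)
  \<comment> \<open>The L1 error after normalization will be at most 2 (1 - I), whence the bound 1 -
    r / 2; the maximum with 0 also ensures that I can be divided by.\<close>
  then have "\<forall>\<^sub>F m in sequentially. max (1 - r / 2) 0 < integral\<^sup>L lborel (h m)"
    using assms n(2) by (intro order_tendstoD) auto
  then obtain m where m: "1 - r / 2 < integral\<^sup>L lborel (h m)" "0 < integral\<^sup>L lborel (h m)"
    using eventually_happens'[OF sequentially_bot] by fastforce
  define I where "I = integral\<^sup>L lborel (h m)"
  have I: "1 - r / 2 < I" "0 < I" using m by (auto simp: I_def)
  have "I \<le> integral\<^sup>L lborel ?n" unfolding I_def by (intro integral_mono hi n h)
  then have "I \<le> 1" using n(2) by simp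
  define cut' where "cut' w = 2 * max 0 (1 - (w / real (Suc m))\<^sup>2) * (- 2 * (w / real (Suc m)) / real (Suc m))" for w
  have cut': "(cut m has_real_derivative cut' w) (at w)" for w
  proof -
    have "((\<lambda>w. 1 - (w / real (Suc m))\<^sup>2) has_real_derivative (- 2 * (w / real (Suc m)) / real (Suc m))) (at w)"
      by (auto intro!: derivative_eq_intros simp del: of_nat_Suc)
    from DERIV_chain2[OF has_real_derivative_pos_part_sq this]
    show ?thesis unfolding cut_def cut'_def by simp
  qed
  have n': "(?n has_real_derivative (- w * ?n w)) (at w)" for w
    unfolding std_normal_density_def
    by (auto intro!: derivative_eq_intros simp: field_simps power2_eq_square)
  define \<rho> where "\<rho> w = h m w / I" for w
  define \<rho>' where "\<rho>' w = (- w * ?n w * cut m w + ?n w * cut' w) / I" for w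
  have cn: "continuous_on UNIV ?n"
    using n' by (intro continuous_at_imp_continuous_on) (auto intro: DERIV_isCont)
  have "compact_noise \<rho> \<rho>' (real (Suc m))"
  proof
    show "(\<rho> has_real_derivative \<rho>' w) (at w)" for w
      unfolding \<rho>_def \<rho>'_def h_def using DERIV_cdivide[OF DERIV_mult[OF n'[of w] cut'[of w]], of I]
      by (simp add: algebra_simps)
    show "continuous_on UNIV \<rho>'"
      unfolding \<rho>'_def cut_def cut'_def using I cn by (intro continuous_intros) auto
    show "0 \<le> \<rho> w" for w using h I by (simp add: \<rho>_def)
    show "\<rho> w = 0" if "real (Suc m) \<le> \<bar>w\<bar>" for w
    proof -
      have "1 \<le> \<bar>w / real (Suc m)\<bar>" using that by (simp add: field_simps del: of_nat_Suc)
      then have "1\<^sup>2 \<le> \<bar>w / real (Suc m)\<bar>\<^sup>2" by (intro power_mono) auto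
      then have "1 \<le> (w / real (Suc m))\<^sup>2" unfolding power2_abs by simp
      then show ?thesis by (simp add: \<rho>_def h_def cut_def del: of_nat_Suc)
    qed
    show "integral\<^sup>L lborel \<rho> = 1" using I by (simp add: \<rho>_def[abs_def] I_def)
  qed simp
  moreover have "(\<integral>w. \<bar>?n w - \<rho> w\<bar> \<partial>lborel) < r"
  proof -
    have \<rho>i: "integrable lborel \<rho>" using hi by (simp add: \<rho>_def[abs_def])
    have le: "h m w \<le> \<rho> w" for w
      using h[of m w] I \<open>I \<le> 1\<close> by (simp add: \<rho>_def pos_le_divide_eq mult_left_le)
    \<comment> \<open>\<open>h m\<close> lies below both densities, because I is at most 1, so each
      density contributes its excess mass 1 - I over it.\<close>
    have "(\<integral>w. \<bar>?n w - \<rho> w\<bar> \<partial>lborel) \<le> (\<integral>w. (?n w - h m w) + (\<rho> w - h m w) \<partial>lborel)"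
    proof (intro integral_mono)
      show "\<bar>?n w - \<rho> w\<bar> \<le> (?n w - h m w) + (\<rho> w - h m w)" for w using le[of w] h[of m w] by auto
    qed (auto intro!: integrable_abs n \<rho>i hi)
    also have "\<dots> = (1 - I) + (1 - I)"
    proof -
      have "integral\<^sup>L lborel \<rho> = 1" using I by (simp add: \<rho>_def[abs_def] I_def)
      then show ?thesis using n \<rho>i hi by (simp add: I_def)
    qed
    also have "\<dots> < r" using I by simp
    finally show ?thesis .
  qed
  ultimately show ?thesis by (rule that)
qed

context compact_noise
begin

text \<open>L1 continuity under affine changes of variable, uniform over all small shifts and
  scalings. A sequence of counterexamples shrinking to the identity contradicts dominated
  convergence.\<close>

lemma noise_affine_close:
  assumes "0 < r"
  obtains \<nu> where "0 < \<nu>" "\<nu> < 1" "\<And>\<alpha> \<beta>. \<bar>\<alpha>\<bar> \<le> \<nu> \<Longrightarrow> \<bar>\<beta> - 1\<bar> \<le> \<nu> \<Longrightarrow>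
    (\<integral>v. \<bar>\<rho> ((v - \<alpha>) / \<beta>) / \<beta> - \<rho> v\<bar> \<partial>lborel) < r"
proof (rule ccontr)
  assume contra: "\<not> thesis"
  \<comment> \<open>The bound 1 / (n + 2) is at most 1 / 2, which keeps \<beta> away from 0.\<close>
  define bad where "bad n \<alpha> \<beta> \<longleftrightarrow> \<bar>\<alpha>\<bar> \<le> 1 / (real n + 2) \<and> \<bar>\<beta> - 1\<bar> \<le> 1 / (real n + 2) \<and>
      r \<le> (\<integral>v. \<bar>\<rho> ((v - \<alpha>) / \<beta>) / \<beta> - \<rho> v\<bar> \<partial>lborel)" for n :: nat and \<alpha> \<beta>
  have "\<exists>\<alpha> \<beta>. bad n \<alpha> \<beta>" for n
  proof (rule ccontr)
    assume no: "\<not> (\<exists>\<alpha> \<beta>. bad n \<alpha> \<beta>)"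
    have thesis
    proof (rule that[of "1 / (real n + 2)"])
      show "1 / (real n + 2) < 1" by simp
    qed (use no in \<open>force simp: bad_def not_le\<close>)+
    then show False using contra by contradiction
  qed
  then obtain \<alpha> \<beta> where "\<And>n. bad n (\<alpha> n) (\<beta> n)" by metis
  then have \<alpha>: "\<And>n. \<bar>\<alpha> n\<bar> \<le> 1 / (real n + 2)" and \<beta>: "\<And>n. \<bar>\<beta> n - 1\<bar> \<le> 1 / (real n + 2)"
    and ge: "\<And>n. r \<le> (\<integral>v. \<bar>\<rho> ((v - \<alpha> n) / \<beta> n) / \<beta> n - \<rho> v\<bar> \<partial>lborel)"
    unfolding bad_def by blast+
  have lim: "(\<lambda>n. 1 / (real n + 2)) \<longlonglongrightarrow> 0"
    using LIMSEQ_ignore_initial_segment[OF lim_inverse_n', of 2] by (simp add: add.commute)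
  have \<alpha>0: "\<alpha> \<longlonglongrightarrow> 0"
    using tendsto_rabs_zero_cancel tendsto_sandwich[OF _ _ tendsto_const lim, of "\<lambda>n. \<bar>\<alpha> n\<bar>"] \<alpha> by force
  have "(\<lambda>n. \<beta> n - 1) \<longlonglongrightarrow> 0"
    using tendsto_rabs_zero_cancel tendsto_sandwich[OF _ _ tendsto_const lim, of "\<lambda>n. \<bar>\<beta> n - 1\<bar>"] \<beta> by force
  then have \<beta>1: "\<beta> \<longlonglongrightarrow> 1" using tendsto_add[of "\<lambda>n. \<beta> n - 1" 0 _ "\<lambda>_. 1"] by simp
  have b: "\<bar>\<alpha> n\<bar> \<le> 1" "1 / 2 \<le> \<beta> n" "\<beta> n \<le> 2" for n
  proof -
    have "1 / (real n + 2) \<le> 1 / 2" by (simp add: field_simps)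
    then show "\<bar>\<alpha> n\<bar> \<le> 1" "1 / 2 \<le> \<beta> n" "\<beta> n \<le> 2" using \<alpha>[of n] \<beta>[of n] by linarith+
  qed
  obtain M where M: "0 \<le> M" "\<And>w. \<rho> w \<le> M" using noise_bound by blast
  \<comment> \<open>With |\<alpha>| \<le> 1 and \<beta> \<le> 2 the interval J contains the supports
    of all rescaled densities. The dominating constant 3 M is 2 M for \<rho> divided by \<beta>
    \<ge> 1 / 2, plus M for \<rho> itself.\<close>
  define J where "J = {- (2 * R + 1)..2 * R + 1}"
  have "(\<lambda>n. \<integral>v. \<bar>\<rho> ((v - \<alpha> n) / \<beta> n) / \<beta> n - \<rho> v\<bar> \<partial>lborel) \<longlonglongrightarrow> integral\<^sup>L lborel (\<lambda>v::real. 0::real)"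
  proof (rule integral_dominated_convergence[where w = "\<lambda>v. (3 * M) * indicator J v"])
    show "integrable lborel (\<lambda>v. (3 * M) * indicator J v)"
      unfolding J_def by (intro integrable_mult_right integrable_real_indicator) (auto simp: emeasure_lborel_Icc_eq)
    have "(\<lambda>n. \<bar>\<rho> ((v - \<alpha> n) / \<beta> n) / \<beta> n - \<rho> v\<bar>) \<longlonglongrightarrow> \<bar>\<rho> ((v - 0) / 1) / 1 - \<rho> v\<bar>" for v
      by (intro tendsto_intros \<alpha>0 \<beta>1 continuous_on_tendsto_compose[OF cont]) auto
    then show "AE v in lborel. (\<lambda>n. \<bar>\<rho> ((v - \<alpha> n) / \<beta> n) / \<beta> n - \<rho> v\<bar>) \<longlonglongrightarrow> 0" by simp
    show "AE v in lborel. norm \<bar>\<rho> ((v - \<alpha> n) / \<beta> n) / \<beta> n - \<rho> v\<bar> \<le> (3 * M) * indicator J v" for n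
    proof (intro AE_I2)
      fix v
      let ?u = "(v - \<alpha> n) / \<beta> n"
      show "norm \<bar>\<rho> ?u / \<beta> n - \<rho> v\<bar> \<le> (3 * M) * indicator J v"
      proof (cases "v \<in> J")
        case True
        have "\<rho> ?u / \<beta> n \<le> M / (1 / 2)" using M b[of n] by (intro frac_le) auto
        moreover have "0 \<le> \<rho> ?u / \<beta> n" using nonneg b[of n] by (intro divide_nonneg_nonneg) auto
        ultimately show ?thesis using True M(2)[of v] nonneg[of v] by simp
      next
        case False
        then have v: "2 * R + 1 < \<bar>v\<bar>" by (auto simp: J_def)
        then have "R * \<beta> n \<le> \<bar>v - \<alpha> n\<bar>" using b[of n] mult_left_mono[of "\<beta> n" 2 R] R_pos by linarith
        then have "R \<le> \<bar>?u\<bar>" using b[of n] by (simp add: field_simps)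
        then show ?thesis using False support[of ?u] support[of v] v R_pos by simp
      qed
    qed
  qed measurable
  then have "r \<le> 0" by (intro LIMSEQ_le_const[of _ 0]) (use ge in auto)
  then show False using assms by simp
qed

end

section \<open>Robust attraction\<close>

text \<open>Every orbit of f with errors up to \<eta> that starts at x enters A after finitely many
  steps, without meeting B before. The inductive form asks for no bound on the number of steps, and
  its rule is what later carries the vanishing of an eigenfunction backwards from A.\<close>

inductive robustly_reaches :: "('a::metric_space \<Rightarrow> 'a) \<Rightarrow> real \<Rightarrow> 'a set \<Rightarrow> 'a set \<Rightarrow> 'a \<Rightarrow> bool"
  for f \<eta> A B
  where
    target: "x \<in> A \<Longrightarrow> robustly_reaches f \<eta> A B x"
  | step: "x \<notin> A \<Longrightarrow> x \<notin> B \<Longrightarrow> (\<And>y. dist y (f x) \<le> \<eta> \<Longrightarrow> robustly_reaches f \<eta> A B y) \<Longrightarrow>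
      robustly_reaches f \<eta> A B x"

text \<open>Radii are proportional to \<kappa>, so that one step of f changes the parameter s by the
  same factor at every periodic point.\<close>

definition core :: "('a::metric_space \<Rightarrow> real) \<Rightarrow> 'a set \<Rightarrow> real \<Rightarrow> 'a set"
  where "core \<kappa> A s = (\<Union>a\<in>A. cball a (\<kappa> a * s))"

text \<open>In the adapted distance \<open>dist x a / \<kappa> a\<close> a single step contracts by
  \<theta> near S and expands by 1 / \<theta> near U. Both inequalities are stated with the
  denominators cleared.\<close>

locale hyperbolic_attraction =
  fixes f :: "'a::metric_space \<Rightarrow> 'a" and S U :: "'a set" and \<kappa> :: "'a \<Rightarrow> real" and \<theta> \<delta> :: real
  assumes compact_UNIV: "compact (UNIV :: 'a set)"
    and cont: "continuous_on UNIV f"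
    and finite_S: "finite S" and finite_U: "finite U" and disjoint: "S \<inter> U = {}"
    and inv_S: "\<And>a. a \<in> S \<Longrightarrow> f a \<in> S" and inv_U: "\<And>a. a \<in> U \<Longrightarrow> f a \<in> U"
    and \<kappa>_pos: "\<And>a. 0 < \<kappa> a"
    and \<theta>_pos: "0 < \<theta>" and \<theta>_less: "\<theta> < 1" and \<delta>_pos: "0 < \<delta>"
    and contract: "\<And>a x. a \<in> S \<Longrightarrow> dist x a \<le> \<delta> \<Longrightarrow> \<kappa> a * dist (f x) (f a) \<le> \<theta> * \<kappa> (f a) * dist x a"
    and expand: "\<And>a x. a \<in> U \<Longrightarrow> dist x a \<le> \<delta> \<Longrightarrow> \<kappa> (f a) * dist x a \<le> \<theta> * \<kappa> a * dist (f x) (f a)"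
    and attract: "\<And>x. x \<notin> U \<Longrightarrow> orbit_converges_to f x S"
begin

text \<open>A rate strictly between \<theta> and 1. The gap between the two rates pays for the noise
  in \<open>stable_step\<close> and \<open>unstable_step\<close>.\<close>

definition \<theta>' :: real where "\<theta>' = (1 + \<theta>) / 2"

lemma \<theta>'_bounds: "0 < \<theta>'" "\<theta> < \<theta>'" "\<theta>' < 1"
  using \<theta>_pos \<theta>_less by (auto simp: \<theta>'_def)

lemma \<kappa>_bounds: obtains k l where "0 < k" "\<And>a. a \<in> S \<union> U \<Longrightarrow> k \<le> \<kappa> a \<and> \<kappa> a \<le> l" "0 < l"
proof -
  have fin: "finite (insert 1 (\<kappa> ` (S \<union> U)))" using finite_S finite_U by simp
  have "0 < Min (insert 1 (\<kappa> ` (S \<union> U)))" using fin \<kappa>_pos by (subst Min_gr_iff) auto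
  moreover have "0 < Max (insert 1 (\<kappa> ` (S \<union> U)))" using fin by (subst Max_gr_iff) auto
  ultimately show ?thesis
    using fin by (intro that[of "Min (insert 1 (\<kappa> ` (S \<union> U)))" "Max (insert 1 (\<kappa> ` (S \<union> U)))"])
      (auto intro!: Min_le Max_ge)
qed

text \<open>An orbit that enters the finite invariant set U stays at positive distance from S,
  whereas orbits starting outside U converge to S.\<close>

lemma preimage_U: assumes "x \<notin> U" shows "f x \<notin> U"
proof
  assume fx: "f x \<in> U"
  have n: "(f ^^ n) x \<in> U" if "0 < n" for n
    using that
  proof (induction n)
    case (Suc n) then show ?case using fx inv_U by (cases n) auto
  qed simp
  have S: "S \<noteq> {}" "(\<lambda>n. infdist ((f ^^ n) x) S) \<longlonglongrightarrow> 0"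
    using attract[OF assms] by (auto simp: orbit_converges_to_def)
  define m where "m = Min ((\<lambda>x. infdist x S) ` U)"
  have "closed S" using finite_S by (rule finite_imp_closed)
  have "0 < infdist a S" if "a \<in> U" for a
    using in_closed_iff_infdist_zero[OF \<open>closed S\<close> S(1), of a] disjoint that infdist_nonneg[of a S] by force
  then have "0 < m" unfolding m_def using finite_U fx by (subst Min_gr_iff) auto
  then have "\<forall>\<^sub>F n in sequentially. infdist ((f ^^ n) x) S < m"
    using S(2) by (auto dest: order_tendstoD)
  then obtain N where N: "\<And>n. n \<ge> N \<Longrightarrow> infdist ((f ^^ n) x) S < m"
    unfolding eventually_sequentially by blast
  have "m \<le> infdist ((f ^^ Suc N) x) S"
    unfolding m_def using n[of "Suc N"] finite_U by (intro Min_le) auto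
  then show False using N[of "Suc N"] by simp
qed

text \<open>The last property says that a noisy step from near an unstable point a can land near no
  unstable point other than \<open>f a\<close>, so escape from U can be followed along one
  orbit.\<close>

lemma small_radius:
  obtains d where "0 < d" "\<And>a. a \<in> S \<union> U \<Longrightarrow> \<kappa> a * d \<le> \<delta>"
    and "core \<kappa> S d \<inter> core \<kappa> U d = {}"
    and "\<And>a b x y. a \<in> U \<Longrightarrow> b \<in> U \<Longrightarrow> b \<noteq> f a \<Longrightarrow> dist x a \<le> \<kappa> a * d \<Longrightarrow> dist y (f x) \<le> d \<Longrightarrow>
      \<kappa> b * d < dist y b"
proof -
  obtain l where l: "0 < l" "\<And>a. a \<in> S \<union> U \<Longrightarrow> \<kappa> a \<le> l" using \<kappa>_bounds by metis
  let ?Z = "S \<union> U"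
  have fin: "finite ?Z" using finite_S finite_U by simp
  define m where "m = Min (insert 1 ((\<lambda>(a, b). dist a b) ` {(a, b) \<in> ?Z \<times> ?Z. a \<noteq> b}))"
  have finm: "finite (insert 1 ((\<lambda>(a, b). dist a b) ` {(a, b) \<in> ?Z \<times> ?Z. a \<noteq> b}))"
    using fin by (auto intro: finite_subset[OF _ finite_cartesian_product[OF fin fin]])
  have m: "0 < m" unfolding m_def using finm by (subst Min_gr_iff) auto
  have sep: "m \<le> dist a b" if "a \<in> ?Z" "b \<in> ?Z" "a \<noteq> b" for a b
    unfolding m_def using finm that by (intro Min_le) (auto intro!: image_eqI[of _ _ "(a, b)"])
  obtain e where e: "0 < e" "\<And>a x. dist x a < e \<Longrightarrow> dist (f x) (f a) < m / 4"
    using compact_uniformly_continuous[OF cont compact_UNIV] m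
    unfolding uniformly_continuous_on_def by (metis UNIV_I dist_commute zero_less_divide_iff zero_less_numeral)
  \<comment> \<open>The bounds keep the cores inside the linear range \<delta>, inside the range e
    of uniform continuity (halved for a strict inequality), and within a quarter of the separation
    m. The image of the core and the noise then cost at most m / 4 each, so a noisy step ends more
    than m / 2 from any other unstable point.\<close>
  define d where "d = min (min (\<delta> / l) (e / (2 * l))) (min (m / (4 * l)) (m / 4))"
  have d: "0 < d" using \<delta>_pos l e m by (auto simp: d_def)
  have "l * d \<le> \<delta>" "l * d \<le> e / 2" "l * d \<le> m / 4" "d \<le> m / 4"
    using l(1) by (auto simp: d_def min_def field_simps split: if_splits)
  then have le: "\<kappa> a * d \<le> \<delta> \<and> \<kappa> a * d \<le> e / 2 \<and> \<kappa> a * d \<le> m / 4" if "a \<in> ?Z" for a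
    using mult_right_mono[OF l(2)[OF that], of d] d by linarith
  show ?thesis
  proof (rule that[OF d])
    show "\<And>a. a \<in> S \<union> U \<Longrightarrow> \<kappa> a * d \<le> \<delta>" using le by blast
    show "core \<kappa> S d \<inter> core \<kappa> U d = {}"
    proof (rule ccontr)
      assume "core \<kappa> S d \<inter> core \<kappa> U d \<noteq> {}"
      then obtain a b x where ab: "a \<in> S" "b \<in> U" "dist a x \<le> \<kappa> a * d" "dist b x \<le> \<kappa> b * d"
        unfolding core_def by auto
      have "a \<noteq> b" using ab disjoint by blast
      then have "m \<le> dist a b" using sep ab by blast
      then show False using dist_triangle2[of a b x] ab le[of a] le[of b] m by auto
    qed
    fix a b x y assume ab: "a \<in> U" "b \<in> U" "b \<noteq> f a" and x: "dist x a \<le> \<kappa> a * d" and y: "dist y (f x) \<le> d"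
    have "m \<le> dist b (f a)" using ab inv_U by (intro sep) auto
    moreover have "dist (f x) (f a) < m / 4" using e(1) le[of a] x ab by (intro e(2)) auto
    moreover have "dist b (f a) \<le> dist y b + dist y (f x) + dist (f x) (f a)"
      using dist_triangle[of b "f a" y] dist_triangle[of y "f a" "f x"] by (simp add: dist_commute)
    ultimately show "\<kappa> b * d < dist y b" using le[of b] ab y \<open>d \<le> m / 4\<close> m by auto
  qed
qed

lemma stable_step:
  assumes s: "a \<in> S" "dist x a \<le> \<delta>" "dist x a \<le> \<kappa> a * s" "dist y (f x) \<le> \<eta>"
    and \<eta>: "\<And>a. a \<in> S \<Longrightarrow> \<eta> \<le> (\<theta>' - \<theta>) * \<kappa> a * s"
  shows "dist y (f a) \<le> \<kappa> (f a) * (\<theta>' * s)"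
proof -
  have "\<kappa> a * dist (f x) (f a) \<le> \<theta> * \<kappa> (f a) * dist x a" by (rule contract[OF s(1,2)])
  also have "\<dots> \<le> \<theta> * \<kappa> (f a) * (\<kappa> a * s)" using s \<theta>_pos \<kappa>_pos[of "f a"] by (intro mult_left_mono) auto
  finally have "\<kappa> a * dist (f x) (f a) \<le> \<kappa> a * (\<theta> * \<kappa> (f a) * s)" by (simp add: mult_ac)
  then have "dist (f x) (f a) \<le> \<theta> * \<kappa> (f a) * s" using \<kappa>_pos[of a] by simp
  then have "dist y (f a) \<le> (\<theta>' - \<theta>) * \<kappa> (f a) * s + \<theta> * \<kappa> (f a) * s"
    using dist_triangle[of y "f a" "f x"] s(4) \<eta>[OF inv_S[OF s(1)]] by linarith
  then show ?thesis by (simp add: algebra_simps)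
qed

lemma unstable_step:
  assumes s: "a \<in> U" "dist x a \<le> \<delta>" "\<kappa> a * s < dist x a" "dist y (f x) \<le> \<eta>"
    and \<eta>: "\<And>a. a \<in> U \<Longrightarrow> \<eta> \<le> (1 / \<theta> - 1 / \<theta>') * \<kappa> a * s"
  shows "\<kappa> (f a) * (s / \<theta>') < dist y (f a)"
proof -
  have "\<kappa> a * (\<kappa> (f a) * s) < \<kappa> (f a) * dist x a" using s(3) \<kappa>_pos[of "f a"] by (simp add: mult_ac)
  also have "\<dots> \<le> \<theta> * \<kappa> a * dist (f x) (f a)" by (rule expand[OF s(1,2)])
  finally have "\<kappa> a * (\<kappa> (f a) * s) < \<kappa> a * (\<theta> * dist (f x) (f a))" by (simp add: mult_ac)
  then have "\<kappa> (f a) * s < \<theta> * dist (f x) (f a)" using \<kappa>_pos[of a] by simp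
  then have "\<kappa> (f a) * s / \<theta> < dist (f x) (f a)" using \<theta>_pos by (simp add: field_simps)
  then have "\<kappa> (f a) * s / \<theta> - (1 / \<theta> - 1 / \<theta>') * \<kappa> (f a) * s < dist y (f a)"
    using dist_triangle[of "f x" "f a" y] s(4) \<eta>[OF inv_U[OF s(1)]] by (simp add: dist_commute)
  then show ?thesis by (simp add: algebra_simps)
qed

text \<open>The hypotheses say that noise of size L \<epsilon> fits into the gap of rates at scale K
  \<epsilon>, and therefore at every larger scale s. Three regions are treated: a fixed
  neighbourhood of S, the compact complement of a fixed neighbourhood of U, and the annuli around U
  between the scale K \<epsilon> and the fixed one.\<close>

lemma eventually_robustly_reaches:
  assumes L: "0 < L" and K: "0 < K"
    and LS: "\<And>a. a \<in> S \<Longrightarrow> L \<le> (\<theta>' - \<theta>) * \<kappa> a * K"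
    and LU: "\<And>a. a \<in> U \<Longrightarrow> L \<le> (1 / \<theta> - 1 / \<theta>') * \<kappa> a * K"
  shows "\<forall>\<^sub>F \<epsilon> in at_right 0. \<forall>x. x \<notin> core \<kappa> U (K * \<epsilon>) \<longrightarrow>
    robustly_reaches f (L * \<epsilon>) (core \<kappa> S (K * \<epsilon>)) (core \<kappa> U (K * \<epsilon>)) x"
proof -
  let ?R = "\<lambda>\<epsilon>. robustly_reaches f (L * \<epsilon>) (core \<kappa> S (K * \<epsilon>)) (core \<kappa> U (K * \<epsilon>))"
  obtain k l where kl: "0 < k" "\<And>a. a \<in> S \<union> U \<Longrightarrow> k \<le> \<kappa> a \<and> \<kappa> a \<le> l" "0 < l"
    using \<kappa>_bounds by metis
  obtain d where d: "0 < d" "\<And>a. a \<in> S \<union> U \<Longrightarrow> \<kappa> a * d \<le> \<delta>"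
    and d_disj: "core \<kappa> S d \<inter> core \<kappa> U d = {}"
    and d_sep: "\<And>a b x y. a \<in> U \<Longrightarrow> b \<in> U \<Longrightarrow> b \<noteq> f a \<Longrightarrow> dist x a \<le> \<kappa> a * d \<Longrightarrow>
      dist y (f x) \<le> d \<Longrightarrow> \<kappa> b * d < dist y b"
    using small_radius by metis
  have mono_S: "core \<kappa> S s \<subseteq> core \<kappa> S t" and mono_U: "core \<kappa> U s \<subseteq> core \<kappa> U t"
    if "s \<le> t" for s t
  proof -
    have "\<kappa> a * s \<le> \<kappa> a * t" for a using \<kappa>_pos[of a] that by simp
    then show "core \<kappa> S s \<subseteq> core \<kappa> S t" "core \<kappa> U s \<subseteq> core \<kappa> U t"
      unfolding core_def by (meson UN_mono order_refl subset_cball)+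
  qed

  have near_S: "?R \<epsilon> x" if \<epsilon>: "0 < \<epsilon>" "K * \<epsilon> \<le> d" and x: "x \<in> core \<kappa> S d" for \<epsilon> x
  proof -
    \<comment> \<open>n counts contractions by \<theta>' that bring the radius s down to the target
      size K \<epsilon>.\<close>
    have *: "?R \<epsilon> x" if "s \<le> d" "s * \<theta>' ^ n \<le> K * \<epsilon>" "x \<in> core \<kappa> S s" for n s x
      using that
    proof (induction n arbitrary: s x)
      case 0
      then have "x \<in> core \<kappa> S (K * \<epsilon>)" using mono_S[of s "K * \<epsilon>"] by auto
      then show ?case by (rule target)
    next
      case (Suc n)
      show ?case
      proof (cases "x \<in> core \<kappa> S (K * \<epsilon>)")
        case False
        then have s: "K * \<epsilon> < s" using Suc.prems mono_S[of s "K * \<epsilon>"] by force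
        have "x \<in> core \<kappa> S d" using Suc.prems mono_S by blast
        then have xU: "x \<notin> core \<kappa> U (K * \<epsilon>)" using d_disj mono_U[OF \<epsilon>(2)] by blast
        obtain a where a: "a \<in> S" "dist x a \<le> \<kappa> a * s"
          using Suc.prems(3) by (auto simp: core_def dist_commute)
        have "dist x a \<le> \<delta>"
          using a(2) d(2)[OF UnI1[OF a(1)]] mult_left_mono[OF Suc.prems(1) less_imp_le[OF \<kappa>_pos[of a]]]
          by linarith
        note st = stable_step[OF a(1) this a(2)]
        have \<eta>: "L * \<epsilon> \<le> (\<theta>' - \<theta>) * \<kappa> b * s" if "b \<in> S" for b
        proof -
          have "L * \<epsilon> \<le> (\<theta>' - \<theta>) * \<kappa> b * K * \<epsilon>" using LS[OF that] \<epsilon> by (intro mult_right_mono) auto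
          also have "\<dots> = (\<theta>' - \<theta>) * \<kappa> b * (K * \<epsilon>)" by simp
          also have "\<dots> \<le> (\<theta>' - \<theta>) * \<kappa> b * s"
            using \<theta>'_bounds \<kappa>_pos[of b] s by (intro mult_left_mono) auto
          finally show ?thesis .
        qed
        show ?thesis
        proof (rule step[OF False xU])
          fix y assume "dist y (f x) \<le> L * \<epsilon>"
          from st[OF this \<eta>] have "y \<in> core \<kappa> S (\<theta>' * s)"
            using inv_S[OF a(1)] by (auto simp: core_def dist_commute intro!: bexI[of _ "f a"])
          moreover have "0 < s" using s K \<epsilon> mult_pos_pos[of K \<epsilon>] by linarith
          then have "\<theta>' * s \<le> d" using Suc.prems(1) \<theta>'_bounds mult_right_mono[of \<theta>' 1 s] by linarith
          ultimately show "?R \<epsilon> y" using Suc.prems(2) by (intro Suc.IH[of "\<theta>' * s"]) (auto simp: mult_ac)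
        qed
      qed (rule target)
    qed
    have "0 < K * \<epsilon> / d" using K \<epsilon> d by simp
    then obtain n where "\<theta>' ^ n < K * \<epsilon> / d"
      using real_arch_pow_inv \<theta>'_bounds by blast
    then have "d * \<theta>' ^ n \<le> K * \<epsilon>" using d by (simp add: field_simps)
    then show ?thesis using *[OF order_refl] x by blast
  qed

  \<comment> \<open>Induction on the time m at which the noiseless orbit enters the d-core of S.
    Nearby points with small noise follow it by continuity, and \<open>preimage_U\<close> keeps the
    orbit off U, hence at positive distance from it at each of these times.\<close>
  have away: "\<exists>r>0. \<exists>e>0. \<forall>\<epsilon> y. 0 < \<epsilon> \<longrightarrow> \<epsilon> < e \<longrightarrow> dist y x < r \<longrightarrow> ?R \<epsilon> y"
    if "x \<notin> U" "a \<in> S" "dist ((f ^^ m) x) a < \<kappa> a * d" for m x a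
    using that
  proof (induction m arbitrary: x)
    case 0
    show ?case
    proof (intro exI conjI allI impI)
      show "0 < \<kappa> a * d - dist x a" using 0 by simp
      show "0 < d / K" using d K by simp
      fix \<epsilon> y assume e: "0 < \<epsilon>" "\<epsilon> < d / K" and "dist y x < \<kappa> a * d - dist x a"
      then have "dist y a \<le> \<kappa> a * d" using dist_triangle[of y a x] by simp
      then have "y \<in> core \<kappa> S d" using 0 by (auto simp: core_def dist_commute)
      then show "?R \<epsilon> y" using e K by (intro near_S) (auto simp: field_simps)
    qed
  next
    case (Suc m)
    have "(f ^^ Suc m) x = (f ^^ m) (f x)" by (simp add: funpow_swap1)
    then obtain r' e' where r': "0 < r'" "0 < e'"
      "\<And>\<epsilon> y. 0 < \<epsilon> \<Longrightarrow> \<epsilon> < e' \<Longrightarrow> dist y (f x) < r' \<Longrightarrow> ?R \<epsilon> y"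
      using Suc.IH[of "f x"] preimage_U Suc.prems by metis
    obtain r where r: "0 < r" "\<And>y. dist y x < r \<Longrightarrow> dist (f y) (f x) < r' / 2"
      using cont r'(1) unfolding continuous_on_iff by (metis UNIV_I half_gt_zero)
    obtain g where g: "0 < g" "\<And>u. u \<in> U \<Longrightarrow> g \<le> dist x u"
      using finite_set_avoid[OF finite_U, of x] Suc.prems(1) by metis
    show ?case
    proof (intro exI conjI allI impI)
      show "0 < min r (g / 2)" using r g by simp
      show "0 < min e' (min (r' / (2 * L)) (g / (2 * l * K)))" using r' L g kl K by simp
      fix \<epsilon> y assume e: "0 < \<epsilon>" "\<epsilon> < min e' (min (r' / (2 * L)) (g / (2 * l * K)))"
        and y: "dist y x < min r (g / 2)"
      show "?R \<epsilon> y"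
      proof (cases "y \<in> core \<kappa> S (K * \<epsilon>)")
        case False
        have "y \<notin> core \<kappa> U (K * \<epsilon>)"
        proof
          assume "y \<in> core \<kappa> U (K * \<epsilon>)"
          then obtain u where u: "u \<in> U" "dist y u \<le> \<kappa> u * (K * \<epsilon>)"
            by (auto simp: core_def dist_commute)
          have "\<kappa> u * (K * \<epsilon>) \<le> l * (K * \<epsilon>)" using kl u(1) K e by (intro mult_right_mono) auto
          also have "\<dots> < g / 2" using e(2) kl K by (simp add: field_simps)
          finally show False using dist_triangle[of x u y] y g(2)[OF u(1)] u(2) by (simp add: dist_commute)
        qed
        then show ?thesis
        proof (rule step[OF False])
          fix z assume "dist z (f y) \<le> L * \<epsilon>"
          moreover have "L * \<epsilon> < r' / 2" using e(2) L by (simp add: field_simps)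
          moreover have "dist (f y) (f x) < r' / 2" using y by (intro r(2)) simp
          ultimately have "dist z (f x) < r'" using dist_triangle[of z "f x" "f y"] by simp
          then show "?R \<epsilon> z" using e by (intro r'(3)) auto
        qed
      qed (rule target)
    qed
  qed

  \<comment> \<open>Compactness turns thresholds for \<epsilon> that depend on the point into the
    single threshold e1.\<close>
  define C where "C = UNIV - (\<Union>a\<in>U. ball a (\<kappa> a * d))"
  have "compact C"
    unfolding C_def by (intro compact_diff compact_UNIV open_UN ballI open_ball)
  have "\<exists>r>0. \<exists>e>0. \<forall>\<epsilon> y. 0 < \<epsilon> \<longrightarrow> \<epsilon> < e \<longrightarrow> dist y x < r \<longrightarrow> ?R \<epsilon> y" if x: "x \<in> C" for x
  proof -
    have xU: "x \<notin> U" using x \<kappa>_pos d(1) by (force simp: C_def)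
    have S: "S \<noteq> {}" "(\<lambda>n. infdist ((f ^^ n) x) S) \<longlonglongrightarrow> 0"
      using attract[OF xU] by (auto simp: orbit_converges_to_def)
    have "0 < k * d" using kl d by simp
    then have "\<forall>\<^sub>F n in sequentially. infdist ((f ^^ n) x) S < k * d"
      using S(2) by (auto dest: order_tendstoD)
    then obtain m where "infdist ((f ^^ m) x) S < k * d"
      unfolding eventually_sequentially by blast
    then obtain a where a: "a \<in> S" "dist ((f ^^ m) x) a < k * d"
      using S(1) unfolding infdist_def by (auto dest!: cInf_lessD[rotated])
    moreover have "k * d \<le> \<kappa> a * d" using kl(2)[of a] a d by (intro mult_right_mono) auto
    ultimately show ?thesis by (intro away[OF xU a(1), of m]) auto
  qed
  then obtain r e where re: "\<And>x. x \<in> C \<Longrightarrow> 0 < r x" "\<And>x. x \<in> C \<Longrightarrow> 0 < e x"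
    "\<And>x \<epsilon> y. x \<in> C \<Longrightarrow> 0 < \<epsilon> \<Longrightarrow> \<epsilon> < e x \<Longrightarrow> dist y x < r x \<Longrightarrow> ?R \<epsilon> y"
    by metis
  have "C \<subseteq> (\<Union>x\<in>C. ball x (r x))" using re(1) by force
  then obtain C' where C': "C' \<subseteq> C" "finite C'" "C \<subseteq> (\<Union>x\<in>C'. ball x (r x))"
    by (rule compactE_image[OF \<open>compact C\<close> open_ball])
  define e1 where "e1 = Min (insert 1 (e ` C'))"
  have "0 < e1" unfolding e1_def using C' re(2) by (subst Min_gr_iff) auto
  have far: "?R \<epsilon> y" if "0 < \<epsilon>" "\<epsilon> < e1" "y \<in> C" for \<epsilon> y
  proof -
    obtain x where x: "x \<in> C'" "dist y x < r x" using C' \<open>y \<in> C\<close> by (auto simp: dist_commute)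
    have "e1 \<le> e x" unfolding e1_def using x C' by (intro Min_le) auto
    then show ?thesis using re(3)[of x \<epsilon> y] x C' that by auto
  qed

  have main: "?R \<epsilon> x" if \<epsilon>: "0 < \<epsilon>" "\<epsilon> < e1" "K * \<epsilon> \<le> d" "L * \<epsilon> \<le> d"
    and x: "x \<notin> core \<kappa> U (K * \<epsilon>)" for \<epsilon> x
  proof -
    \<comment> \<open>n counts expansions by 1 / \<theta>' that bring the adapted distance from U up
      to d, where the compact region C begins.\<close>
    have *: "?R \<epsilon> x" if "K * \<epsilon> \<le> s" "d \<le> s / \<theta>' ^ n" "x \<notin> core \<kappa> U s" for n s x
      using that
    proof (induction n arbitrary: s x)
      case 0
      then have "x \<notin> core \<kappa> U d" using mono_U[of d s] by auto
      then have "x \<in> C" by (auto simp: C_def core_def)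
      then show ?case using \<epsilon> far by blast
    next
      case (Suc n)
      show ?case
      proof (cases "x \<in> core \<kappa> S (K * \<epsilon>) \<or> x \<in> C")
        case True then show ?thesis using \<epsilon> far target by blast
      next
        case False
        then obtain a where a: "a \<in> U" "dist x a \<le> \<kappa> a * d"
          by (auto simp: C_def dist_commute)
        have xs: "\<kappa> a * s < dist x a"
          using Suc.prems(3) a(1) by (auto simp: core_def dist_commute not_le)
        have "\<kappa> a * s < \<kappa> a * d" using xs a by simp
        then have sd: "s < d" using \<kappa>_pos[of a] by simp
        have s0: "0 < s" using Suc.prems(1) K \<epsilon> mult_pos_pos[of K \<epsilon>] by linarith
        have "x \<notin> core \<kappa> U (K * \<epsilon>)" using Suc.prems mono_U[OF Suc.prems(1)] by blast
        have "dist x a \<le> \<delta>" using a d(2)[of a] by simp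
        note st = unstable_step[OF a(1) this xs]
        have \<eta>: "L * \<epsilon> \<le> (1 / \<theta> - 1 / \<theta>') * \<kappa> b * s" if "b \<in> U" for b
        proof -
          have "L * \<epsilon> \<le> (1 / \<theta> - 1 / \<theta>') * \<kappa> b * K * \<epsilon>" using LU[OF that] \<epsilon> by (intro mult_right_mono) auto
          also have "\<dots> = (1 / \<theta> - 1 / \<theta>') * \<kappa> b * (K * \<epsilon>)" by simp
          also have "\<dots> \<le> (1 / \<theta> - 1 / \<theta>') * \<kappa> b * s"
            using \<theta>'_bounds \<theta>_pos \<kappa>_pos[of b] Suc.prems(1) by (intro mult_left_mono) (auto simp: field_simps)
          finally show ?thesis .
        qed
        \<comment> \<open>The cap at d is needed because \<open>d_sep\<close> excludes the other
          unstable points only up to that radius.\<close>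
        define s' where "s' = min (s / \<theta>') d"
        have "s \<le> s / \<theta>'" using s0 \<theta>'_bounds by (simp add: field_simps)
        show ?thesis
        proof (rule step)
          show "x \<notin> core \<kappa> S (K * \<epsilon>)" using False by blast
          show "x \<notin> core \<kappa> U (K * \<epsilon>)" by fact
          fix y assume y: "dist y (f x) \<le> L * \<epsilon>"
          have "\<kappa> b * s' < dist y b" if b: "b \<in> U" for b
          proof (cases "b = f a")
            case True
            have "\<kappa> b * s' \<le> \<kappa> b * (s / \<theta>')"
              unfolding s'_def using \<kappa>_pos[of b] by (intro mult_left_mono) auto
            also have "\<dots> < dist y b" using st[OF y \<eta>] True by simp
            finally show ?thesis .
          next
            case False
            have "\<kappa> b * s' \<le> \<kappa> b * d" using \<kappa>_pos[of b] by (simp add: s'_def)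
            also have "\<dots> < dist y b" using d_sep[OF a(1) b False a(2), of y] y \<epsilon> by simp
            finally show ?thesis .
          qed
          then have "y \<notin> core \<kappa> U s'" by (force simp: core_def dist_commute not_le)
          moreover have "K * \<epsilon> \<le> s'" using Suc.prems(1) \<epsilon> \<open>s \<le> s / \<theta>'\<close> by (simp add: s'_def)
          moreover have "d \<le> s' / \<theta>' ^ n"
          proof (cases "s / \<theta>' \<le> d")
            case True then show ?thesis using Suc.prems(2) by (simp add: s'_def)
          next
            case False
            have "\<theta>' ^ n \<le> 1" using \<theta>'_bounds by (intro power_le_one) auto
            then have "d * \<theta>' ^ n \<le> d" using d by simp
            then show ?thesis using False \<theta>'_bounds by (simp add: s'_def field_simps)
          qed
          ultimately show "?R \<epsilon> y" by (intro Suc.IH)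
        qed
      qed
    qed
    have "0 < K * \<epsilon> / d" using K \<epsilon> d by simp
    then obtain n where "\<theta>' ^ n < K * \<epsilon> / d"
      using real_arch_pow_inv \<theta>'_bounds by blast
    then have "d \<le> K * \<epsilon> / \<theta>' ^ n" using d \<theta>'_bounds by (simp add: field_simps)
    then show ?thesis using *[OF order_refl] x by blast
  qed
  have "\<forall>\<^sub>F \<epsilon> in at_right 0. \<epsilon> \<in> {0<..<min e1 (min (d / K) (d / L))}"
    using \<open>0 < e1\<close> d K L by (intro eventually_at_right_real) simp
  then show ?thesis
  proof eventually_elim
    case (elim \<epsilon>)
    have "K * \<epsilon> \<le> d" "L * \<epsilon> \<le> d" using elim K L by (auto simp: field_simps)
    then show ?case using elim main by auto
  qed
qed

end

section \<open>Geometry of the circle\<close>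

lemma angle_norm_small: assumes "\<bar>t\<bar> \<le> pi" shows "angle_norm t = \<bar>t\<bar>"
proof (rule antisym)
  show "angle_norm t \<le> \<bar>t\<bar>" using angle_norm_le[of t 0] by simp
  obtain k :: int where k: "angle_norm t = \<bar>t + 2 * pi * of_int k\<bar>" using angle_norm_attained by blast
  show "\<bar>t\<bar> \<le> angle_norm t"
  proof (cases "k = 0")
    case False
    then have "1 \<le> \<bar>of_int k :: real\<bar>" by linarith
    then have "2 * pi \<le> \<bar>2 * pi * of_int k\<bar>" by (simp add: abs_mult)
    then show ?thesis using k assms by linarith
  qed (simp add: k)
qed

lemma dist_circle_translate: "dist (x + z) (y + z) = dist x (y :: circle)"
  by (cases x, cases y, cases z) (simp add: to_circle_add[symmetric] dist_circle.abs_eq)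

lemma dist_circle_0: "dist (to_circle t) 0 = angle_norm t"
  using dist_circle.abs_eq[of t 0] by simp

lemma dist_circle_diff: "dist x y = dist (x - y) (0 :: circle)"
  using dist_circle_translate[of x "- y" y] by simp

lemma dist_add_to_circle: "\<bar>t\<bar> \<le> pi \<Longrightarrow> dist (a + to_circle t) a = \<bar>t\<bar>"
  by (simp add: dist_circle_diff[of _ a] dist_circle_0 angle_norm_small)

lemma dist_add_to_circle_le: "dist (a + to_circle t) a \<le> \<bar>t\<bar>"
  using dist_to_circle_le[of t 0] by (simp add: dist_circle_diff[of _ a])

lemma compact_circle: "compact (UNIV :: circle set)"
proof -
  have "x \<in> to_circle ` {0..2 * pi}" for x
  proof (cases x)
    fix u assume u: "x = to_circle u"
    define k where "k = \<lfloor>u / (2 * pi)\<rfloor>"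
    have "of_int k \<le> u / (2 * pi)" "u / (2 * pi) \<le> of_int k + 1" unfolding k_def by linarith+
    then have "u - 2 * pi * of_int k \<in> {0..2 * pi}" by (auto simp: field_simps)
    moreover have "x = to_circle (u - 2 * pi * of_int k)"
      unfolding u to_circle_eq_iff by (intro exI[of _ k]) simp
    ultimately show ?thesis by blast
  qed
  then have "(UNIV :: circle set) = to_circle ` {0..2 * pi}" by auto
  then show ?thesis
    using compact_continuous_image[OF continuous_on_to_circle[OF continuous_on_id], of "{0..2 * pi}"] by simp
qed

instance circle :: topological_group_add
proof
  fix x :: circle
  have "dist (- u) (- v) = dist u v" for u v :: circle
    using dist_circle_translate[of "- u" "u + v" "- v"] by (simp add: dist_commute add.commute)
  then show "(uminus \<longlongrightarrow> - x) (nhds x)"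
    unfolding tendsto_iff eventually_nhds_metric by auto
qed

lemma borel_measurable_circle_diff [measurable]:
  fixes g h :: "'a \<Rightarrow> circle"
  assumes [measurable]: "g \<in> borel_measurable M" "h \<in> borel_measurable M"
  shows "(\<lambda>x. g x - h x) \<in> borel_measurable M"
proof -
  have [measurable]: "(uminus :: circle \<Rightarrow> circle) \<in> borel_measurable borel"
    by (intro borel_measurable_continuous_onI continuous_on_minus continuous_on_id)
  have "(\<lambda>x. g x + - h x) \<in> borel_measurable M" by measurable
  then show ?thesis by simp
qed

section \<open>Signed angular displacement\<close>

definition angle :: "circle \<Rightarrow> real" where
  "angle x = (THE t. - pi \<le> t \<and> t < pi \<and> to_circle t = x)"

lemma angle_unique:
  assumes "- pi \<le> s" "s < pi" "- pi \<le> t" "t < pi" "to_circle s = to_circle t" shows "s = t"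
proof -
  obtain k :: int where k: "s = t + 2 * pi * of_int k" using assms(5) to_circle_eq_iff by blast
  have "k = 0"
  proof (rule ccontr)
    assume "k \<noteq> 0"
    then have "1 \<le> \<bar>of_int k :: real\<bar>" by linarith
    then have "2 * pi \<le> \<bar>2 * pi * of_int k\<bar>" by (simp add: abs_mult)
    then show False using k assms by linarith
  qed
  then show ?thesis using k by simp
qed

lemma angle_props: "- pi \<le> angle x \<and> angle x < pi \<and> to_circle (angle x) = x"
  unfolding angle_def
proof (rule theI')
  obtain u where u: "x = to_circle u" by (cases x)
  define k where "k = \<lfloor>(u + pi) / (2 * pi)\<rfloor>"
  have "of_int k \<le> (u + pi) / (2 * pi)" "(u + pi) / (2 * pi) < of_int k + 1" unfolding k_def by linarith+
  then have "- pi \<le> u - 2 * pi * of_int k" "u - 2 * pi * of_int k < pi" by (auto simp: field_simps)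
  moreover have "to_circle (u - 2 * pi * of_int k) = x"
    unfolding u to_circle_eq_iff by (intro exI[of _ "- k"]) simp
  ultimately show "\<exists>!t. - pi \<le> t \<and> t < pi \<and> to_circle t = x"
    using angle_unique by blast
qed

lemma to_circle_angle [simp]: "to_circle (angle x) = x" using angle_props by blast

lemma angle_to_circle: "- pi \<le> t \<Longrightarrow> t < pi \<Longrightarrow> angle (to_circle t) = t"
  using angle_unique[of "angle (to_circle t)" t] angle_props[of "to_circle t"] by simp

lemma abs_angle: "\<bar>angle (x - a)\<bar> = dist x a"
  using angle_norm_small[of "angle (x - a)"] angle_props[of "x - a"]
  by (simp add: dist_circle_diff[of x a] dist_circle_0[symmetric] abs_le_iff)

lemma angle_measurable [measurable]: "angle \<in> borel_measurable borel"
proof (rule borel_measurableI_le)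
  fix c
  have "{x \<in> space borel. angle x \<le> c} = to_circle ` {- pi..c}" if "- pi \<le> c" "c < pi"
  proof safe
    fix x assume "angle x \<le> c"
    then show "x \<in> to_circle ` {- pi..c}"
      using angle_props[of x] by (intro image_eqI[of _ _ "angle x"]) auto
  next
    fix t assume "t \<in> {- pi..c}"
    then show "angle (to_circle t) \<le> c" using that by (subst angle_to_circle) auto
  qed simp
  moreover have "closed (to_circle ` {- pi..c})"
    by (intro compact_imp_closed compact_continuous_image continuous_on_to_circle continuous_on_id compact_Icc)
  moreover have "{x \<in> space borel. angle x \<le> c} = {}" if "c < - pi"
    using that angle_props by (auto simp: not_le) (metis order_less_le_trans linorder_not_le)
  moreover have "{x \<in> space borel. angle x \<le> c} = UNIV" if "pi \<le> c"
    using that angle_props by (auto intro: order_trans less_imp_le)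
  ultimately show "{x \<in> space borel. angle x \<le> c} \<in> sets borel"
    by (cases "c < - pi"; cases "pi \<le> c") (auto intro: borel_closed)
qed

section \<open>Lifts, linearization and the chain rule\<close>

lemma smooth_circle_map_lift:
  assumes "smooth_circle_map f"
  obtains F where "\<And>t. f (to_circle t) = to_circle (F t)" "\<And>t. (F has_real_derivative deriv F t) (at t)"
proof -
  obtain F where F: "smooth_real F" "\<And>t. f (to_circle t) = to_circle (F t)"
    using assms unfolding smooth_circle_map_def by blast
  have "(deriv ^^ 0) F differentiable (at t)" for t
    using F(1) unfolding smooth_real_def by blast
  then have "(F has_real_derivative deriv F t) (at t)" for t
    by (simp add: DERIV_deriv_iff_real_differentiable)
  then show ?thesis using that F(2) by blast
qed

lemma smooth_circle_map_continuous:
  assumes "smooth_circle_map f" shows "continuous_on UNIV f"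
proof -
  obtain F where F: "\<And>t. f (to_circle t) = to_circle (F t)" "\<And>t. (F has_real_derivative deriv F t) (at t)"
    using smooth_circle_map_lift[OF assms] by blast
  show ?thesis
    unfolding F(1)
    by (intro continuous_on_circleI[of f])
      (auto simp: F(1) intro!: continuous_on_to_circle DERIV_continuous_on F(2))
qed

lemma circle_deriv_linearization:
  assumes "smooth_circle_map f" "0 < \<nu>"
  obtains d where "0 < d" "\<And>t. \<bar>t\<bar> \<le> d \<Longrightarrow>
    dist (f (a + to_circle t)) (f a + to_circle (circle_deriv f a * t)) \<le> \<nu> * \<bar>t\<bar>"
proof -
  obtain F where F: "\<And>t. f (to_circle t) = to_circle (F t)" "\<And>t. (F has_real_derivative deriv F t) (at t)"
    using smooth_circle_map_lift[OF assms(1)] by blast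
  obtain \<tau> where a: "a = to_circle \<tau>" by (cases a)
  have D: "circle_deriv f a = deriv F \<tau>" unfolding a by (rule circle_deriv_eq[OF F])
  have "(F has_derivative (\<lambda>h. deriv F \<tau> * h)) (at \<tau>)"
    using F(2)[of \<tau>] by (simp add: has_field_derivative_def)
  then obtain d where d: "0 < d" "\<And>y. norm (y - \<tau>) < d \<Longrightarrow>
      norm (F y - F \<tau> - deriv F \<tau> * (y - \<tau>)) \<le> \<nu> * norm (y - \<tau>)"
    using assms(2) unfolding has_derivative_at_alt by blast
  show ?thesis
  proof (rule that[of "d / 2"])
    fix t assume t: "\<bar>t\<bar> \<le> d / 2"
    have "dist (f (a + to_circle t)) (f a + to_circle (circle_deriv f a * t)) =
        dist (to_circle (F (\<tau> + t))) (to_circle (F \<tau> + deriv F \<tau> * t))"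
      unfolding D by (simp add: a to_circle_add[symmetric] F(1))
    also have "\<dots> \<le> \<bar>F (\<tau> + t) - (F \<tau> + deriv F \<tau> * t)\<bar>" by (rule dist_to_circle_le)
    also have "\<dots> \<le> \<nu> * \<bar>t\<bar>" using d(2)[of "\<tau> + t"] t d(1) by (simp add: diff_diff_eq)
    finally show "dist (f (a + to_circle t)) (f a + to_circle (circle_deriv f a * t)) \<le> \<nu> * \<bar>t\<bar>" .
  qed (use d in simp)
qed

text \<open>Iterates of a lift are lifts of the iterates, so the chain rule on the line
  transfers.\<close>

lemma circle_deriv_funpow:
  assumes "smooth_circle_map f"
  shows "circle_deriv (f ^^ n) x = (\<Prod>k<n. circle_deriv f ((f ^^ k) x))"
proof -
  obtain F where F: "\<And>t. f (to_circle t) = to_circle (F t)" "\<And>t. (F has_real_derivative deriv F t) (at t)"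
    using smooth_circle_map_lift[OF assms] by blast
  obtain t where x: "x = to_circle t" by (cases x)
  have lift: "(f ^^ n) (to_circle s) = to_circle ((F ^^ n) s)" for n s
    by (induction n) (auto simp: F)
  have "((F ^^ n) has_real_derivative (\<Prod>k<n. deriv F ((F ^^ k) t))) (at t)"
  proof (induction n)
    case (Suc n)
    from DERIV_chain[OF F(2) Suc] show ?case by (simp add: mult.commute comp_def)
  qed (simp add: id_def)
  then have "circle_deriv (f ^^ n) x = (\<Prod>k<n. deriv F ((F ^^ k) t))"
    unfolding x by (rule circle_deriv_eq[where G = "F ^^ n", OF lift])
  also have "\<dots> = (\<Prod>k<n. circle_deriv f ((f ^^ k) x))"
    unfolding x lift by (intro prod.cong refl circle_deriv_eq[OF F, symmetric])
  finally show ?thesis .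
qed

section \<open>Products along periodic orbits\<close>

lemma prod_orbit_shift:
  assumes "(f ^^ n) a = a"
  shows "(\<Prod>k<n. g ((f ^^ k) (f a))) = (\<Prod>k<n. g ((f ^^ k) a) :: 'b::comm_monoid_mult)"
proof (cases n)
  case (Suc m)
  have sh: "(f ^^ k) (f a) = (f ^^ Suc k) a" for k by (simp add: funpow_swap1)
  have "(\<Prod>k<n. g ((f ^^ k) (f a))) = (\<Prod>k<m. g ((f ^^ Suc k) a)) * g ((f ^^ n) a)"
    unfolding sh Suc by simp
  also have "\<dots> = g ((f ^^ 0) a) * (\<Prod>k<m. g ((f ^^ Suc k) a))"
    using assms by (simp add: mult.commute)
  also have "\<dots> = (\<Prod>k<n. g ((f ^^ k) a))"
    unfolding Suc by (rule prod.lessThan_Suc_shift[symmetric])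
  finally show ?thesis .
qed simp

lemma funpow_mult_fixed: "(f ^^ n) a = a \<Longrightarrow> (f ^^ (n * m)) a = a"
  by (induction m) (simp_all add: funpow_add)

lemma prod_orbit_mult:
  assumes "(f ^^ n) a = a"
  shows "(\<Prod>k<n * m. g ((f ^^ k) a)) = (\<Prod>k<n. g ((f ^^ k) a) :: 'b::comm_monoid_mult) ^ m"
proof (induction m)
  case (Suc m)
  have add: "(\<Prod>k<i + j. h k) = (\<Prod>k<i. h k) * (\<Prod>k<j. h (i + k))" for i j :: nat and h :: "nat \<Rightarrow> 'b"
    by (induction j) (auto simp: mult.assoc)
  have sh: "(f ^^ (n * m + k)) a = (f ^^ k) a" for k
    using funpow_mult_fixed[OF assms, of m] by (simp add: add.commute[of "n * m"] funpow_add)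
  have "(\<Prod>k<n * Suc m. g ((f ^^ k) a)) = (\<Prod>k<n * m. g ((f ^^ k) a)) * (\<Prod>k<n. g ((f ^^ k) a))"
    unfolding mult_Suc_right add.commute[of n] add sh ..
  then show ?case using Suc by (simp add: mult.commute)
qed simp

text \<open>Moving the base point permutes the factors cyclically. Hence the multiplier at the given
  point of an orbit agrees with the one at the point that witnesses its stability or
  instability.\<close>

lemma least_period_orbit:
  assumes x: "least_period f n x" and A: "A = (\<lambda>k. (f ^^ k) x) ` {..<n}" and a: "a \<in> A"
  shows "f a \<in> A" "(f ^^ n) a = a"
    and "(\<Prod>k<n. g ((f ^^ k) a)) = (\<Prod>k<n. g ((f ^^ k) x) :: 'b::comm_monoid_mult)"
proof -
  have n: "0 < n" "(f ^^ n) x = x" using x by (auto simp: least_period_def)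
  obtain j where j: "j < n" "a = (f ^^ j) x" using a A by auto
  show "f a \<in> A"
  proof (cases "Suc j = n")
    case True
    then have "f a = (f ^^ 0) x" using n j by auto
    then show ?thesis unfolding A using n by blast
  next
    case False
    then show ?thesis unfolding A j using j by (intro image_eqI[of _ _ "Suc j"]) auto
  qed
  have per: "(f ^^ n) ((f ^^ i) x) = (f ^^ i) x" for i
    using n(2) by (metis add.commute comp_apply funpow_add)
  then show "(f ^^ n) a = a" using j by simp
  have "(\<Prod>k<n. g ((f ^^ k) ((f ^^ i) x))) = (\<Prod>k<n. g ((f ^^ k) x))" for i
  proof (induction i)
    case (Suc i)
    then show ?case using prod_orbit_shift[OF per[of i], of g] by simp
  qed simp
  then show "(\<Prod>k<n. g ((f ^^ k) a)) = (\<Prod>k<n. g ((f ^^ k) x))" using j by simp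
qed

text \<open>The weight sums the normalized growth \<open>d (a) \<dots> d (f\<^sup>n\<^sup>-\<^sup>1 a) / \<theta>\<^sup>n\<close> over one period, so that
  a step of \<open>f\<close> only shifts the sum.\<close>

lemma adapted_weight:
  fixes d :: "'a \<Rightarrow> real"
  assumes Z: "finite Z" and d: "\<And>a. 0 \<le> d a" and N: "0 < N"
    and per: "\<And>a. a \<in> Z \<Longrightarrow> (f ^^ N) a = a" and less: "\<And>a. a \<in> Z \<Longrightarrow> (\<Prod>k<N. d ((f ^^ k) a)) < 1"
  obtains \<theta> W where "0 < \<theta>" "\<theta> < 1" "\<And>a. 0 < W a" "\<And>a. a \<in> Z \<Longrightarrow> d a * W (f a) \<le> \<theta> * W a"
proof -
  \<comment> \<open>Finitely many products lie below 1, so a single \<theta> < 1 can be fitted above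
    all of them after taking N-th powers.\<close>
  have "\<forall>\<^sub>F \<theta> in at_left 1. (\<Prod>k<N. d ((f ^^ k) a)) < \<theta> ^ N" if "a \<in> Z" for a
  proof (rule order_tendstoD(1)[OF _ less[OF that]])
    show "((\<lambda>\<theta>. \<theta> ^ N) \<longlongrightarrow> 1) (at_left (1::real))" by (auto intro!: tendsto_eq_intros)
  qed
  then have "\<forall>\<^sub>F \<theta> in at_left 1. \<forall>a\<in>Z. (\<Prod>k<N. d ((f ^^ k) a)) < \<theta> ^ N"
    using Z by (simp add: eventually_ball_finite)
  moreover have "\<forall>\<^sub>F \<theta> in at_left (1::real). \<theta> \<in> {0<..<1}" by (intro eventually_at_left_real) simp
  ultimately have "\<forall>\<^sub>F \<theta> in at_left (1::real). (\<forall>a\<in>Z. (\<Prod>k<N. d ((f ^^ k) a)) < \<theta> ^ N) \<and> \<theta> \<in> {0<..<1}"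
    by (rule eventually_conj)
  then obtain \<theta> where \<theta>: "\<And>a. a \<in> Z \<Longrightarrow> (\<Prod>k<N. d ((f ^^ k) a)) < \<theta> ^ N" "0 < \<theta>" "\<theta> < 1"
    using eventually_happens'[OF trivial_limit_at_left_real] by fastforce
  define G where "G n a = (\<Prod>i<n. d ((f ^^ i) a)) / \<theta> ^ n" for n a
  define W where "W a = (\<Sum>n<N. G n a)" for a
  have G0: "0 \<le> G n a" for n a unfolding G_def using d \<theta> by (intro divide_nonneg_pos prod_nonneg) auto
  have G_Suc: "d a * G n (f a) = \<theta> * G (Suc n) a" for n a
  proof -
    have sh: "(f ^^ k) (f a) = (f ^^ Suc k) a" for k by (simp add: funpow_swap1)
    have "(\<Prod>i<Suc n. d ((f ^^ i) a)) = d a * (\<Prod>i<n. d ((f ^^ i) (f a)))"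
      unfolding sh prod.lessThan_Suc_shift by simp
    then show ?thesis using \<theta>(2) by (simp add: G_def)
  qed
  show ?thesis
  proof (rule that[OF \<theta>(2,3)])
    show "0 < W a" for a
    proof -
      have "G 0 a \<le> W a" unfolding W_def using N G0 by (intro member_le_sum) auto
      then show ?thesis by (simp add: G_def)
    qed
    fix a assume a: "a \<in> Z"
    have "d a * W (f a) = \<theta> * (\<Sum>n<N. G (Suc n) a)"
      unfolding W_def by (simp add: sum_distrib_left G_Suc)
    \<comment> \<open>Shifting the sum trades G 0 a = 1 for G N a, which is at most 1 by the choice
      of \<theta>.\<close>
    also have "(\<Sum>n<N. G (Suc n) a) = W a + G N a - G 0 a"
      using sum.lessThan_Suc[of "\<lambda>n. G n a" N] sum.lessThan_Suc_shift[of "\<lambda>n. G n a" N]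
      unfolding W_def by linarith
    also have "\<theta> * \<dots> \<le> \<theta> * W a"
      using \<theta> a by (intro mult_left_mono) (auto simp: G_def field_simps less_imp_le)
    finally show "d a * W (f a) \<le> \<theta> * W a" .
  qed
qed

section \<open>Perturbed transition operators\<close>

context compact_noise
begin

text \<open>e moves the centre of the next step and s is its noise amplitude; for e = 0 and s =
  \<epsilon> \<sigma> only the noise law differs from the original chain.\<close>

definition perturbed_fun ::
  "(circle \<Rightarrow> circle) \<Rightarrow> (circle \<Rightarrow> real) \<Rightarrow> (circle \<Rightarrow> real) \<Rightarrow> (circle \<Rightarrow> real) \<Rightarrow> circle \<Rightarrow> real"
  where "perturbed_fun f e s \<phi> x = (\<integral>w. \<rho> w *\<^sub>R \<phi> (f x + to_circle (e x + s x * w)) \<partial>lborel)"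

definition perturbed_op ::
  "(circle \<Rightarrow> circle) \<Rightarrow> (circle \<Rightarrow> real) \<Rightarrow> (circle \<Rightarrow> real) \<Rightarrow> bborel \<Rightarrow>\<^sub>L bborel"
  where "perturbed_op f e s = Blinfun (\<lambda>\<phi>. Bborel (perturbed_fun f e s (apply_bborel \<phi>)))"

lemma perturbed_op_apply:
  assumes [measurable]: "f \<in> borel_measurable borel" "e \<in> borel_measurable borel" "s \<in> borel_measurable borel"
  shows "apply_bborel (blinfun_apply (perturbed_op f e s) \<phi>) = perturbed_fun f e s (apply_bborel \<phi>)"
proof -
  have int: "integrable lborel (\<lambda>w. \<rho> w *\<^sub>R apply_bborel \<phi> (f x + to_circle (e x + s x * w)))" for \<phi> x
    by (rule integrable_noise_mult[where B = "norm \<phi>"]) (auto simp: abs_apply_bborel_le)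
  have le: "\<bar>perturbed_fun f e s (apply_bborel \<phi>) x\<bar> \<le> norm \<phi>" for \<phi> x
    unfolding perturbed_fun_def real_norm_def[symmetric]
    by (rule norm_noise_integral_le) (auto simp: abs_apply_bborel_le)
  have meas: "perturbed_fun f e s (apply_bborel \<phi>) \<in> borel_measurable borel" for \<phi>
    unfolding perturbed_fun_def by measurable
  have B: "apply_bborel (Bborel (perturbed_fun f e s (apply_bborel \<phi>))) =
      perturbed_fun f e s (apply_bborel \<phi>)" for \<phi>
    using le[of \<phi>] meas[of \<phi>] by (intro Bborel_inverse) (auto simp: bounded_iff)
  have "bounded_linear (\<lambda>\<phi>. Bborel (perturbed_fun f e s (apply_bborel \<phi>)))"
  proof (rule bounded_linear_intro[where K = 1])
    fix \<phi> \<psi> :: bborel and c :: real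
    show "Bborel (perturbed_fun f e s (apply_bborel (\<phi> + \<psi>))) =
        Bborel (perturbed_fun f e s (apply_bborel \<phi>)) + Bborel (perturbed_fun f e s (apply_bborel \<psi>))"
    proof (rule bborel_eqI)
      fix x
      have "perturbed_fun f e s (apply_bborel (\<phi> + \<psi>)) x =
          perturbed_fun f e s (apply_bborel \<phi>) x + perturbed_fun f e s (apply_bborel \<psi>) x"
        unfolding perturbed_fun_def plus_bborel.rep_eq scaleR_add_right
        by (rule Bochner_Integration.integral_add[OF int int])
      then show "apply_bborel (Bborel (perturbed_fun f e s (apply_bborel (\<phi> + \<psi>)))) x = apply_bborel
          (Bborel (perturbed_fun f e s (apply_bborel \<phi>)) + Bborel (perturbed_fun f e s (apply_bborel \<psi>))) x"
        by (subst B, subst plus_bborel.rep_eq, subst B, subst B)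
    qed
    show "Bborel (perturbed_fun f e s (apply_bborel (c *\<^sub>R \<phi>))) =
        c *\<^sub>R Bborel (perturbed_fun f e s (apply_bborel \<phi>))"
    proof (rule bborel_eqI)
      fix x
      have "perturbed_fun f e s (apply_bborel (c *\<^sub>R \<phi>)) x = c * perturbed_fun f e s (apply_bborel \<phi>) x"
        unfolding perturbed_fun_def scaleR_bborel.rep_eq by (simp add: mult.left_commute[of _ c])
      then show "apply_bborel (Bborel (perturbed_fun f e s (apply_bborel (c *\<^sub>R \<phi>)))) x =
          apply_bborel (c *\<^sub>R Bborel (perturbed_fun f e s (apply_bborel \<phi>))) x"
        by (subst B, subst scaleR_bborel.rep_eq, subst B)
    qed
    show "norm (Bborel (perturbed_fun f e s (apply_bborel \<phi>))) \<le> norm \<phi> * 1"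
      by (rule norm_bborel_le) (simp add: B le)
  qed
  then show ?thesis
    unfolding perturbed_op_def by (simp add: bounded_linear_Blinfun_apply B)
qed

text \<open>Both operators are integrals over \<open>v\<close> of the same bounded function
  \<open>\<phi> (f x + to_circle (\<epsilon> \<sigma>(x) v))\<close>, against the normal density and against an affine image
  of \<open>\<rho>\<close>.\<close>

lemma norm_transition_perturbed:
  assumes [measurable]: "f \<in> borel_measurable borel" "e \<in> borel_measurable borel" "s \<in> borel_measurable borel"
      "\<sigma> \<in> borel_measurable borel"
    and \<epsilon>: "0 < \<epsilon>" and \<sigma>: "\<And>x. 0 < \<sigma> x" and s: "\<And>x. 0 < s x"
    and n: "(\<integral>w. \<bar>std_normal_density w - \<rho> w\<bar> \<partial>lborel) \<le> r1"
    and close: "\<And>x. (\<integral>v. \<bar>\<rho> ((v - e x / (\<epsilon> * \<sigma> x)) / (s x / (\<epsilon> * \<sigma> x))) / (s x / (\<epsilon> * \<sigma> x)) - \<rho> v\<bar> \<partial>lborel) \<le> r2"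
  shows "norm (transition_op f \<sigma> \<epsilon> - perturbed_op f e s) \<le> r1 + r2"
proof (rule norm_blinfun_bound)
  have "0 \<le> (\<integral>w. \<bar>std_normal_density w - \<rho> w\<bar> \<partial>lborel)"
    "0 \<le> (\<integral>v. \<bar>\<rho> ((v - e 0 / (\<epsilon> * \<sigma> 0)) / (s 0 / (\<epsilon> * \<sigma> 0))) / (s 0 / (\<epsilon> * \<sigma> 0)) - \<rho> v\<bar> \<partial>lborel)"
    by (auto intro!: integral_nonneg)
  then show "0 \<le> r1 + r2" using n close[of 0] by linarith
  fix \<phi>
  show "norm (blinfun_apply (transition_op f \<sigma> \<epsilon> - perturbed_op f e s) \<phi>) \<le> (r1 + r2) * norm \<phi>"
  proof (rule norm_bborel_le)
    fix x
    \<comment> \<open>Centre and scale of the perturbed noise, measured in the amplitude \<epsilon>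
      \<sigma>(x) of the original noise.\<close>
    define \<alpha> \<beta> where "\<alpha> = e x / (\<epsilon> * \<sigma> x)" and "\<beta> = s x / (\<epsilon> * \<sigma> x)"
    have \<beta>: "0 < \<beta>" using \<epsilon> \<sigma> s by (simp add: \<beta>_def)
    define g where "g v = apply_bborel \<phi> (f x + to_circle (\<epsilon> * \<sigma> x * v))" for v
    have [measurable]: "g \<in> borel_measurable borel" unfolding g_def by measurable
    have g: "\<bar>g v\<bar> \<le> norm \<phi>" for v unfolding g_def by (rule abs_apply_bborel_le)
    define \<rho>a where "\<rho>a v = \<rho> ((v - \<alpha>) / \<beta>) / \<beta>" for v
    have [measurable]: "\<rho>a \<in> borel_measurable borel" unfolding \<rho>a_def by measurable
    have "integrable lborel (\<lambda>v. \<rho> ((- \<alpha> / \<beta>) + (1 / \<beta>) * v))"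
      using \<beta> by (intro lborel_integrable_real_affine integrable_noise) simp
    then have \<rho>a: "integrable lborel \<rho>a"
      unfolding \<rho>a_def using \<beta> by (simp add: diff_divide_distrib add.commute)
    let ?n = std_normal_density
    have nd: "integrable lborel ?n" using integrable_normal_density[of 1 0] by auto
    have bound: "integrable lborel (\<lambda>v. h v * g v)" if [measurable]: "integrable lborel h" for h :: "real \<Rightarrow> real"
    proof (rule Bochner_Integration.integrable_bound[where f = "\<lambda>v. norm \<phi> * h v"])
      show "AE v in lborel. norm (h v * g v) \<le> norm (norm \<phi> * h v)"
        using g by (auto simp: abs_mult mult.commute[of "norm \<phi>"] intro!: mult_left_mono)
    qed (use that in auto)
    have T: "apply_bborel (blinfun_apply (transition_op f \<sigma> \<epsilon>) \<phi>) x = (\<integral>v. ?n v * g v \<partial>lborel)"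
      unfolding transition_op_apply[OF assms(1,4)] transition_fun_def g_def
      by (subst integral_density) auto
    have "\<epsilon> * \<sigma> x * (\<alpha> + \<beta> * w) = e x + s x * w" for w
      using \<epsilon> \<sigma>[of x] by (simp add: \<alpha>_def \<beta>_def field_simps)
    then have "apply_bborel (blinfun_apply (perturbed_op f e s) \<phi>) x = (\<integral>w. \<rho> w *\<^sub>R g (\<alpha> + \<beta> * w) \<partial>lborel)"
      unfolding perturbed_op_apply[OF assms(1,2,3)] perturbed_fun_def g_def by simp
    also have "\<dots> = (\<integral>v. \<rho>a v * g v \<partial>lborel)"
      unfolding noise_integral_affine[OF \<beta>] \<rho>a_def by simp
    finally have "apply_bborel (blinfun_apply (transition_op f \<sigma> \<epsilon> - perturbed_op f e s) \<phi>) x =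
        (\<integral>v. ?n v * g v \<partial>lborel) - (\<integral>v. \<rho>a v * g v \<partial>lborel)"
      by (simp add: blinfun.diff_left minus_bborel.rep_eq T)
    also have "\<dots> = (\<integral>v. ?n v * g v - \<rho>a v * g v \<partial>lborel)"
      by (intro Bochner_Integration.integral_diff[symmetric] bound nd \<rho>a)
    also have "\<bar>\<dots>\<bar> \<le> (\<integral>v. (\<bar>?n v - \<rho> v\<bar> + \<bar>\<rho>a v - \<rho> v\<bar>) * norm \<phi> \<partial>lborel)"
      unfolding real_norm_def[symmetric]
    proof (rule Bochner_Integration.integral_norm_bound_integral)
      show "norm (?n v * g v - \<rho>a v * g v) \<le> (norm (?n v - \<rho> v) + norm (\<rho>a v - \<rho> v)) * norm \<phi>" for v
      proof -
        have "norm (?n v * g v - \<rho>a v * g v) = \<bar>?n v - \<rho>a v\<bar> * \<bar>g v\<bar>"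
          by (simp add: abs_mult[symmetric] left_diff_distrib)
        also have "\<dots> \<le> (\<bar>?n v - \<rho> v\<bar> + \<bar>\<rho>a v - \<rho> v\<bar>) * norm \<phi>"
          using g[of v] by (intro mult_mono) auto
        finally show ?thesis by simp
      qed
    qed (auto intro!: Bochner_Integration.integrable_diff bound nd \<rho>a integrable_mult_left
        Bochner_Integration.integrable_add integrable_abs integrable_noise simp del: real_norm_def simp: real_norm_def)
    also have "\<dots> = ((\<integral>v. \<bar>?n v - \<rho> v\<bar> \<partial>lborel) + (\<integral>v. \<bar>\<rho>a v - \<rho> v\<bar> \<partial>lborel)) * norm \<phi>"
      by (subst integral_mult_left_zero, subst Bochner_Integration.integral_add)
        (auto intro!: integrable_abs Bochner_Integration.integrable_diff nd \<rho>a integrable_noise)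
    also have "\<dots> \<le> (r1 + r2) * norm \<phi>"
      using n close[of x] unfolding \<rho>a_def \<alpha>_def \<beta>_def by (intro mult_right_mono add_mono) auto
    finally show "\<bar>apply_bborel (blinfun_apply (transition_op f \<sigma> \<epsilon> - perturbed_op f e s) \<phi>) x\<bar>
        \<le> (r1 + r2) * norm \<phi>" .
  qed
qed

end

section \<open>Spectrum near the periodic orbits\<close>

locale hyperbolic_circle_map =
  fixes f :: "circle \<Rightarrow> circle"
    and \<sigma> :: "circle \<Rightarrow> real"
    and \<sigma>lb \<sigma>ub :: real
    and ms mu :: nat
    and P Q :: "nat \<Rightarrow> circle set"
    and p q :: "nat \<Rightarrow> nat"
    and x y :: "nat \<Rightarrow> circle"
    and cs cu :: "nat \<Rightarrow> real"
  assumes f_smooth: "smooth_circle_map f"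
    and \<sigma>_smooth: "smooth_circle_fun \<sigma>"
    and \<sigma>_bounds: "0 < \<sigma>lb" "\<And>z. \<sigma>lb < \<sigma> z \<and> \<sigma> z < \<sigma>ub"
    and stable: "\<And>i. i \<in> {1..ms} \<Longrightarrow> stable_orbit f (p i) (P i)"
    and unstable: "\<And>i. i \<in> {1..mu} \<Longrightarrow> unstable_orbit f (q i) (Q i)"
    and cs: "\<And>i. i \<in> {1..ms} \<Longrightarrow> x i \<in> P i \<and> cs i = circle_deriv (f ^^ p i) (x i)"
    and cu: "\<And>i. i \<in> {1..mu} \<Longrightarrow> y i \<in> Q i \<and> cu i = circle_deriv (f ^^ q i) (y i)"
    and attract: "\<And>z. z \<notin> (\<Union>i\<in>{1..mu}. Q i) \<Longrightarrow> orbit_converges_to f z (\<Union>i\<in>{1..ms}. P i)"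
begin

abbreviation D :: "circle \<Rightarrow> real" where "D \<equiv> circle_deriv f"
definition S :: "circle set" where "S = (\<Union>i\<in>{1..ms}. P i)"
definition U :: "circle set" where "U = (\<Union>i\<in>{1..mu}. Q i)"

lemma \<sigma>_pos: "0 < \<sigma> z" using \<sigma>_bounds(2)[of z] \<sigma>_bounds(1) by linarith

lemma \<sigma>ub_pos: "0 < \<sigma>ub" using \<sigma>_pos[of 0] \<sigma>_bounds(2)[of 0] by linarith

lemma stable_facts:
  assumes i: "i \<in> {1..ms}"
  shows "0 < p i" "finite (P i)" "\<bar>cs i\<bar> < 1"
    and "\<And>a. a \<in> P i \<Longrightarrow> f a \<in> P i \<and> (f ^^ p i) a = a \<and> (\<Prod>k<p i. D ((f ^^ k) a)) = cs i"
proof -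
  obtain x0 where x0: "least_period f (p i) x0" "P i = (\<lambda>k. (f ^^ k) x0) ` {..<p i}"
    "\<bar>circle_deriv (f ^^ p i) x0\<bar> < 1"
    using stable[OF i] unfolding stable_orbit_def by blast
  note lp = least_period_orbit[OF x0(1,2)]
  have c: "cs i = (\<Prod>k<p i. D ((f ^^ k) x0))"
    using cs[OF i] lp(3)[of "x i" D] circle_deriv_funpow[OF f_smooth] by simp
  show "0 < p i" using x0(1) by (simp add: least_period_def)
  show "finite (P i)" unfolding x0(2) by simp
  show "\<bar>cs i\<bar> < 1" using x0(3) c circle_deriv_funpow[OF f_smooth] by simp
  show "f a \<in> P i \<and> (f ^^ p i) a = a \<and> (\<Prod>k<p i. D ((f ^^ k) a)) = cs i" if "a \<in> P i" for a
    using lp[OF that] c by auto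
qed

lemma unstable_facts:
  assumes i: "i \<in> {1..mu}"
  shows "0 < q i" "finite (Q i)" "1 < \<bar>cu i\<bar>"
    and "\<And>a. a \<in> Q i \<Longrightarrow> f a \<in> Q i \<and> (f ^^ q i) a = a \<and> (\<Prod>k<q i. D ((f ^^ k) a)) = cu i"
proof -
  obtain x0 where x0: "least_period f (q i) x0" "Q i = (\<lambda>k. (f ^^ k) x0) ` {..<q i}"
    "1 < \<bar>circle_deriv (f ^^ q i) x0\<bar>"
    using unstable[OF i] unfolding unstable_orbit_def by blast
  note lp = least_period_orbit[OF x0(1,2)]
  have c: "cu i = (\<Prod>k<q i. D ((f ^^ k) x0))"
    using cu[OF i] lp(3)[of "y i" D] circle_deriv_funpow[OF f_smooth] by simp
  show "0 < q i" using x0(1) by (simp add: least_period_def)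
  show "finite (Q i)" unfolding x0(2) by simp
  show "1 < \<bar>cu i\<bar>" using x0(3) c circle_deriv_funpow[OF f_smooth] by simp
  show "f a \<in> Q i \<and> (f ^^ q i) a = a \<and> (\<Prod>k<q i. D ((f ^^ k) a)) = cu i" if "a \<in> Q i" for a
    using lp[OF that] c by auto
qed

lemma finite_S: "finite S" and finite_U: "finite U"
  using stable_facts(2) unstable_facts(2) by (auto simp: S_def U_def)

lemma inv_S: "a \<in> S \<Longrightarrow> f a \<in> S" and inv_U: "a \<in> U \<Longrightarrow> f a \<in> U"
  unfolding S_def U_def using stable_facts(4) unstable_facts(4) by blast+

text \<open>\<open>adapted_weight\<close> works with one period for all points of S \<union> U at
  once.\<close>

definition common_period :: nat where
  "common_period = (\<Prod>i\<in>{1..ms}. p i) * (\<Prod>i\<in>{1..mu}. q i)"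

lemma common_period_pos: "0 < common_period"
  unfolding common_period_def using stable_facts(1) unstable_facts(1) by (auto intro!: prod_pos)

lemma S_multiplier:
  assumes a: "a \<in> S"
  shows "(f ^^ common_period) a = a" "\<bar>\<Prod>k<common_period. D ((f ^^ k) a)\<bar> < 1"
proof -
  obtain i where i: "i \<in> {1..ms}" "a \<in> P i" using a by (auto simp: S_def)
  have "p i dvd common_period"
    unfolding common_period_def using i by (intro dvd_mult2 dvd_prodI) auto
  then obtain m where m: "common_period = p i * m" by blast
  have "0 < m" using common_period_pos m by (cases m) auto
  note s = stable_facts[OF i(1)]
  have per: "(f ^^ p i) a = a" using s(4) i by blast
  show "(f ^^ common_period) a = a" unfolding m by (rule funpow_mult_fixed[OF per])
  have "\<bar>\<Prod>k<common_period. D ((f ^^ k) a)\<bar> = \<bar>cs i\<bar> ^ m"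
    unfolding m prod_orbit_mult[OF per] using s(4)[OF i(2)] by (simp add: power_abs)
  also have "\<dots> < 1 ^ m" using s(3) \<open>0 < m\<close> by (intro power_strict_mono) auto
  finally show "\<bar>\<Prod>k<common_period. D ((f ^^ k) a)\<bar> < 1" by simp
qed

lemma U_multiplier:
  assumes a: "a \<in> U"
  shows "(f ^^ common_period) a = a" "1 < \<bar>\<Prod>k<common_period. D ((f ^^ k) a)\<bar>"
proof -
  obtain i where i: "i \<in> {1..mu}" "a \<in> Q i" using a by (auto simp: U_def)
  have "q i dvd common_period"
    unfolding common_period_def using i by (intro dvd_mult dvd_prodI) auto
  then obtain m where m: "common_period = q i * m" by blast
  have "0 < m" using common_period_pos m by (cases m) auto
  note s = unstable_facts[OF i(1)]
  have per: "(f ^^ q i) a = a" using s(4) i by blast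
  show "(f ^^ common_period) a = a" unfolding m by (rule funpow_mult_fixed[OF per])
  have "1 ^ m < \<bar>cu i\<bar> ^ m" using s(3) \<open>0 < m\<close> by (intro power_strict_mono) auto
  also have "\<dots> = \<bar>\<Prod>k<common_period. D ((f ^^ k) a)\<bar>"
    unfolding m prod_orbit_mult[OF per] using s(4)[OF i(2)] by (simp add: power_abs)
  finally show "1 < \<bar>\<Prod>k<common_period. D ((f ^^ k) a)\<bar>" by simp
qed

lemma disjoint: "S \<inter> U = {}"
  using S_multiplier(2) U_multiplier(2) by fastforce

lemma D_nz: assumes "a \<in> U" shows "D a \<noteq> 0"
proof
  assume "D a = 0"
  then have z: "(\<Prod>k<common_period. D ((f ^^ k) a)) = 0"
    using common_period_pos by (auto intro!: bexI[of _ 0])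
  show False using U_multiplier(2)[OF assms] unfolding z by simp
qed

text \<open>\<open>adapted_weight\<close> is applied to |D a| on S and to 1 / |D a| on U, so that
  both products over a period are below 1. W times the distance then contracts near S, and the
  distance divided by W expands near U; hence \<kappa> is 1 / W on S and W on U. Relaxing \<theta>
  to the midpoint \<theta>1 leaves room for the nonlinearity of f.\<close>

lemma hyperbolic_attraction_exists:
  obtains \<kappa> \<theta> \<delta> where "hyperbolic_attraction f S U \<kappa> \<theta> \<delta>"
    and "\<And>a. a \<in> S \<Longrightarrow> \<bar>D a\<bar> * \<kappa> a \<le> \<theta> * \<kappa> (f a)"
    and "\<And>a. a \<in> U \<Longrightarrow> \<kappa> (f a) \<le> \<theta> * (\<bar>D a\<bar> * \<kappa> a)"
proof -
  let ?Z = "S \<union> U"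
  define d where "d a = (if a \<in> S then \<bar>D a\<bar> else 1 / \<bar>D a\<bar>)" for a
  have funpow_S: "(f ^^ k) a \<in> S" if "a \<in> S" for k a
    by (induction k) (auto simp: that inv_S)
  have funpow_U: "(f ^^ k) a \<in> U" if "a \<in> U" for k a
    by (induction k) (auto simp: that inv_U)
  have less: "(\<Prod>k<common_period. d ((f ^^ k) a)) < 1" if "a \<in> ?Z" for a
  proof (cases "a \<in> S")
    case True
    then show ?thesis using S_multiplier(2)[OF True] by (simp add: d_def funpow_S abs_prod)
  next
    case False
    then have "a \<in> U" using that by blast
    have "(\<Prod>k<common_period. d ((f ^^ k) a)) = (\<Prod>k<common_period. 1 / \<bar>D ((f ^^ k) a)\<bar>)"
      using funpow_U[OF \<open>a \<in> U\<close>] disjoint by (intro prod.cong refl) (auto simp: d_def)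
    also have "\<dots> = 1 / \<bar>\<Prod>k<common_period. D ((f ^^ k) a)\<bar>" by (simp add: prod_dividef abs_prod)
    also have "1 / X < 1" if "1 < X" for X :: real using that by simp
    note this[OF U_multiplier(2)[OF \<open>a \<in> U\<close>]]
    finally show ?thesis .
  qed
  have per: "(f ^^ common_period) a = a" if "a \<in> ?Z" for a
    using that S_multiplier(1) U_multiplier(1) by blast
  have d0: "0 \<le> d a" for a by (simp add: d_def)
  obtain \<theta> W where \<theta>: "0 < \<theta>" "\<theta> < 1" and W: "\<And>a. 0 < W a" "\<And>a. a \<in> ?Z \<Longrightarrow> d a * W (f a) \<le> \<theta> * W a"
    using adapted_weight[OF finite_UnI[OF finite_S finite_U] d0 common_period_pos per less] by blast
  define \<kappa> where "\<kappa> a = (if a \<in> S then 1 / W a else W a)" for a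
  have \<kappa>: "0 < \<kappa> a" for a using W(1) by (simp add: \<kappa>_def)
  have linS: "\<bar>D a\<bar> * \<kappa> a \<le> \<theta> * \<kappa> (f a)" if "a \<in> S" for a
    using W(2)[of a] W(1)[of a] W(1)[of "f a"] that inv_S[OF that] by (simp add: \<kappa>_def d_def field_simps)
  have linU: "\<kappa> (f a) \<le> \<theta> * (\<bar>D a\<bar> * \<kappa> a)" if "a \<in> U" for a
    using W(2)[of a] W(1)[of a] W(1)[of "f a"] that inv_U[OF that] disjoint D_nz[OF that]
    by (auto simp: \<kappa>_def d_def field_simps)
  define \<theta>1 where "\<theta>1 = (1 + \<theta>) / 2"
  have \<theta>1: "\<theta> < \<theta>1" "\<theta>1 < 1" "0 < \<theta>1" using \<theta> by (auto simp: \<theta>1_def)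
  \<comment> \<open>The linearization errors that the passage from \<theta> to \<theta>1 can absorb:
    the first bound serves the contraction estimate, the second the expansion estimate.\<close>
  define \<nu> where "\<nu> a = min ((\<theta>1 - \<theta>) * \<kappa> (f a) / \<kappa> a) ((1 - \<theta> / \<theta>1) * \<kappa> (f a) / (\<theta> * \<kappa> a))" for a
  have \<nu>: "0 < \<nu> a" for a using \<kappa> \<theta> \<theta>1 by (simp add: \<nu>_def)
  have \<nu>S: "\<nu> a * \<kappa> a \<le> (\<theta>1 - \<theta>) * \<kappa> (f a)" for a
    using \<kappa>[of a] unfolding \<nu>_def by (simp add: pos_le_divide_eq[symmetric])
  have \<nu>U: "\<theta> * \<kappa> a * \<nu> a \<le> (1 - \<theta> / \<theta>1) * \<kappa> (f a)" for a
    using mult_pos_pos[OF \<theta>(1) \<kappa>[of a]] unfolding \<nu>_def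
    by (simp add: pos_le_divide_eq[symmetric] mult.commute[of "\<theta> * \<kappa> a"])
  have "\<exists>dd>0. \<forall>t. \<bar>t\<bar> \<le> dd \<longrightarrow>
      dist (f (a + to_circle t)) (f a + to_circle (D a * t)) \<le> \<nu> a * \<bar>t\<bar>" for a
    using circle_deriv_linearization[OF f_smooth \<nu>[of a], of a] by metis
  then obtain dd where dd: "\<And>a. 0 < dd a" "\<And>a t. \<bar>t\<bar> \<le> dd a \<Longrightarrow>
      dist (f (a + to_circle t)) (f a + to_circle (D a * t)) \<le> \<nu> a * \<bar>t\<bar>"
    by metis
  \<comment> \<open>The bound pi / (|D a| + 1) keeps |D a t| \<le> pi, so the linear image lies at
    distance exactly |D a t| from \<open>f a\<close>; the lower estimate near U depends on
    this.\<close>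
  define \<delta> where "\<delta> = Min (insert 1 ((\<lambda>a. min (dd a) (pi / (\<bar>D a\<bar> + 1))) ` ?Z))"
  have fin: "finite (insert 1 ((\<lambda>a. min (dd a) (pi / (\<bar>D a\<bar> + 1))) ` ?Z))"
    using finite_S finite_U by simp
  have "0 < \<delta>" unfolding \<delta>_def using fin dd by (subst Min_gr_iff) (auto simp: add_nonneg_pos)
  have \<delta>: "\<delta> \<le> dd a \<and> \<delta> \<le> pi / (\<bar>D a\<bar> + 1)" if "a \<in> ?Z" for a
  proof -
    have "\<delta> \<le> min (dd a) (pi / (\<bar>D a\<bar> + 1))" unfolding \<delta>_def using fin that by (intro Min_le) auto
    then show ?thesis by simp
  qed
  have lin: "dist (f z) (f a + to_circle (D a * angle (z - a))) \<le> \<nu> a * dist z a"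
    if "a \<in> ?Z" "dist z a \<le> \<delta>" for a z
    using dd(2)[of "angle (z - a)" a] \<delta>[OF that(1)] that(2) by (simp add: abs_angle)
  have "hyperbolic_attraction f S U \<kappa> \<theta>1 \<delta>"
  proof
    fix a z assume a: "a \<in> S" and z: "dist z a \<le> \<delta>"
    let ?t = "angle (z - a)"
    have "dist (f z) (f a) \<le> dist (f z) (f a + to_circle (D a * ?t)) + dist (f a + to_circle (D a * ?t)) (f a)"
      by (rule dist_triangle)
    also have "\<dots> \<le> \<nu> a * dist z a + \<bar>D a\<bar> * dist z a"
      using lin[of a z] a z dist_add_to_circle_le[of "f a" "D a * ?t"] by (simp add: abs_mult abs_angle)
    finally have "\<kappa> a * dist (f z) (f a) \<le> \<kappa> a * ((\<nu> a + \<bar>D a\<bar>) * dist z a)"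
      using less_imp_le[OF \<kappa>[of a]] by (intro mult_left_mono) (auto simp: algebra_simps)
    also have "\<dots> = (\<nu> a * \<kappa> a + \<bar>D a\<bar> * \<kappa> a) * dist z a" by (simp add: algebra_simps)
    also have "\<dots> \<le> (\<theta>1 * \<kappa> (f a)) * dist z a"
      using \<nu>S[of a] linS[OF a] by (intro mult_right_mono) (auto simp: algebra_simps)
    finally show "\<kappa> a * dist (f z) (f a) \<le> \<theta>1 * \<kappa> (f a) * dist z a" .
  next
    fix a z assume a: "a \<in> U" and z: "dist z a \<le> \<delta>"
    let ?t = "angle (z - a)"
    have "\<bar>?t\<bar> \<le> pi / (\<bar>D a\<bar> + 1)" using \<delta>[of a] a z by (simp add: abs_angle)
    then have "(\<bar>D a\<bar> + 1) * \<bar>?t\<bar> \<le> pi" by (simp add: pos_le_divide_eq add_nonneg_pos mult.commute)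
    then have "\<bar>D a * ?t\<bar> \<le> pi" by (simp add: abs_mult algebra_simps)
    then have "\<bar>D a\<bar> * dist z a = dist (f a + to_circle (D a * ?t)) (f a)"
      by (simp add: dist_add_to_circle abs_mult abs_angle)
    also have "\<dots> \<le> dist (f z) (f a) + \<nu> a * dist z a"
      using dist_triangle[of "f a + to_circle (D a * ?t)" "f a" "f z"] lin[of a z] a z
      by (simp add: dist_commute)
    finally have "\<theta> * \<kappa> a * (\<bar>D a\<bar> * dist z a) \<le> \<theta> * \<kappa> a * (dist (f z) (f a) + \<nu> a * dist z a)"
      using \<theta> \<kappa>[of a] by (intro mult_left_mono) auto
    moreover have "\<kappa> (f a) * dist z a \<le> \<theta> * (\<bar>D a\<bar> * \<kappa> a) * dist z a"
      using linU[OF a] by (intro mult_right_mono) auto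
    moreover have "(\<theta> * \<kappa> a * \<nu> a) * dist z a \<le> ((1 - \<theta> / \<theta>1) * \<kappa> (f a)) * dist z a"
      using \<nu>U[of a] by (intro mult_right_mono) auto
    ultimately have "(\<theta> / \<theta>1) * (\<kappa> (f a) * dist z a) \<le> \<theta> * (\<kappa> a * dist (f z) (f a))"
      by (simp add: algebra_simps)
    then have "\<theta> * (\<kappa> (f a) * dist z a) \<le> \<theta> * (\<theta>1 * (\<kappa> a * dist (f z) (f a)))"
      using \<theta>1(3) by (simp add: field_simps)
    then show "\<kappa> (f a) * dist z a \<le> \<theta>1 * \<kappa> a * dist (f z) (f a)" using \<theta>(1) by simp
  next
    show "orbit_converges_to f z S" if "z \<notin> U" for z
      using attract[of z] that by (simp add: S_def U_def)
  qed (use compact_circle smooth_circle_map_continuous[OF f_smooth] finite_S finite_U disjoint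
      inv_S inv_U \<kappa> \<theta>1 \<open>0 < \<delta>\<close> in auto)
  moreover have "\<bar>D a\<bar> * \<kappa> a \<le> \<theta>1 * \<kappa> (f a)" if "a \<in> S" for a
    using linS[OF that] mult_right_mono[of \<theta> \<theta>1 "\<kappa> (f a)"] \<theta>1 \<kappa>[of "f a"] by linarith
  moreover have "\<kappa> (f a) \<le> \<theta>1 * (\<bar>D a\<bar> * \<kappa> a)" if "a \<in> U" for a
    using linU[OF that] mult_right_mono[of \<theta> \<theta>1 "\<bar>D a\<bar> * \<kappa> a"] \<theta>1 \<kappa>[of a] by (smt (verit) mult_nonneg_nonneg abs_ge_zero)
  ultimately show ?thesis by (rule that)
qed

end

text \<open>In coordinates of scale \<open>\<epsilon>\<close>, the perturbed chain is affine on the windows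
  \<open>\<bar>z\<bar> \<le> \<kappa> a * K\<close> around the periodic points \<open>a\<close>; elsewhere it is unchanged except for the noise.\<close>

locale modelled_circle_map = hyperbolic_circle_map + compact_noise +
  fixes \<kappa> :: "circle \<Rightarrow> real" and K \<epsilon> :: real and e s :: "circle \<Rightarrow> real"
  assumes e_meas [measurable]: "e \<in> borel_measurable borel" and s_meas [measurable]: "s \<in> borel_measurable borel"
    and \<epsilon>_pos: "0 < \<epsilon>" and K_pos: "0 < K" and \<kappa>_pos: "\<And>a. 0 < \<kappa> a"
    and windows_S: "\<And>a. a \<in> S \<Longrightarrow> \<bar>D a\<bar> * (\<kappa> a * K) + \<sigma> a * R \<le> \<kappa> (f a) * K"
    and windows_U: "\<And>a. a \<in> U \<Longrightarrow> \<kappa> (f a) * K + \<sigma> a * R \<le> \<bar>D a\<bar> * (\<kappa> a * K)"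
    and affine: "\<And>a z w. a \<in> S \<union> U \<Longrightarrow> \<bar>z\<bar> \<le> \<kappa> a * K \<Longrightarrow>
      f (a + to_circle (\<epsilon> * z)) + to_circle (e (a + to_circle (\<epsilon> * z)) + s (a + to_circle (\<epsilon> * z)) * w) =
      f a + to_circle (\<epsilon> * (D a * z + \<sigma> a * w))"
    and unchanged: "\<And>z. z \<notin> core \<kappa> S (K * \<epsilon>) \<Longrightarrow> z \<notin> core \<kappa> U (K * \<epsilon>) \<Longrightarrow> e z = 0 \<and> s z = \<epsilon> * \<sigma> z"
    and isolated: "\<And>a w. a \<in> U \<Longrightarrow> \<kappa> (f a) * K < \<bar>w\<bar> \<Longrightarrow> \<bar>w\<bar> \<le> \<bar>D a\<bar> * (\<kappa> a * K) + \<sigma> a * R \<Longrightarrow>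
      f a + to_circle (\<epsilon> * w) \<notin> core \<kappa> U (K * \<epsilon>)"
    and reaches: "\<And>z. z \<notin> core \<kappa> U (K * \<epsilon>) \<Longrightarrow>
      robustly_reaches f (\<sigma>ub * R * \<epsilon>) (core \<kappa> S (K * \<epsilon>)) (core \<kappa> U (K * \<epsilon>)) z"
begin

lemma core_coordinate:
  assumes "z \<in> core \<kappa> A (K * \<epsilon>)"
  obtains a t where "a \<in> A" "\<bar>t\<bar> \<le> \<kappa> a * K" "z = a + to_circle (\<epsilon> * t)"
proof -
  obtain a where a: "a \<in> A" "dist z a \<le> \<kappa> a * (K * \<epsilon>)"
    using assms by (auto simp: core_def dist_commute)
  have "\<bar>angle (z - a) / \<epsilon>\<bar> \<le> \<kappa> a * K"
    using a(2) \<epsilon>_pos by (simp add: abs_angle abs_divide pos_divide_le_eq mult.assoc)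
  moreover have "z = a + to_circle (\<epsilon> * (angle (z - a) / \<epsilon>))"
    using \<epsilon>_pos by simp
  ultimately show ?thesis using a(1) that by blast
qed

lemma f_meas [measurable]: "f \<in> borel_measurable borel"
  by (rule smooth_circle_map_measurable[OF f_smooth])

theorem eigenvalue:
  assumes ev: "complex_eigenvalue (perturbed_op f e s) \<mu>" and \<mu>: "\<mu> \<noteq> 0"
  shows "(\<exists>i\<in>{1..ms}. \<exists>j. \<mu> ^ p i = of_real (cs i ^ j)) \<or>
    (\<exists>i\<in>{1..mu}. \<exists>j. \<mu> ^ q i = of_real (inverse \<bar>cu i\<bar> * inverse (cu i ^ j)))"
proof (rule ccontr)
  assume not: "\<not> ?thesis"
  obtain u v where uv: "u \<noteq> 0 \<or> v \<noteq> 0"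
    "blinfun_apply (perturbed_op f e s) u = Re \<mu> *\<^sub>R u - Im \<mu> *\<^sub>R v"
    "blinfun_apply (perturbed_op f e s) v = Im \<mu> *\<^sub>R u + Re \<mu> *\<^sub>R v"
    using ev unfolding complex_eigenvalue_def by blast
  define \<phi> where "\<phi> z = of_real (apply_bborel u z) + \<i> * of_real (apply_bborel v z)" for z
  define B where "B = norm u + norm v"
  have [measurable]: "\<phi> \<in> borel_measurable borel" unfolding \<phi>_def by measurable
  have B: "norm (\<phi> z) \<le> B" for z
    unfolding \<phi>_def B_def using abs_apply_bborel_le[of u z] abs_apply_bborel_le[of v z]
    by (intro norm_triangle_le) (auto simp: norm_mult)
  have eq: "\<mu> * \<phi> z = (\<integral>w. \<rho> w *\<^sub>R \<phi> (f z + to_circle (e z + s z * w)) \<partial>lborel)" for z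
  proof -
    let ?g = "\<lambda>w. f z + to_circle (e z + s z * w)"
    have int: "integrable lborel (\<lambda>w. \<rho> w *\<^sub>R apply_bborel h (?g w))" for h
      by (rule integrable_noise_mult[where B = "norm h"]) (auto simp: abs_apply_bborel_le)
    have ap: "(\<integral>w. \<rho> w *\<^sub>R apply_bborel h (?g w) \<partial>lborel) = apply_bborel (blinfun_apply (perturbed_op f e s) h) z" for h
      unfolding perturbed_op_apply[OF f_meas e_meas s_meas] perturbed_fun_def ..
    have "(\<integral>w. \<rho> w *\<^sub>R \<phi> (?g w) \<partial>lborel) =
        (\<integral>w. of_real (\<rho> w *\<^sub>R apply_bborel u (?g w)) + \<i> * of_real (\<rho> w *\<^sub>R apply_bborel v (?g w)) \<partial>lborel)"
      unfolding \<phi>_def by (intro Bochner_Integration.integral_cong refl) (simp add: scaleR_conv_of_real algebra_simps)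
    also have "\<dots> = of_real (\<integral>w. \<rho> w *\<^sub>R apply_bborel u (?g w) \<partial>lborel) +
        \<i> * of_real (\<integral>w. \<rho> w *\<^sub>R apply_bborel v (?g w) \<partial>lborel)"
      using int by (subst Bochner_Integration.integral_add) (simp_all only: integrable_of_real
          integrable_mult_right integral_mult_right_zero integral_complex_of_real)
    also have "\<dots> = \<mu> * \<phi> z"
      unfolding ap uv(2,3)
      by (simp add: \<phi>_def plus_bborel.rep_eq minus_bborel.rep_eq scaleR_bborel.rep_eq complex_eq_iff algebra_simps)
    finally show ?thesis ..
  qed
  have core_eq: "\<mu> * \<phi> (a + to_circle (\<epsilon> * z)) =
      (\<integral>w. \<rho> w *\<^sub>R \<phi> (f a + to_circle (\<epsilon> * (D a * z + \<sigma> a * w))) \<partial>lborel)"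
    if "a \<in> S \<union> U" "\<bar>z\<bar> \<le> \<kappa> a * K" for a z
    unfolding eq affine[OF that] ..

  have S0: "\<phi> z = 0" if z: "z \<in> core \<kappa> S (K * \<epsilon>)" for z
  proof -
    obtain a t where a: "a \<in> S" "\<bar>t\<bar> \<le> \<kappa> a * K" "z = a + to_circle (\<epsilon> * t)"
      using core_coordinate[OF z] by blast
    obtain i where i: "i \<in> {1..ms}" "a \<in> P i" using a by (auto simp: S_def)
    have sub: "b \<in> S" if "b \<in> P i" for b using that i by (auto simp: S_def)
    note sf = stable_facts[OF i(1)]
    interpret C: contracting_noise_cycle \<rho> \<rho>' R "P i" f D \<sigma> "\<lambda>a. \<kappa> a * K" "p i" "cs i" \<mu>
      "\<lambda>a z. \<phi> (a + to_circle (\<epsilon> * z))" B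
    proof
      fix b w assume b: "b \<in> P i"
      show "f b \<in> P i" "(f ^^ p i) b = b" "(\<Prod>k<p i. D ((f ^^ k) b)) = cs i" using sf(4)[OF b] by auto
      show "0 < \<sigma> b" by (rule \<sigma>_pos)
      show "0 < \<kappa> b * K" using \<kappa>_pos K_pos by simp
      show "(\<lambda>z. \<phi> (b + to_circle (\<epsilon> * z))) \<in> borel_measurable borel" by measurable
      show "norm (\<phi> (b + to_circle (\<epsilon> * w))) \<le> B" by (rule B)
      show "\<bar>D b\<bar> * (\<kappa> b * K) + \<sigma> b * R \<le> \<kappa> (f b) * K" by (rule windows_S[OF sub[OF b]])
    qed (use \<mu> sf(3) core_eq sub in auto)
    show ?thesis
      unfolding a(3) using not i a by (intro C.contracting_eigenvalue) auto
  qed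

  \<comment> \<open>Rule induction on \<open>robustly_reaches\<close>: if \<phi> vanishes wherever
    one step can lead, the right side of the equation is 0, and \<mu> \<noteq> 0 gives \<phi> z = 0.
    Off the cores only the noise law was changed, so a step strays from f z by at most \<sigma>ub R
    \<epsilon>.\<close>
  have out0: "\<phi> z = 0" if z: "z \<notin> core \<kappa> U (K * \<epsilon>)" for z
    using reaches[OF z]
  proof induction
    case (step z)
    have "\<rho> w *\<^sub>R \<phi> (f z + to_circle (e z + s z * w)) = 0" for w
    proof (cases "R \<le> \<bar>w\<bar>")
      case False
      have "dist (f z + to_circle (\<epsilon> * \<sigma> z * w)) (f z) \<le> \<bar>\<epsilon> * \<sigma> z * w\<bar>" by (rule dist_add_to_circle_le)
      also have "\<dots> = \<sigma> z * \<bar>w\<bar> * \<epsilon>" using \<epsilon>_pos \<sigma>_pos[of z] by (simp add: abs_mult)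
      also have "\<dots> \<le> \<sigma>ub * R * \<epsilon>"
        using False \<epsilon>_pos \<sigma>_bounds(2)[of z] \<sigma>ub_pos by (intro mult_right_mono mult_mono) auto
      finally show ?thesis using step.IH unchanged[OF step.hyps(1,2)] by simp
    qed (simp add: support)
    then have "\<mu> * \<phi> z = 0"
      unfolding eq by (simp only: Bochner_Integration.integral_zero)
    then show ?case using \<mu> by simp
  qed (rule S0)

  have U0: "\<phi> z = 0" if z: "z \<in> core \<kappa> U (K * \<epsilon>)" for z
  proof -
    obtain a t where a: "a \<in> U" "\<bar>t\<bar> \<le> \<kappa> a * K" "z = a + to_circle (\<epsilon> * t)"
      using core_coordinate[OF z] by blast
    obtain i where i: "i \<in> {1..mu}" "a \<in> Q i" using a by (auto simp: U_def)
    have sub: "b \<in> U" if "b \<in> Q i" for b using that i by (auto simp: U_def)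
    note sf = unstable_facts[OF i(1)]
    \<comment> \<open>Truncation to the windows provides the hypothesis \<open>outside\<close>; the
      eigenvalue equation survives because \<phi> is already known to vanish off the unstable
      cores.\<close>
    define \<Phi> where "\<Phi> b z = indicator {- (\<kappa> b * K)..\<kappa> b * K} z *\<^sub>R \<phi> (b + to_circle (\<epsilon> * z))" for b z
    interpret C: expanding_noise_cycle \<rho> \<rho>' R "Q i" f D \<sigma> "\<lambda>a. \<kappa> a * K" "q i" "cu i" \<mu> \<Phi> B
    proof
      fix b w assume b: "b \<in> Q i"
      show "f b \<in> Q i" "(f ^^ q i) b = b" "(\<Prod>k<q i. D ((f ^^ k) b)) = cu i" using sf(4)[OF b] by auto
      show "0 < \<sigma> b" by (rule \<sigma>_pos)
      show "0 < \<kappa> b * K" using \<kappa>_pos K_pos by simp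
      show "\<Phi> b \<in> borel_measurable borel" unfolding \<Phi>_def by measurable
      show "norm (\<Phi> b w) \<le> B"
        using B[of "b + to_circle (\<epsilon> * w)"] norm_ge_zero order_trans
        by (auto simp: \<Phi>_def indicator_def intro: order_trans[OF norm_ge_zero])
      show "\<kappa> (f b) * K + \<sigma> b * R \<le> \<bar>D b\<bar> * (\<kappa> b * K)" by (rule windows_U[OF sub[OF b]])
      show "\<Phi> b w = 0" if "\<kappa> b * K < \<bar>w\<bar>" using that by (auto simp: \<Phi>_def indicator_def)
      show "\<mu> * \<Phi> b w = (\<integral>z. \<rho> z *\<^sub>R \<Phi> (f b) (D b * w + \<sigma> b * z) \<partial>lborel)" if w: "\<bar>w\<bar> \<le> \<kappa> b * K"
      proof -
        have "\<mu> * \<Phi> b w = \<mu> * \<phi> (b + to_circle (\<epsilon> * w))" using w by (auto simp: \<Phi>_def abs_le_iff)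
        also have "\<dots> = (\<integral>z. \<rho> z *\<^sub>R \<phi> (f b + to_circle (\<epsilon> * (D b * w + \<sigma> b * z))) \<partial>lborel)"
          using sub[OF b] w by (intro core_eq) auto
        also have "\<dots> = (\<integral>z. \<rho> z *\<^sub>R \<Phi> (f b) (D b * w + \<sigma> b * z) \<partial>lborel)"
        proof (intro Bochner_Integration.integral_cong refl)
          fix z
          let ?y = "D b * w + \<sigma> b * z"
          show "\<rho> z *\<^sub>R \<phi> (f b + to_circle (\<epsilon> * ?y)) = \<rho> z *\<^sub>R \<Phi> (f b) ?y"
          proof (cases "R \<le> \<bar>z\<bar> \<or> \<bar>?y\<bar> \<le> \<kappa> (f b) * K")
            case True
            then show ?thesis by (auto simp: support \<Phi>_def abs_le_iff)
          next
            case False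
            have "\<bar>?y\<bar> \<le> \<bar>D b\<bar> * \<bar>w\<bar> + \<sigma> b * \<bar>z\<bar>"
              using \<sigma>_pos[of b] by (metis abs_mult abs_of_pos abs_triangle_ineq)
            also have "\<dots> \<le> \<bar>D b\<bar> * (\<kappa> b * K) + \<sigma> b * R"
              using w False \<sigma>_pos[of b] by (intro add_mono mult_left_mono) auto
            \<comment> \<open>A point past the window of \<open>f b\<close> might lie in another
              unstable window; \<open>isolated\<close> excludes this, so the truncated values were 0
              anyway.\<close>
            finally have "f b + to_circle (\<epsilon> * ?y) \<notin> core \<kappa> U (K * \<epsilon>)"
              using False by (intro isolated sub b) auto
            then have "\<phi> (f b + to_circle (\<epsilon> * ?y)) = 0" by (rule out0)
            then show ?thesis using False by (auto simp: \<Phi>_def)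
          qed
        qed
        finally show ?thesis .
      qed
    qed (use \<mu> in auto)
    have "\<Phi> a t = 0"
      using not i by (intro C.expanding_eigenvalue) (auto simp: field_simps)
    then show ?thesis using a(2,3) by (auto simp: \<Phi>_def abs_le_iff)
  qed
  have "\<phi> z = 0" for z using U0 out0 by blast
  then have "apply_bborel u z = 0 \<and> apply_bborel v z = 0" for z
    by (simp add: \<phi>_def complex_eq_iff)
  then have "u = 0" "v = 0" by (auto intro!: bborel_eqI simp: zero_bborel.rep_eq)
  then show False using uv(1) by blast
qed

end

text \<open>Of the allowed error r, one half goes to replacing the normal law by \<rho>, and a
  quarter to linearizing f and freezing \<sigma> on the windows. Apart from the reachability
  statement, \<epsilon> has to satisfy only finitely many strict inequalities that hold for all
  small \<epsilon>.\<close>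

lemma (in hyperbolic_circle_map) eventually_modelled:
  assumes "0 < r"
  shows "\<forall>\<^sub>F \<epsilon> in at_right 0. \<exists>X. norm (transition_op f \<sigma> \<epsilon> - X) < r \<and>
    (\<forall>\<mu>. complex_eigenvalue X \<mu> \<and> \<mu> \<noteq> 0 \<longrightarrow>
      (\<exists>i\<in>{1..ms}. \<exists>j. \<mu> ^ p i = of_real (cs i ^ j)) \<or>
      (\<exists>i\<in>{1..mu}. \<exists>j. \<mu> ^ q i = of_real (inverse \<bar>cu i\<bar> * inverse (cu i ^ j))))"
proof -
  obtain \<rho> \<rho>' R where "compact_noise \<rho> \<rho>' R"
    and near: "(\<integral>w. \<bar>std_normal_density w - \<rho> w\<bar> \<partial>lborel) < r / 2"
    using compact_noise_near_normal[of "r / 2"] assms by auto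
  then interpret N: compact_noise \<rho> \<rho>' R by simp
  obtain \<nu> where \<nu>: "0 < \<nu>" "\<nu> < 1" "\<And>\<alpha> \<beta>. \<bar>\<alpha>\<bar> \<le> \<nu> \<Longrightarrow> \<bar>\<beta> - 1\<bar> \<le> \<nu> \<Longrightarrow>
      (\<integral>v. \<bar>\<rho> ((v - \<alpha>) / \<beta>) / \<beta> - \<rho> v\<bar> \<partial>lborel) < r / 4"
    using N.noise_affine_close[of "r / 4"] assms by auto
  obtain \<kappa> \<theta> \<delta> where hyp: "hyperbolic_attraction f S U \<kappa> \<theta> \<delta>"
    and linS: "\<And>a. a \<in> S \<Longrightarrow> \<bar>D a\<bar> * \<kappa> a \<le> \<theta> * \<kappa> (f a)"
    and linU: "\<And>a. a \<in> U \<Longrightarrow> \<kappa> (f a) \<le> \<theta> * (\<bar>D a\<bar> * \<kappa> a)"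
    using hyperbolic_attraction_exists by blast
  interpret H: hyperbolic_attraction f S U \<kappa> \<theta> \<delta> by (rule hyp)
  let ?Z = "S \<union> U"
  have finZ: "finite ?Z" using finite_S finite_U by simp
  obtain k where k: "0 < k" "\<And>a. a \<in> ?Z \<Longrightarrow> k \<le> \<kappa> a" using H.\<kappa>_bounds by metis
  define L where "L = \<sigma>ub * R"
  have L: "0 < L" using \<sigma>ub_pos N.R_pos by (simp add: L_def)
  have \<sigma>R: "\<sigma> a * R \<le> L" for a
    unfolding L_def using \<sigma>_bounds(2)[of a] N.R_pos by (intro mult_right_mono) auto
  define gap where "gap = min (H.\<theta>' - \<theta>) (1 / \<theta> - 1 / H.\<theta>')"
  have gap: "0 < gap" using H.\<theta>'_bounds H.\<theta>_pos by (auto simp: gap_def field_simps)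
  \<comment> \<open>As k bounds all weights from below, the margin gap * \<kappa> a * K of every
    window is at least L, which bounds the noise in units of \<epsilon>.\<close>
  define K where "K = L / (gap * k)"
  have K: "0 < K" using L gap k by (simp add: K_def)
  have LK: "L \<le> gap * \<kappa> a * K" if "a \<in> ?Z" for a
  proof -
    have "L * 1 \<le> L * (\<kappa> a / k)" using L k that by (intro mult_left_mono) auto
    also have "\<dots> = gap * \<kappa> a * K" using gap k by (simp add: K_def)
    finally show ?thesis by simp
  qed
  have LS: "L \<le> (H.\<theta>' - \<theta>) * \<kappa> a * K" and LU: "L \<le> (1 / \<theta> - 1 / H.\<theta>') * \<kappa> a * K" if "a \<in> ?Z" for a
  proof -
    have "gap * (\<kappa> a * K) \<le> (H.\<theta>' - \<theta>) * (\<kappa> a * K)" "gap * (\<kappa> a * K) \<le> (1 / \<theta> - 1 / H.\<theta>') * (\<kappa> a * K)"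
      using H.\<kappa>_pos[of a] K by (intro mult_right_mono; simp add: gap_def)+
    then show "L \<le> (H.\<theta>' - \<theta>) * \<kappa> a * K" "L \<le> (1 / \<theta> - 1 / H.\<theta>') * \<kappa> a * K"
      using LK[OF that] by (simp_all add: mult.assoc)
  qed
  have windows_S: "\<bar>D a\<bar> * (\<kappa> a * K) + \<sigma> a * R \<le> \<kappa> (f a) * K" if a: "a \<in> S" for a
  proof -
    have "\<bar>D a\<bar> * (\<kappa> a * K) \<le> \<theta> * \<kappa> (f a) * K"
      using mult_right_mono[OF linS[OF a], of K] K by (simp add: mult.assoc)
    moreover have "\<sigma> a * R \<le> (H.\<theta>' - \<theta>) * \<kappa> (f a) * K"
      using \<sigma>R[of a] LS[of "f a"] inv_S[OF a] by auto
    moreover have "H.\<theta>' * (\<kappa> (f a) * K) \<le> 1 * (\<kappa> (f a) * K)"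
      using H.\<theta>'_bounds H.\<kappa>_pos[of "f a"] K by (intro mult_right_mono) auto
    ultimately show ?thesis by (simp add: algebra_simps)
  qed
  have windows_U: "\<kappa> (f a) * K + \<sigma> a * R \<le> \<bar>D a\<bar> * (\<kappa> a * K)" if a: "a \<in> U" for a
  proof -
    have "\<kappa> (f a) * K / \<theta> \<le> \<bar>D a\<bar> * (\<kappa> a * K)"
      using mult_right_mono[OF linU[OF a], of K] K H.\<theta>_pos by (simp add: field_simps)
    moreover have "\<sigma> a * R \<le> (1 / \<theta> - 1 / H.\<theta>') * \<kappa> (f a) * K"
      using \<sigma>R[of a] LU[of "f a"] inv_U[OF a] by auto
    moreover have "1 * (\<kappa> (f a) * K) \<le> 1 / H.\<theta>' * (\<kappa> (f a) * K)"
      using H.\<theta>'_bounds H.\<kappa>_pos[of "f a"] K by (intro mult_right_mono) auto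
    ultimately show ?thesis by (simp add: algebra_simps)
  qed
  \<comment> \<open>An error of \<nu>' \<epsilon> is at most \<nu> times the local noise amplitude.
    The linearization tolerance below is divided by \<kappa> a * K so that it adds up to \<nu>'
    \<epsilon> across a window of radius \<epsilon> * (\<kappa> a * K).\<close>
  define \<nu>' where "\<nu>' = \<nu> * \<sigma>lb"
  have \<nu>': "0 < \<nu>'" using \<nu> \<sigma>_bounds(1) by (simp add: \<nu>'_def)
  have "\<exists>d>0. \<forall>t. \<bar>t\<bar> \<le> d \<longrightarrow>
      dist (f (a + to_circle t)) (f a + to_circle (D a * t)) \<le> \<nu>' / (\<kappa> a * K) * \<bar>t\<bar>" for a
    using circle_deriv_linearization[OF f_smooth, of "\<nu>' / (\<kappa> a * K)" a] \<nu>' H.\<kappa>_pos[of a] K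
    by (metis divide_pos_pos mult_pos_pos)
  then obtain d where d: "\<And>a. 0 < d a" "\<And>a t. \<bar>t\<bar> \<le> d a \<Longrightarrow>
      dist (f (a + to_circle t)) (f a + to_circle (D a * t)) \<le> \<nu>' / (\<kappa> a * K) * \<bar>t\<bar>"
    by metis
  have "continuous_on UNIV \<sigma>"
    using \<sigma>_smooth unfolding smooth_circle_fun_def
    by (intro continuous_on_circleI smooth_real_continuous)
  then have "\<exists>d>0. \<forall>z. dist z a < d \<longrightarrow> \<bar>\<sigma> z - \<sigma> a\<bar> < \<nu>'" for a
    using \<nu>' unfolding continuous_on_iff dist_real_def by simp
  then obtain d' where d': "\<And>a. 0 < d' a" "\<And>a z. dist z a < d' a \<Longrightarrow> \<bar>\<sigma> z - \<sigma> a\<bar> < \<nu>'"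
    by metis
  \<comment> \<open>Largest displacement from \<open>f a\<close>, in units of \<epsilon>, of a noisy
    linear step out of the window of a. For small \<epsilon> it stays below half a turn and misses
    the windows of all points of S \<union> U other than \<open>f a\<close>.\<close>
  define M where "M a = \<bar>D a\<bar> * (\<kappa> a * K) + \<sigma> a * R" for a
  have small: "\<forall>\<^sub>F \<epsilon> in at_right 0. \<epsilon> * G < g" if "0 < g" for G g :: real
  proof (rule order_tendstoD(2)[OF _ that])
    show "((\<lambda>\<epsilon>. \<epsilon> * G) \<longlongrightarrow> 0) (at_right 0)" by (auto intro!: tendsto_eq_intros)
  qed
  have "\<forall>\<^sub>F \<epsilon> in at_right 0. \<forall>a\<in>?Z. \<forall>b\<in>?Z.
      (\<epsilon> * (\<kappa> a * K) < pi \<and> \<epsilon> * (\<kappa> a * K) < d a \<and> \<epsilon> * (\<kappa> a * K) < d' a) \<and> \<epsilon> * M a < pi \<and>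
      (a \<noteq> b \<longrightarrow> \<epsilon> * (\<kappa> a * K + \<kappa> b * K) < dist a b) \<and>
      (f a \<noteq> b \<longrightarrow> \<epsilon> * (M a + \<kappa> b * K) < dist (f a) b)"
  proof (intro eventually_ball_finite finZ ballI)
    fix a b
    have sep: "\<forall>\<^sub>F \<epsilon> in at_right 0. u \<noteq> v \<longrightarrow> \<epsilon> * G < dist u v" for u v :: circle and G :: real
      using small[of "dist u v" G] by (cases "u = v") auto
    show "\<forall>\<^sub>F \<epsilon> in at_right 0.
      (\<epsilon> * (\<kappa> a * K) < pi \<and> \<epsilon> * (\<kappa> a * K) < d a \<and> \<epsilon> * (\<kappa> a * K) < d' a) \<and> \<epsilon> * M a < pi \<and>
      (a \<noteq> b \<longrightarrow> \<epsilon> * (\<kappa> a * K + \<kappa> b * K) < dist a b) \<and>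
      (f a \<noteq> b \<longrightarrow> \<epsilon> * (M a + \<kappa> b * K) < dist (f a) b)"
      by (intro eventually_conj small sep pi_gt_zero d(1) d'(1))
  qed
  moreover have "\<forall>\<^sub>F \<epsilon> in at_right 0. \<forall>z. z \<notin> core \<kappa> U (K * \<epsilon>) \<longrightarrow>
      robustly_reaches f (L * \<epsilon>) (core \<kappa> S (K * \<epsilon>)) (core \<kappa> U (K * \<epsilon>)) z"
    by (rule H.eventually_robustly_reaches[OF L K]) (auto intro: LS LU)
  moreover have "\<forall>\<^sub>F \<epsilon> in at_right (0::real). 0 < \<epsilon>" by (simp add: eventually_at_filter)
  ultimately show ?thesis
  proof eventually_elim
    case (elim \<epsilon>)
    note \<epsilon> = elim(3)
    have e1: "\<epsilon> * (\<kappa> a * K) < pi" "\<epsilon> * (\<kappa> a * K) < d a" "\<epsilon> * (\<kappa> a * K) < d' a" "\<epsilon> * M a < pi"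
      if "a \<in> ?Z" for a using elim(1) that by blast+
    have e2: "\<epsilon> * (\<kappa> a * K + \<kappa> b * K) < dist a b" if "a \<in> ?Z" "b \<in> ?Z" "a \<noteq> b" for a b
      using elim(1) that by blast
    have e3: "\<epsilon> * (M a + \<kappa> b * K) < dist (f a) b" if "a \<in> ?Z" "b \<in> ?Z" "f a \<noteq> b" for a b
      using elim(1) that by blast
    define I where "I a = cball a (\<kappa> a * (K * \<epsilon>))" for a
    have I: "z \<in> I a \<longleftrightarrow> dist z a \<le> \<epsilon> * (\<kappa> a * K)" for z a
      by (simp add: I_def dist_commute mult_ac)
    have I_unique: "b = a" if "a \<in> ?Z" "b \<in> ?Z" "z \<in> I a" "z \<in> I b" for a b z
    proof (rule ccontr)
      assume "b \<noteq> a"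
      then show False using e2[of a b] that dist_triangle[of a b z] by (auto simp: I dist_commute algebra_simps)
    qed
    \<comment> \<open>The shift e carries f z to its linearized image. Windows are disjoint, so at
      most one summand is nonzero, and writing e and s as finite sums makes them measurable at
      once.\<close>
    define e where "e z = (\<Sum>a\<in>?Z. indicator (I a) z * angle (f a + to_circle (D a * angle (z - a)) - f z))" for z
    define s where "s z = \<epsilon> * (\<sigma> z + (\<Sum>a\<in>?Z. indicator (I a) z * (\<sigma> a - \<sigma> z)))" for z
    have sum_core: "(\<Sum>a\<in>?Z. indicator (I a) z * h a) = h a" if "a \<in> ?Z" "z \<in> I a" for z a and h :: "circle \<Rightarrow> real"
    proof -
      have "(\<Sum>b\<in>?Z. indicator (I b) z * h b) = (\<Sum>b\<in>?Z. if b = a then h a else 0)"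
      proof (intro sum.cong refl)
        fix b assume b: "b \<in> ?Z"
        show "indicator (I b) z * h b = (if b = a then h a else 0)"
        proof (cases "b = a")
          case False
          then have "z \<notin> I b" using I_unique[OF that(1) b that(2)] by blast
          then show ?thesis using False by simp
        qed (use that in simp)
      qed
      then show ?thesis using finZ that by simp
    qed
    have e_core: "e z = angle (f a + to_circle (D a * angle (z - a)) - f z)"
      and s_core: "s z = \<epsilon> * \<sigma> a" if "a \<in> ?Z" "z \<in> I a" for a z
      unfolding e_def s_def sum_core[OF that] by auto
    have off: "e z = 0" "s z = \<epsilon> * \<sigma> z" if "\<And>a. a \<in> ?Z \<Longrightarrow> z \<notin> I a" for z
      unfolding e_def s_def using that by (auto intro!: sum.neutral)
    have [measurable]: "f \<in> borel_measurable borel" "\<sigma> \<in> borel_measurable borel"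
      by (rule smooth_circle_map_measurable[OF f_smooth], rule smooth_circle_fun_measurable[OF \<sigma>_smooth])
    have [measurable]: "I a \<in> sets borel" for a unfolding I_def by simp
    have e_meas [measurable]: "e \<in> borel_measurable borel" unfolding e_def by measurable
    have s_meas [measurable]: "s \<in> borel_measurable borel" unfolding s_def by measurable
    interpret X: modelled_circle_map f \<sigma> \<sigma>lb \<sigma>ub ms mu P Q p q x y cs cu \<rho> \<rho>' R \<kappa> K \<epsilon> e s
    proof
      fix a z w assume a: "a \<in> ?Z" and z: "\<bar>z\<bar> \<le> \<kappa> a * K"
      let ?x = "a + to_circle (\<epsilon> * z)"
      have "\<bar>\<epsilon> * z\<bar> \<le> \<epsilon> * (\<kappa> a * K)" using z \<epsilon> by (simp add: abs_mult)
      then have *: "\<bar>\<epsilon> * z\<bar> < pi" "?x \<in> I a"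
        using e1(1)[OF a] dist_add_to_circle_le[of a "\<epsilon> * z"] by (auto simp: I)
      have "angle (?x - a) = \<epsilon> * z"
        using *(1) by (simp add: angle_to_circle)
      then have "to_circle (e ?x) = f a + to_circle (D a * (\<epsilon> * z)) - f ?x"
        unfolding e_core[OF a *(2)] by simp
      then show "f ?x + to_circle (e ?x + s ?x * w) = f a + to_circle (\<epsilon> * (D a * z + \<sigma> a * w))"
        unfolding s_core[OF a *(2)] to_circle_add distrib_left by (simp add: mult_ac to_circle_add add.assoc)
    next
      fix z assume z: "z \<notin> core \<kappa> S (K * \<epsilon>)" "z \<notin> core \<kappa> U (K * \<epsilon>)"
      then show "e z = 0 \<and> s z = \<epsilon> * \<sigma> z" using off[of z] by (auto simp: core_def I_def)
    next
      fix a w assume a: "a \<in> U" and w: "\<kappa> (f a) * K < \<bar>w\<bar>" "\<bar>w\<bar> \<le> \<bar>D a\<bar> * (\<kappa> a * K) + \<sigma> a * R"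
      have aZ: "a \<in> ?Z" "f a \<in> ?Z" using a inv_U by auto
      have wM: "\<epsilon> * \<bar>w\<bar> \<le> \<epsilon> * M a" using w \<epsilon> by (simp add: M_def)
      then have "\<epsilon> * \<bar>w\<bar> \<le> pi" using e1(4)[OF aZ(1)] by linarith
      then have "\<bar>\<epsilon> * w\<bar> \<le> pi" using \<epsilon> by (simp add: abs_mult)
      then have dw: "dist (f a + to_circle (\<epsilon> * w)) (f a) = \<epsilon> * \<bar>w\<bar>"
        using \<epsilon> by (simp add: dist_add_to_circle abs_mult)
      show "f a + to_circle (\<epsilon> * w) \<notin> core \<kappa> U (K * \<epsilon>)"
      proof
        assume "f a + to_circle (\<epsilon> * w) \<in> core \<kappa> U (K * \<epsilon>)"
        then obtain b where b: "b \<in> U" "f a + to_circle (\<epsilon> * w) \<in> I b" by (auto simp: core_def I_def)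
        show False
        proof (cases "f a = b")
          case True
          then show ?thesis using b dw w(1) \<epsilon> by (simp add: I)
        next
          case False
          then show ?thesis
            using e3[of a b] aZ b dist_triangle[of "f a" b "f a + to_circle (\<epsilon> * w)"] dw wM
            by (simp add: I dist_commute algebra_simps)
        qed
      qed
    next
      show "robustly_reaches f (\<sigma>ub * R * \<epsilon>) (core \<kappa> S (K * \<epsilon>)) (core \<kappa> U (K * \<epsilon>)) z"
        if "z \<notin> core \<kappa> U (K * \<epsilon>)" for z
        using elim(2) that by (simp add: L_def)
    qed (use \<epsilon> K H.\<kappa>_pos windows_S windows_U in \<open>auto simp del: mult_pos_pos\<close>)
    have es: "\<bar>e z\<bar> \<le> \<nu>' * \<epsilon> \<and> \<bar>s z - \<epsilon> * \<sigma> z\<bar> \<le> \<nu>' * \<epsilon> \<and> 0 < s z" for z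
    proof (cases "\<exists>a\<in>?Z. z \<in> I a")
      case True
      then obtain a where a: "a \<in> ?Z" "z \<in> I a" by blast
      have za: "dist z a \<le> \<epsilon> * (\<kappa> a * K)" using a(2) by (simp add: I)
      have "\<bar>e z\<bar> = dist (f z) (f a + to_circle (D a * angle (z - a)))"
        unfolding e_core[OF a] by (simp add: abs_angle dist_commute)
      also have "\<dots> \<le> \<nu>' / (\<kappa> a * K) * dist z a"
        using d(2)[of "angle (z - a)" a] za e1(2)[OF a(1)] by (simp add: abs_angle)
      also have "\<dots> \<le> \<nu>' / (\<kappa> a * K) * (\<epsilon> * (\<kappa> a * K))"
        using \<nu>' K H.\<kappa>_pos[of a] za by (intro mult_left_mono) auto
      also have "\<dots> = \<nu>' * \<epsilon>" using K H.\<kappa>_pos[of a] by simp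
      finally have "\<bar>e z\<bar> \<le> \<nu>' * \<epsilon>" .
      moreover have "\<bar>\<sigma> z - \<sigma> a\<bar> < \<nu>'" using za e1(3)[OF a(1)] by (intro d'(2)) simp
      then have "\<epsilon> * \<bar>\<sigma> a - \<sigma> z\<bar> \<le> \<nu>' * \<epsilon>"
        using \<epsilon> by (simp add: abs_minus_commute mult.commute)
      then have "\<bar>s z - \<epsilon> * \<sigma> z\<bar> \<le> \<nu>' * \<epsilon>"
        unfolding s_core[OF a] using \<epsilon> by (simp add: right_diff_distrib[symmetric] abs_mult)
      ultimately show ?thesis using s_core[OF a] \<epsilon> \<sigma>_pos by simp
    next
      case False
      then show ?thesis using off[of z] \<epsilon> \<nu>' \<sigma>_pos by auto
    qed
    have close: "(\<integral>v. \<bar>\<rho> ((v - e z / (\<epsilon> * \<sigma> z)) / (s z / (\<epsilon> * \<sigma> z))) / (s z / (\<epsilon> * \<sigma> z)) - \<rho> v\<bar> \<partial>lborel) \<le> r / 4"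
      for z
    proof (rule less_imp_le[OF \<nu>(3)])
      have \<epsilon>\<sigma>: "0 < \<epsilon> * \<sigma> z" using \<epsilon> \<sigma>_pos[of z] by simp
      have "\<nu>' * \<epsilon> = \<nu> * (\<epsilon> * \<sigma>lb)" by (simp add: \<nu>'_def)
      also have "\<dots> \<le> \<nu> * (\<epsilon> * \<sigma> z)" using \<nu> \<epsilon> \<sigma>_bounds(2)[of z] by (intro mult_left_mono) auto
      finally have le: "\<nu>' * \<epsilon> \<le> \<nu> * (\<epsilon> * \<sigma> z)" .
      have "\<bar>e z / (\<epsilon> * \<sigma> z)\<bar> = \<bar>e z\<bar> / (\<epsilon> * \<sigma> z)" using \<epsilon>\<sigma> by (simp only: abs_divide abs_of_pos)
      then show "\<bar>e z / (\<epsilon> * \<sigma> z)\<bar> \<le> \<nu>"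
        using es[of z] le \<epsilon>\<sigma> by (simp add: pos_divide_le_eq)
      have "s z / (\<epsilon> * \<sigma> z) - 1 = (s z - \<epsilon> * \<sigma> z) / (\<epsilon> * \<sigma> z)"
        using \<epsilon> \<sigma>_pos[of z] by (simp add: diff_divide_distrib)
      then have "\<bar>s z / (\<epsilon> * \<sigma> z) - 1\<bar> = \<bar>s z - \<epsilon> * \<sigma> z\<bar> / (\<epsilon> * \<sigma> z)"
        using \<epsilon>\<sigma> by (simp only: abs_divide abs_of_pos)
      then show "\<bar>s z / (\<epsilon> * \<sigma> z) - 1\<bar> \<le> \<nu>"
        using es[of z] le \<epsilon>\<sigma> by (simp add: pos_divide_le_eq)
    qed
    have "norm (transition_op f \<sigma> \<epsilon> - N.perturbed_op f e s) \<le> r / 2 + r / 4"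
      using near es by (intro N.norm_transition_perturbed close \<epsilon> \<sigma>_pos) auto
    then have "norm (transition_op f \<sigma> \<epsilon> - N.perturbed_op f e s) < r" using assms by simp
    then show ?case using X.eigenvalue by blast
  qed
qed

theorem theorem1:
  fixes f :: "circle \<Rightarrow> circle"
    and \<sigma> :: "circle \<Rightarrow> real"
    and \<sigma>lb \<sigma>ub :: real
    and ms mu :: nat
    and P Q :: "nat \<Rightarrow> circle set"
    and p q :: "nat \<Rightarrow> nat"
    and x y :: "nat \<Rightarrow> circle"
    and cs cu :: "nat \<Rightarrow> real"
  assumes f_smooth: "smooth_circle_map f"
    and \<sigma>_smooth: "smooth_circle_fun \<sigma>"
    and \<sigma>_bounds: "0 < \<sigma>lb" "\<And>z. \<sigma>lb < \<sigma> z \<and> \<sigma> z < \<sigma>ub"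
    and stable: "\<And>i. i \<in> {1..ms} \<Longrightarrow> stable_orbit f (p i) (P i)"
    and unstable: "\<And>i. i \<in> {1..mu} \<Longrightarrow> unstable_orbit f (q i) (Q i)"
    and all_stable: "{A. \<exists>n. stable_orbit f n A} = P ` {1..ms}"
    and all_unstable: "{A. \<exists>n. unstable_orbit f n A} = Q ` {1..mu}"
    and cs: "\<And>i. i \<in> {1..ms} \<Longrightarrow> x i \<in> P i \<and> cs i = circle_deriv (f ^^ p i) (x i)"
    and cu: "\<And>i. i \<in> {1..mu} \<Longrightarrow> y i \<in> Q i \<and> cu i = circle_deriv (f ^^ q i) (y i)"
    and attract: "\<And>z. z \<notin> (\<Union>i\<in>{1..mu}. Q i) \<Longrightarrow> orbit_converges_to f z (\<Union>i\<in>{1..ms}. P i)"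
  shows "\<forall>r>0. \<exists>(Tup :: real \<Rightarrow> bborel \<Rightarrow>\<^sub>L bborel) (Tlp :: real \<Rightarrow> bborel \<Rightarrow>\<^sub>L bborel).
    (\<forall>\<epsilon>>0. transition_op f \<sigma> \<epsilon> = Tup \<epsilon> + Tlp \<epsilon>) \<and>
    (\<exists>C. \<forall>\<^sub>F \<epsilon> in at_right 0.
      norm (Tlp \<epsilon>) < r \<and>
      (\<forall>\<mu>. complex_eigenvalue (Tup \<epsilon>) \<mu> \<and> cmod \<mu> > r \<longrightarrow>
        (\<exists>lam::complex. cmod (\<mu> - lam) \<le> C * \<epsilon> \<and>
          ((\<exists>i\<in>{1..ms}. \<exists>j::nat. lam ^ p i = of_real (cs i ^ j)) \<or>
           (\<exists>i\<in>{1..mu}. \<exists>j::nat. lam ^ q i = of_real (inverse \<bar>cu i\<bar> * inverse (cu i ^ j)))))))"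
proof (intro allI impI)
  fix r :: real assume r: "0 < r"
  interpret hyperbolic_circle_map f \<sigma> \<sigma>lb \<sigma>ub ms mu P Q p q x y cs cu
    by unfold_locales (fact f_smooth \<sigma>_smooth \<sigma>_bounds stable unstable cs cu attract)+
  define good where "good \<epsilon> X \<longleftrightarrow> norm (transition_op f \<sigma> \<epsilon> - X) < r \<and>
    (\<forall>\<mu>. complex_eigenvalue X \<mu> \<and> \<mu> \<noteq> 0 \<longrightarrow>
      (\<exists>i\<in>{1..ms}. \<exists>j. \<mu> ^ p i = of_real (cs i ^ j)) \<or>
      (\<exists>i\<in>{1..mu}. \<exists>j. \<mu> ^ q i = of_real (inverse \<bar>cu i\<bar> * inverse (cu i ^ j))))" for \<epsilon> X
  \<comment> \<open>A model exists only for small \<epsilon>; for other \<epsilon> the choice is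
    arbitrary, which does no harm because the lower part is taken to be the remainder.\<close>
  define Tup where "Tup \<epsilon> = (SOME X. good \<epsilon> X)" for \<epsilon>
  have ev: "\<forall>\<^sub>F \<epsilon> in at_right 0. good \<epsilon> (Tup \<epsilon>)"
    using eventually_modelled[OF r] unfolding good_def[symmetric] Tup_def
    by eventually_elim (rule someI_ex)
  show "\<exists>(Tup :: real \<Rightarrow> bborel \<Rightarrow>\<^sub>L bborel) (Tlp :: real \<Rightarrow> bborel \<Rightarrow>\<^sub>L bborel).
    (\<forall>\<epsilon>>0. transition_op f \<sigma> \<epsilon> = Tup \<epsilon> + Tlp \<epsilon>) \<and>
    (\<exists>C. \<forall>\<^sub>F \<epsilon> in at_right 0.
      norm (Tlp \<epsilon>) < r \<and>
      (\<forall>\<mu>. complex_eigenvalue (Tup \<epsilon>) \<mu> \<and> cmod \<mu> > r \<longrightarrow>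
        (\<exists>lam::complex. cmod (\<mu> - lam) \<le> C * \<epsilon> \<and>
          ((\<exists>i\<in>{1..ms}. \<exists>j::nat. lam ^ p i = of_real (cs i ^ j)) \<or>
           (\<exists>i\<in>{1..mu}. \<exists>j::nat. lam ^ q i = of_real (inverse \<bar>cu i\<bar> * inverse (cu i ^ j)))))))"
  proof (rule exI[of _ Tup], rule exI[of _ "\<lambda>\<epsilon>. transition_op f \<sigma> \<epsilon> - Tup \<epsilon>"], intro conjI exI[of _ 0])
    show "\<forall>\<^sub>F \<epsilon> in at_right 0. norm (transition_op f \<sigma> \<epsilon> - Tup \<epsilon>) < r \<and>
      (\<forall>\<mu>. complex_eigenvalue (Tup \<epsilon>) \<mu> \<and> cmod \<mu> > r \<longrightarrow>
        (\<exists>lam::complex. cmod (\<mu> - lam) \<le> 0 * \<epsilon> \<and>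
          ((\<exists>i\<in>{1..ms}. \<exists>j::nat. lam ^ p i = of_real (cs i ^ j)) \<or>
           (\<exists>i\<in>{1..mu}. \<exists>j::nat. lam ^ q i = of_real (inverse \<bar>cu i\<bar> * inverse (cu i ^ j))))))"
      using ev
    proof eventually_elim
      case (elim \<epsilon>)
      show ?case
      proof (intro conjI allI impI)
        show "norm (transition_op f \<sigma> \<epsilon> - Tup \<epsilon>) < r" using elim by (simp add: good_def)
        fix \<mu> assume \<mu>: "complex_eigenvalue (Tup \<epsilon>) \<mu> \<and> cmod \<mu> > r"
        then have "\<mu> \<noteq> 0" using r by auto
        then show "\<exists>lam::complex. cmod (\<mu> - lam) \<le> 0 * \<epsilon> \<and>
          ((\<exists>i\<in>{1..ms}. \<exists>j::nat. lam ^ p i = of_real (cs i ^ j)) \<or>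
           (\<exists>i\<in>{1..mu}. \<exists>j::nat. lam ^ q i = of_real (inverse \<bar>cu i\<bar> * inverse (cu i ^ j))))"
          using elim \<mu> unfolding good_def by (intro exI[of _ \<mu>]) auto
      qed
    qed
  qed simp
qed

end
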